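(* Let $M$ be a Riemann surface and let $B:M\to Sl_2(\mathbb C)$ be a holomorphic map such that there exist nowhere vanishing holomorphic $1$-forms $\theta,\omega$ on $M$ satisfying $$B^{-1}dB=\begin{pmatrix}0&\theta\\ \omega&0\end{pmatrix}.$$ Assume moreover that $\Im m\left(\frac{\omega}{\theta}\right)\neq0$. Then $$F:=B\begin{pmatrix}0&i\\ i&0\end{pmatrix}B^*:M\longrightarrow\mathbb S^{2,1}$$ defines, with the induced metric, a flat timelike isometric immersion. Conversely, let $F:M\to\mathbb S^{2,1}$ be an isometric immersion of a simply connected flat timelike surface $M$ in the De Sitter space $\mathbb S^{2,1}$. Then there exist a Riemann surface structure on $M$, a holomorphic map $B:M\to Sl_2(\mathbb C)$ and nowhere vanishing holomorphic $1$-forms $\theta,\omega$ on $M$ with $\Im m\left(\frac{\omega}{\theta}\right)\neq0$ such that $$B^{-1}dB=\begin{pmatrix}0&\theta\\ \omega&0\end{pmatrix}\qquad\text{and}\qquad F=B\begin{pmatrix}0&i\\ i&0\end{pmatrix}B^*.$$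
   Context: $B^*$ denotes the conjugate transpose of $B$. Minkowski space $\mathbb R^{3,1}$ (signature $(3,1)$) is identified with $i\,Herm(2)$, the real space of matrices $iA$ with $A$ a $2\times2$ Hermitian matrix, with the quadratic form $\det$ as the Minkowski metric. The De Sitter space $\mathbb S^{2,1}=\{x\in\mathbb R^{3,1}:\langle x,x\rangle=1\}$ is then $$\mathbb S^{2,1}=\left\{B\begin{pmatrix}0&i\\ i&0\end{pmatrix}B^*: B\in Sl_2(\mathbb C)\right\}\subset i\,Herm(2).$$ A surface is timelike if its induced metric has signature $(1,1)$, and flat if its Gauss curvature vanishes. $\Im m(\omega/\theta)$ denotes the imaginary part of $\omega/\theta$, and $\Im m(\omega/\theta)\ne0$ is required at every point. *)

theory Defs
  imports "HOL-Complex_Analysis.Complex_Analysis"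
begin

text \<open>These are the usual classes for open sets only.  In the successor case the derivative is
  contracted with a fixed vector, so that \<^term>\<open>v\<close> ranges over all directional derivatives.\<close>

primrec C_k_on ::
  "nat \<Rightarrow> 'a set \<Rightarrow> ('a::real_normed_vector \<Rightarrow> 'b::real_normed_vector) \<Rightarrow> bool" where
  "C_k_on 0 S f \<longleftrightarrow> continuous_on S f"
| "C_k_on (Suc k) S f \<longleftrightarrow> (\<forall>x\<in>S. f differentiable (at x)) \<and>
     (\<forall>v. C_k_on k S (\<lambda>x. frechet_derivative f (at x) v))"

definition smooth_on ::
  "'a set \<Rightarrow> ('a::real_normed_vector \<Rightarrow> 'b::real_normed_vector) \<Rightarrow> bool" where
  "smooth_on S f \<longleftrightarrow> (\<forall>k. C_k_on k S f)"

text \<open>A chart is a pair of its domain and its coordinate map.  The model plane is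
  \<^typ>\<open>complex\<close> throughout; for a merely smooth surface it is read as the real plane.
  Functions such as a coordinate map are only meaningful on their domains.\<close>

type_synonym 'a chart = "'a set \<times> ('a \<Rightarrow> complex)"

definition coords :: "'a chart \<Rightarrow> complex set" where
  "coords c = snd c ` fst c"

definition param :: "'a chart \<Rightarrow> complex \<Rightarrow> 'a" where
  "param c = inv_into (fst c) (snd c)"

definition chart_on :: "'a::topological_space set \<Rightarrow> 'a chart \<Rightarrow> bool" where
  "chart_on M c \<longleftrightarrow> openin (top_of_set M) (fst c) \<and> open (coords c) \<and>
     homeomorphism (fst c) (coords c) (snd c) (param c)"

definition overlap :: "'a chart \<Rightarrow> 'a chart \<Rightarrow> complex set" where
  "overlap c d = snd c ` (fst c \<inter> fst d)"

definition transition :: "'a chart \<Rightarrow> 'a chart \<Rightarrow> complex \<Rightarrow> complex" where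
  "transition c d = snd d \<circ> param c"

definition second_countable_set :: "'a::topological_space set \<Rightarrow> bool" where
  "second_countable_set M \<longleftrightarrow> (\<exists>\<B>. countable \<B> \<and> (\<forall>V\<in>\<B>. openin (top_of_set M) V) \<and>
     (\<forall>U. openin (top_of_set M) U \<longrightarrow> (\<exists>\<U>\<subseteq>\<B>. U = \<Union>\<U>)))"

definition topological_surface :: "'a::topological_space set \<Rightarrow> 'a chart set \<Rightarrow> bool" where
  "topological_surface M A \<longleftrightarrow>
     connected M \<and> Hausdorff_space (top_of_set M) \<and> second_countable_set M \<and>
     (\<forall>c\<in>A. chart_on M c) \<and> (\<Union>c\<in>A. fst c) = M"

definition smooth_surface :: "'a::topological_space set \<Rightarrow> 'a chart set \<Rightarrow> bool" where
  "smooth_surface M A \<longleftrightarrow> topological_surface M A \<and>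
     (\<forall>c\<in>A. \<forall>d\<in>A. smooth_on (overlap c d) (transition c d))"

text \<open>For a Riemann surface second countability is automatic (Rado), so requiring it here does
  not exclude any.\<close>

definition riemann_surface :: "'a::topological_space set \<Rightarrow> 'a chart set \<Rightarrow> bool" where
  "riemann_surface M A \<longleftrightarrow> topological_surface M A \<and>
     (\<forall>c\<in>A. \<forall>d\<in>A. transition c d holomorphic_on overlap c d)"

text \<open>A one-form is given by its coefficients: in the coordinate \<^term>\<open>z\<close> of a chart
  \<^term>\<open>c\<close> it is \<^term>\<open>\<theta> c z\<close> times \<open>dz\<close>.\<close>

definition holomorphic_1form ::
  "'a chart set \<Rightarrow> ('a chart \<Rightarrow> complex \<Rightarrow> complex) \<Rightarrow> bool" where
  "holomorphic_1form A \<theta> \<longleftrightarrow> (\<forall>c\<in>A. \<theta> c holomorphic_on coords c) \<and>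
     (\<forall>c\<in>A. \<forall>d\<in>A. \<forall>z\<in>overlap c d.
        \<theta> c z = \<theta> d (transition c d z) * deriv (transition c d) z)"

definition nowhere_vanishing ::
  "'a chart set \<Rightarrow> ('a chart \<Rightarrow> complex \<Rightarrow> complex) \<Rightarrow> bool" where
  "nowhere_vanishing A \<theta> \<longleftrightarrow> (\<forall>c\<in>A. \<forall>z\<in>coords c. \<theta> c z \<noteq> 0)"

text \<open>The quotient of two one-forms is a function on the surface; in a chart it is the quotient
  of the coefficients.\<close>

definition Im_quotient_nonzero ::
  "'a chart set \<Rightarrow> ('a chart \<Rightarrow> complex \<Rightarrow> complex) \<Rightarrow> ('a chart \<Rightarrow> complex \<Rightarrow> complex) \<Rightarrow> bool" where
  "Im_quotient_nonzero A \<omega> \<theta> \<longleftrightarrow> (\<forall>c\<in>A. \<forall>z\<in>coords c. Im (\<omega> c z / \<theta> c z) \<noteq> 0)"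

definition holomorphic_to_SL2 ::
  "'a set \<Rightarrow> 'a chart set \<Rightarrow> ('a \<Rightarrow> complex^2^2) \<Rightarrow> bool" where
  "holomorphic_to_SL2 M A B \<longleftrightarrow> (\<forall>p\<in>M. det (B p) = 1) \<and>
     (\<forall>c\<in>A. \<forall>i j. (\<lambda>z. B (param c z) $ i $ j) holomorphic_on coords c)"

text \<open>The \<open>dz\<close>-coefficient of \<open>B\<^sup>-\<^sup>1 dB\<close>.\<close>

definition maurer_cartan ::
  "('a \<Rightarrow> complex^2^2) \<Rightarrow> 'a chart \<Rightarrow> complex \<Rightarrow> complex^2^2" where
  "maurer_cartan B c z =
     matrix_inv (B (param c z)) ** (\<chi> i j. deriv (\<lambda>w. B (param c w) $ i $ j) z)"

definition has_maurer_cartan_form ::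
  "'a chart set \<Rightarrow> ('a \<Rightarrow> complex^2^2) \<Rightarrow> ('a chart \<Rightarrow> complex \<Rightarrow> complex) \<Rightarrow>
   ('a chart \<Rightarrow> complex \<Rightarrow> complex) \<Rightarrow> bool" where
  "has_maurer_cartan_form A B \<theta> \<omega> \<longleftrightarrow> (\<forall>c\<in>A. \<forall>z\<in>coords c.
     maurer_cartan B c z = vector [vector [0, \<theta> c z], vector [\<omega> c z, 0]])"

definition conj_transpose :: "complex^'n^'m \<Rightarrow> complex^'m^'n" where
  "conj_transpose X = (\<chi> i j. cnj (X $ j $ i))"

definition scalar_i :: "complex^2^2 \<Rightarrow> complex^2^2" where
  "scalar_i X = (\<chi> i j. \<i> * X $ i $ j)"

definition i_Herm2 :: "(complex^2^2) set" where
  "i_Herm2 = scalar_i ` {X. conj_transpose X = X}"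

text \<open>The polarization of \<open>det\<close>, which is real-valued on \<^term>\<open>i_Herm2\<close>.\<close>

definition minkowski :: "complex^2^2 \<Rightarrow> complex^2^2 \<Rightarrow> real" where
  "minkowski X Y = Re (det (X + Y) - det X - det Y) / 2"

definition de_sitter :: "(complex^2^2) set" where
  "de_sitter = {X \<in> i_Herm2. minkowski X X = 1}"

definition J_mat :: "complex^2^2" where
  "J_mat = vector [vector [0, \<i>], vector [\<i>, 0]]"

text \<open>A metric is given by its coordinate expressions: \<^term>\<open>g c z\<close> is a bilinear form on
  the real plane.\<close>

type_synonym 'a metric_field = "'a chart \<Rightarrow> complex \<Rightarrow> complex \<Rightarrow> complex \<Rightarrow> real"

definition symmetric_bilinear :: "(complex \<Rightarrow> complex \<Rightarrow> real) \<Rightarrow> bool" where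
  "symmetric_bilinear b \<longleftrightarrow> bilinear b \<and> (\<forall>u v. b u v = b v u)"

text \<open>Existence of a pseudo-orthonormal basis; independence of the two vectors is implied.\<close>

definition signature_1_1 :: "(complex \<Rightarrow> complex \<Rightarrow> real) \<Rightarrow> bool" where
  "signature_1_1 b \<longleftrightarrow> symmetric_bilinear b \<and> (\<exists>u v. b u u = 1 \<and> b v v = -1 \<and> b u v = 0)"

definition timelike_metric :: "'a chart set \<Rightarrow> 'a metric_field \<Rightarrow> bool" where
  "timelike_metric A g \<longleftrightarrow>
     (\<forall>c\<in>A. \<forall>u v. smooth_on (coords c) (\<lambda>z. g c z u v)) \<and>
     (\<forall>c\<in>A. \<forall>z\<in>coords c. signature_1_1 (g c z)) \<and>
     (\<forall>c\<in>A. \<forall>d\<in>A. \<forall>z\<in>overlap c d. \<forall>u v.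
        g c z u v = g d (transition c d z)
          (frechet_derivative (transition c d) (at z) u)
          (frechet_derivative (transition c d) (at z) v))"

definition unit_dir :: "2 \<Rightarrow> complex" where
  "unit_dir i = (if i = 1 then 1 else \<i>)"

definition partial :: "2 \<Rightarrow> (complex \<Rightarrow> real) \<Rightarrow> complex \<Rightarrow> real" where
  "partial i f z = frechet_derivative f (at z) (unit_dir i)"

definition gram :: "(complex \<Rightarrow> complex \<Rightarrow> complex \<Rightarrow> real) \<Rightarrow> complex \<Rightarrow> real^2^2" where
  "gram h z = (\<chi> i j. h z (unit_dir i) (unit_dir j))"

text \<open>\<open>\<Gamma>\<^sup>k\<^sub>i\<^sub>j\<close> of the Levi-Civita connection.\<close>

definition christoffel :: "(complex \<Rightarrow> real^2^2) \<Rightarrow> 2 \<Rightarrow> 2 \<Rightarrow> 2 \<Rightarrow> complex \<Rightarrow> real" where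
  "christoffel G k i j z = (\<Sum>l\<in>UNIV. matrix_inv (G z) $ k $ l *
     (partial i (\<lambda>w. G w $ j $ l) z + partial j (\<lambda>w. G w $ i $ l) z
      - partial l (\<lambda>w. G w $ i $ j) z)) / 2"

text \<open>The \<open>l\<close>-th component of \<open>R(\<partial>\<^sub>i, \<partial>\<^sub>j) \<partial>\<^sub>k\<close>, with
  \<open>R(X,Y) = \<nabla>\<^sub>X \<nabla>\<^sub>Y - \<nabla>\<^sub>Y \<nabla>\<^sub>X - \<nabla>\<^sub>[\<^sub>X\<^sub>,\<^sub>Y\<^sub>]\<close>.\<close>

definition riemann_tensor :: "(complex \<Rightarrow> real^2^2) \<Rightarrow> 2 \<Rightarrow> 2 \<Rightarrow> 2 \<Rightarrow> 2 \<Rightarrow> complex \<Rightarrow> real" where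
  "riemann_tensor G l i j k z =
     partial i (christoffel G l j k) z - partial j (christoffel G l i k) z +
     (\<Sum>m\<in>UNIV. christoffel G l i m z * christoffel G m j k z
               - christoffel G l j m z * christoffel G m i k z)"

definition gauss_curvature :: "(complex \<Rightarrow> real^2^2) \<Rightarrow> complex \<Rightarrow> real" where
  "gauss_curvature G z = (\<Sum>l\<in>UNIV. G z $ 1 $ l * riemann_tensor G l 1 2 2 z) / det (G z)"

definition flat_metric :: "'a chart set \<Rightarrow> 'a metric_field \<Rightarrow> bool" where
  "flat_metric A g \<longleftrightarrow> (\<forall>c\<in>A. \<forall>z\<in>coords c. gauss_curvature (gram (g c)) z = 0)"

definition flat_timelike_surface ::
  "'a::topological_space set \<Rightarrow> 'a chart set \<Rightarrow> 'a metric_field \<Rightarrow> bool" where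
  "flat_timelike_surface M A g \<longleftrightarrow>
     smooth_surface M A \<and> timelike_metric A g \<and> flat_metric A g"

definition differential ::
  "('a \<Rightarrow> complex^2^2) \<Rightarrow> 'a chart \<Rightarrow> complex \<Rightarrow> complex \<Rightarrow> complex^2^2" where
  "differential F c z = frechet_derivative (F \<circ> param c) (at z)"

definition induced_metric :: "('a \<Rightarrow> complex^2^2) \<Rightarrow> 'a metric_field" where
  "induced_metric F c z u v = minkowski (differential F c z u) (differential F c z v)"

definition immersion_in_de_sitter ::
  "'a set \<Rightarrow> 'a chart set \<Rightarrow> ('a \<Rightarrow> complex^2^2) \<Rightarrow> bool" where
  "immersion_in_de_sitter M A F \<longleftrightarrow> F ` M \<subseteq> de_sitter \<and>
     (\<forall>c\<in>A. smooth_on (coords c) (F \<circ> param c)) \<and>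
     (\<forall>c\<in>A. \<forall>z\<in>coords c. inj (differential F c z))"

definition isometric_immersion_in_de_sitter ::
  "'a set \<Rightarrow> 'a chart set \<Rightarrow> 'a metric_field \<Rightarrow> ('a \<Rightarrow> complex^2^2) \<Rightarrow> bool" where
  "isometric_immersion_in_de_sitter M A g F \<longleftrightarrow> immersion_in_de_sitter M A F \<and>
     (\<forall>c\<in>A. \<forall>z\<in>coords c. \<forall>u v. g c z u v = induced_metric F c z u v)"

end

theory Submission
  imports Defs
begin

text \<open>Write \<open>B\<^sup>-\<^sup>1 dB\<close> with diagonal entry \<open>\<mu>\<close> and off-diagonal entries \<open>\<theta>, \<omega>\<close>.  For
  \<open>F = B J B\<^sup>*\<close> one finds \<open>dF = B D B\<^sup>*\<close>, where \<open>D\<close> has the diagonal entries \<open>2i Re \<theta>\<close>, \<open>2i Re \<omega>\<close>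
  and off-diagonal entries \<open>\<plusminus> 2 Im \<mu>\<close>.  If \<open>\<mu> = 0\<close>, the induced metric is thus \<open>- 4 Re \<theta> Re \<omega>\<close>; it
  is flat because \<open>Re \<theta>\<close> and \<open>Re \<omega>\<close> are closed.

  Conversely a flat timelike metric is locally \<open>- 4 \<alpha> \<beta>\<close> with closed real one-forms \<open>\<alpha>, \<beta>\<close>, and the
  null frame dual to them, together with \<open>F\<close>, lifts to a frame \<open>B\<close> in \<open>Sl\<^sub>2\<close>.  Comparison of \<open>dF\<close> gives
  \<open>Re \<theta> = \<alpha>\<close>, \<open>Re \<omega> = \<beta>\<close> and \<open>Im \<mu> = 0\<close>, and the real part of the structure equation
  \<open>d\<theta> + 2 \<mu> \<and> \<theta> = 0 = d\<omega> - 2 \<mu> \<and> \<omega>\<close> forces \<open>\<mu> = 0\<close>.  What is left of it, \<open>d\<theta> = 0\<close>, \<open>d\<omega> = 0\<close> and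
  \<open>\<theta> \<and> \<omega> = 0\<close>, says that primitives of \<open>\<theta>\<close> are complex coordinates in which \<open>B\<close> is holomorphic.  The
  local frames are unique up to constant factors, so they extend along paths to the simply
  connected surface.\<close>

text \<open>Without the next line every indexing operator is also parsed as a power series coefficient.\<close>

no_notation fps_nth (infixl "$" 75)

section \<open>Smooth maps\<close>

text \<open>The differential of the surface sees only the real parts of the off-diagonal entries and
  the imaginary part of the diagonal one; the other half of \<open>B\<^sup>-\<^sup>1 dB\<close> is
  reached through integrability alone. Since \<theta> \<and> \<omega> vanishes while the real parts
  are independent, \<omega> is a non-real multiple l \<theta>; hence \<theta> is injective on real
  tangent vectors, and its primitives are local diffeomorphisms. They differ by constants, so in the
  new atlas \<theta> is dz and \<omega> is l dz, with l holomorphic as an entry of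
  \<open>B\<^sup>-\<^sup>1 dB\<close>. No frame is canonical: the constant factors are the monomial
  matrices that fix \<open>J_mat\<close>. They scale \<alpha> and \<beta> by inverse positive
  constants or exchange the two, and this freedom is what makes the passage to a global frame a
  question of monodromy. A lift to Sl_2 also needs a time orientation: \<open>conjg B\<close> takes
  \<open>diag2 (2 * \<i>) 0\<close> to \<i> times a positive semidefinite matrix, so the first null
  vector has to be future directed, which fixes the common sign of \<alpha> and \<beta>.\<close>

abbreviation dirD :: "('a::real_normed_vector \<Rightarrow> 'b::real_normed_vector) \<Rightarrow> 'a \<Rightarrow> 'a \<Rightarrow> 'b" where
  "dirD f v \<equiv> (\<lambda>x. frechet_derivative f (at x) v)"

text \<open>No differentiability is assumed: \<open>frechet_derivative\<close> picks an element from
  the set of all derivatives at the point, and that set depends only on the function near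
  it.\<close>

lemma frechet_derivative_cong_open:
  assumes "open S" "x \<in> S" "\<And>y. y \<in> S \<Longrightarrow> f y = g y"
  shows "frechet_derivative f (at x) = frechet_derivative g (at x)"
proof -
  have "(f has_derivative D) (at x) \<longleftrightarrow> (g has_derivative D) (at x)" for D
    using assms by (metis has_derivative_transform_within_open)
  then show ?thesis
    unfolding frechet_derivative_def by simp
qed

lemma differentiable_cong_open:
  assumes "open S" "x \<in> S" "\<And>y. y \<in> S \<Longrightarrow> f y = g y"
  shows "f differentiable (at x) \<longleftrightarrow> g differentiable (at x)"
  unfolding differentiable_def using assms by (metis has_derivative_transform_within_open)

lemma C_k_on_cong:
  assumes "open S" "\<And>x. x \<in> S \<Longrightarrow> f x = g x"
  shows "C_k_on k S f \<longleftrightarrow> C_k_on k S g"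
  using assms(2)
proof (induction k arbitrary: f g)
  case 0
  then show ?case by (simp cong: continuous_on_cong)
next
  case (Suc k)
  have "C_k_on k S (dirD f v) \<longleftrightarrow> C_k_on k S (dirD g v)" for v
    by (rule Suc.IH) (metis frechet_derivative_cong_open[OF assms(1)] Suc.prems)
  moreover have "f differentiable (at x) \<longleftrightarrow> g differentiable (at x)" if "x \<in> S" for x
    using differentiable_cong_open[OF assms(1) that] Suc.prems by blast
  ultimately show ?case by simp
qed

lemma smooth_on_cong:
  assumes "open S" "\<And>x. x \<in> S \<Longrightarrow> f x = g x"
  shows "smooth_on S f \<longleftrightarrow> smooth_on S g"
  using C_k_on_cong[OF assms] by (simp add: smooth_on_def)

lemma C_k_on_SucD: "C_k_on (Suc k) S f \<Longrightarrow> C_k_on k S f"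
proof (induction k arbitrary: f)
  case 0
  then show ?case
    by (auto intro!: continuous_at_imp_continuous_on differentiable_imp_continuous_within)
next
  case (Suc k)
  then show ?case by (metis C_k_on.simps(2))
qed

text \<open>The recursion turns coinductive: the right side yields every class \<open>Suc k\<close>
  at once, and \<open>C_k_on_SucD\<close> brings these down to every \<open>k\<close>, including
  \<open>0\<close>.\<close>

lemma smooth_on_alt:
  "smooth_on S f \<longleftrightarrow> (\<forall>x\<in>S. f differentiable (at x)) \<and> (\<forall>v. smooth_on S (dirD f v))"
proof
  assume "smooth_on S f"
  then have "C_k_on (Suc k) S f" for k by (simp add: smooth_on_def)
  then show "(\<forall>x\<in>S. f differentiable (at x)) \<and> (\<forall>v. smooth_on S (dirD f v))"
    by (auto simp: smooth_on_def)
next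
  assume *: "(\<forall>x\<in>S. f differentiable (at x)) \<and> (\<forall>v. smooth_on S (dirD f v))"
  then have "C_k_on (Suc k) S f" for k by (simp add: smooth_on_def)
  then show "smooth_on S f"
    unfolding smooth_on_def using C_k_on_SucD by blast
qed

lemma smooth_on_differentiable: "smooth_on S f \<Longrightarrow> x \<in> S \<Longrightarrow> f differentiable (at x)"
  by (simp add: smooth_on_alt[of S f])

lemma smooth_on_has_derivative:
  "smooth_on S f \<Longrightarrow> x \<in> S \<Longrightarrow> (f has_derivative frechet_derivative f (at x)) (at x)"
  using frechet_derivative_works smooth_on_differentiable by blast

lemma smooth_on_dirD: "smooth_on S f \<Longrightarrow> smooth_on S (dirD f v)"
  using smooth_on_alt by blast

lemma smooth_on_imp_continuous_on: "smooth_on S f \<Longrightarrow> continuous_on S f"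
  unfolding smooth_on_def by (metis C_k_on.simps(1))

lemma C_k_on_subset: "C_k_on k S f \<Longrightarrow> T \<subseteq> S \<Longrightarrow> C_k_on k T f"
  by (induction k arbitrary: f) (auto intro: continuous_on_subset)

lemma smooth_on_subset: "smooth_on S f \<Longrightarrow> T \<subseteq> S \<Longrightarrow> smooth_on T f"
  unfolding smooth_on_def by (metis C_k_on_subset)

lemma smooth_on_local:
  assumes "\<And>x. x \<in> S \<Longrightarrow> \<exists>T. open T \<and> x \<in> T \<and> smooth_on T f"
  shows "smooth_on S f"
proof -
  have "C_k_on k S f" if "\<And>x. x \<in> S \<Longrightarrow> \<exists>T. open T \<and> x \<in> T \<and> C_k_on k T f" for k
    using that
  proof (induction k arbitrary: f)
    case 0
    then show ?case
      by (simp add: continuous_on_eq_continuous_at continuous_at_imp_continuous_on) 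
        (metis continuous_at_imp_continuous_on continuous_on_eq_continuous_at)
  next
    case (Suc k)
    have "f differentiable (at x)" if "x \<in> S" for x
      using Suc.prems that by auto
    moreover have "C_k_on k S (dirD f v)" for v
      by (rule Suc.IH) (use Suc.prems in force)
    ultimately show ?case by simp
  qed
  with assms show ?thesis unfolding smooth_on_def by meson
qed

lemma smooth_on_const [simp]: "smooth_on S (\<lambda>_. c)"
proof -
  have "C_k_on k S (\<lambda>_. c)" for k :: nat and c :: 'b
    by (induction k arbitrary: c) auto
  then show ?thesis by (simp add: smooth_on_def)
qed

text \<open>The definition speaks of \<open>frechet_derivative\<close>; uniqueness of derivatives
  allows any explicit derivative \<open>f'\<close> in its place. The product and chain rules enter
  through this rule.\<close>

lemma C_k_on_SucI:
  assumes S: "open S" and hd: "\<And>x. x \<in> S \<Longrightarrow> (f has_derivative f' x) (at x)"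
    and C: "\<And>v. C_k_on k S (\<lambda>x. f' x v)"
  shows "C_k_on (Suc k) S f"
proof -
  have "C_k_on k S (dirD f v)" for v
    using C[of v] C_k_on_cong[OF S, of "dirD f v" "\<lambda>x. f' x v" k]
    by (simp add: frechet_derivative_at[OF hd, symmetric])
  with hd show ?thesis by (auto simp: differentiable_def)
qed

lemma C_k_on_Suc_has_derivative:
  "C_k_on (Suc k) S f \<Longrightarrow> x \<in> S \<Longrightarrow> (f has_derivative frechet_derivative f (at x)) (at x)"
  using frechet_derivative_works by auto

lemma smooth_onI:
  assumes S: "open S" and hd: "\<And>x. x \<in> S \<Longrightarrow> (f has_derivative f' x) (at x)"
    and C: "\<And>v. smooth_on S (\<lambda>x. f' x v)"
  shows "smooth_on S f"
  unfolding smooth_on_def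
proof
  fix k
  have "C_k_on (Suc k) S f"
    by (rule C_k_on_SucI[OF S hd]) (use C in \<open>auto simp: smooth_on_def\<close>)
  then show "C_k_on k S f" by (rule C_k_on_SucD)
qed

section \<open>Closure under linear maps, products and composition\<close>

lemma C_k_on_bounded_linear:
  assumes L: "bounded_linear L" and f: "C_k_on k S f" and S: "open S"
  shows "C_k_on k S (\<lambda>x. L (f x))"
  using f
proof (induction k arbitrary: f)
  case 0
  then show ?case by (simp add: bounded_linear.continuous_on[OF L])
next
  case (Suc k)
  show ?case
    by (rule C_k_on_SucI[OF S bounded_linear.has_derivative[OF L C_k_on_Suc_has_derivative[OF Suc.prems]]])
       (use Suc in simp_all)
qed

lemma smooth_on_bounded_linear:
  "bounded_linear L \<Longrightarrow> smooth_on S f \<Longrightarrow> open S \<Longrightarrow> smooth_on S (\<lambda>x. L (f x))"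
  by (simp add: smooth_on_def C_k_on_bounded_linear)

lemma C_k_on_add:
  assumes S: "open S" and "C_k_on k S f" "C_k_on k S g"
  shows "C_k_on k S (\<lambda>x. f x + g x)"
  using assms(2-)
proof (induction k arbitrary: f g)
  case 0
  then show ?case by (simp add: continuous_on_add)
next
  case (Suc k)
  show ?case
    by (rule C_k_on_SucI[OF S has_derivative_add[OF C_k_on_Suc_has_derivative[OF Suc.prems(1)] C_k_on_Suc_has_derivative[OF Suc.prems(2)]]])
      (use Suc in simp_all)
qed

lemma smooth_on_add:
  "open S \<Longrightarrow> smooth_on S f \<Longrightarrow> smooth_on S g \<Longrightarrow> smooth_on S (\<lambda>x. f x + g x)"
  by (simp add: smooth_on_def C_k_on_add)

lemma smooth_on_minus: "open S \<Longrightarrow> smooth_on S f \<Longrightarrow> smooth_on S (\<lambda>x. - f x)"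
  by (rule smooth_on_bounded_linear[OF bounded_linear_minus[OF bounded_linear_ident]])

lemma smooth_on_diff:
  "open S \<Longrightarrow> smooth_on S f \<Longrightarrow> smooth_on S g \<Longrightarrow> smooth_on S (\<lambda>x. f x - g x)"
  using smooth_on_add[of S f "\<lambda>x. - g x"] smooth_on_minus[of S g] by simp

lemma smooth_on_sum:
  "open S \<Longrightarrow> (\<And>i. i \<in> I \<Longrightarrow> smooth_on S (f i)) \<Longrightarrow> smooth_on S (\<lambda>x. \<Sum>i\<in>I. f i x)"
  by (induction I rule: infinite_finite_induct) (auto intro: smooth_on_add)

lemma C_k_on_bilinear:
  assumes B: "bounded_bilinear B" and S: "open S" and "C_k_on k S f" "C_k_on k S g"
  shows "C_k_on k S (\<lambda>x. B (f x) (g x))"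
  using assms(3-)
proof (induction k arbitrary: f g)
  case 0
  then show ?case by (simp add: bounded_bilinear.continuous_on[OF B])
next
  case (Suc k)
  have fg: "C_k_on k S f" "C_k_on k S g"
    using Suc.prems by (blast intro: C_k_on_SucD)+
  show ?case
    by (rule C_k_on_SucI[OF S bounded_bilinear.FDERIV[OF B C_k_on_Suc_has_derivative[OF Suc.prems(1)] C_k_on_Suc_has_derivative[OF Suc.prems(2)]]])
       (use Suc fg in \<open>auto intro!: C_k_on_add[OF S]\<close>)
qed

lemma smooth_on_bilinear:
  "bounded_bilinear B \<Longrightarrow> open S \<Longrightarrow> smooth_on S f \<Longrightarrow> smooth_on S g \<Longrightarrow> smooth_on S (\<lambda>x. B (f x) (g x))"
  by (simp add: smooth_on_def C_k_on_bilinear)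

lemma smooth_on_mult:
  fixes f g :: "_ \<Rightarrow> 'b::real_normed_algebra"
  shows "open S \<Longrightarrow> smooth_on S f \<Longrightarrow> smooth_on S g \<Longrightarrow> smooth_on S (\<lambda>x. f x * g x)"
  by (rule smooth_on_bilinear[OF bounded_bilinear_mult])

text \<open>The chain rule evaluates the derivative of \<open>f\<close> in the direction
  \<open>dirD g v x\<close>, which moves with \<open>x\<close>, while \<open>C_k_on\<close> controls
  fixed directions only. Expanding the moving direction in an orthonormal basis leaves a finite sum
  of products of a coefficient and a derivative in a fixed direction; hence the Euclidean
  intermediate space.\<close>

lemma C_k_on_compose:
  fixes g :: "'a::real_normed_vector \<Rightarrow> 'c::euclidean_space" and f :: "'c \<Rightarrow> 'b::real_normed_vector"
  assumes S: "open S" and g: "C_k_on k S g" and f: "C_k_on k T f" and gT: "g ` S \<subseteq> T"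
  shows "C_k_on k S (\<lambda>x. f (g x))"
  using f g
proof (induction k arbitrary: f)
  case 0
  with gT show ?case
    by (auto intro: continuous_on_compose2)
next
  case (Suc k)
  note g = Suc.prems(2)
  let ?F = "\<lambda>x v. \<Sum>b\<in>Basis. (dirD g v x \<bullet> b) *\<^sub>R dirD f b (g x)"
  have hd: "((\<lambda>x. f (g x)) has_derivative ?F x) (at x)" if x: "x \<in> S" for x
  proof -
    let ?D = "frechet_derivative f (at (g x))"
    have D: "(f has_derivative ?D) (at (g x))"
      using C_k_on_Suc_has_derivative[OF Suc.prems(1)] x gT by blast
    then interpret bounded_linear ?D by (rule has_derivative_bounded_linear)
    have "?F x v = ?D (dirD g v x)" for v
    proof -
      have "?F x v = ?D (\<Sum>b\<in>Basis. (dirD g v x \<bullet> b) *\<^sub>R b)"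
        by (simp add: sum scaleR)
      then show ?thesis by (simp only: euclidean_representation)
    qed
    then have "?F x = (\<lambda>v. ?D (dirD g v x))" by blast
    with has_derivative_compose[OF C_k_on_Suc_has_derivative[OF g x] D] show ?thesis by simp
  qed
  have C1: "C_k_on k S (\<lambda>x. (dirD g v x \<bullet> b) *\<^sub>R dirD f b (g x))" for b v
  proof (rule C_k_on_bilinear[OF bounded_bilinear_scaleR S])
    show "C_k_on k S (\<lambda>x. dirD g v x \<bullet> b)"
      by (rule C_k_on_bounded_linear[OF bounded_linear_inner_left _ S]) (use g in simp)
    show "C_k_on k S (\<lambda>x. dirD f b (g x))"
      using Suc.IH[of "dirD f b"] Suc.prems C_k_on_SucD[OF g] by simp
  qed
  have C2: "C_k_on k S (\<lambda>x. \<Sum>b\<in>I. F b x)" if "finite I" "\<And>b. C_k_on k S (F b)"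
    for I and F :: "'c \<Rightarrow> 'a \<Rightarrow> 'b"
    using that(1)
  proof (induction I)
    case empty
    have "smooth_on S (\<lambda>_. 0 :: 'b)" by (rule smooth_on_const)
    then show ?case unfolding smooth_on_def by simp
  next
    case (insert b I)
    then show ?case using C_k_on_add[OF S that(2)] by simp
  qed
  show ?case
  proof (rule C_k_on_SucI[OF S hd])
    show "C_k_on k S (\<lambda>x. ?F x v)" for v
      using C2[OF finite_Basis C1[of v]] by simp
  qed
qed

lemma smooth_on_compose:
  fixes g :: "'a::real_normed_vector \<Rightarrow> 'c::euclidean_space" and f :: "'c \<Rightarrow> 'b::real_normed_vector"
  shows "open S \<Longrightarrow> smooth_on S g \<Longrightarrow> smooth_on T f \<Longrightarrow> g ` S \<subseteq> T \<Longrightarrow> smooth_on S (\<lambda>x. f (g x))"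
  unfolding smooth_on_def by (metis C_k_on_compose)

text \<open>The derivative in direction \<open>v\<close> is \<open>deriv f z * v\<close>, again
  holomorphic, so the induction closes. Inverse, exponential and square root get their smoothness
  from here; the real versions are real parts of the complex ones.\<close>

lemma smooth_on_holomorphic:
  assumes "f holomorphic_on S" "open S"
  shows "smooth_on S f"
proof -
  have "C_k_on k S f" for k
    using assms(1)
  proof (induction k arbitrary: f)
    case 0
    then show ?case by (simp add: holomorphic_on_imp_continuous_on)
  next
    case (Suc k)
    show ?case
    proof (rule C_k_on_SucI[OF assms(2)])
      show "(f has_derivative (*) (deriv f z)) (at z)" if "z \<in> S" for z
        using Suc.prems assms(2) that holomorphic_derivI has_field_derivative_imp_has_derivative by blast
      show "C_k_on k S (\<lambda>z. deriv f z * v)" for v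
        by (rule Suc.IH) (intro holomorphic_intros holomorphic_deriv Suc.prems assms(2))
    qed
  qed
  then show ?thesis by (simp add: smooth_on_def)
qed

lemma smooth_on_compose_holomorphic:
  assumes "smooth_on S g" "open S" "f holomorphic_on T" "open T" "g ` S \<subseteq> T"
  shows "smooth_on S (\<lambda>x. f (g x))"
  using smooth_on_compose[OF assms(2,1) smooth_on_holomorphic[OF assms(3,4)] assms(5)] .

lemma smooth_on_of_real:
  "smooth_on S f \<Longrightarrow> open S \<Longrightarrow> smooth_on S (\<lambda>x. complex_of_real (f x))"
  by (rule smooth_on_bounded_linear[OF bounded_linear_of_real])

lemma smooth_on_Re: "smooth_on S f \<Longrightarrow> open S \<Longrightarrow> smooth_on S (\<lambda>x. Re (f x))"
  by (rule smooth_on_bounded_linear[OF bounded_linear_Re])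

lemma smooth_on_Im: "smooth_on S f \<Longrightarrow> open S \<Longrightarrow> smooth_on S (\<lambda>x. Im (f x))"
  by (rule smooth_on_bounded_linear[OF bounded_linear_Im])

lemma smooth_on_cnj: "smooth_on S f \<Longrightarrow> open S \<Longrightarrow> smooth_on S (\<lambda>x. cnj (f x))"
  by (rule smooth_on_bounded_linear[OF bounded_linear_cnj])

lemma smooth_on_inverse_complex:
  fixes f :: "'a::real_normed_vector \<Rightarrow> complex"
  assumes "smooth_on S f" "open S" "\<And>x. x \<in> S \<Longrightarrow> f x \<noteq> 0"
  shows "smooth_on S (\<lambda>x. inverse (f x))"
proof (rule smooth_on_compose_holomorphic[where f=inverse and T="-{0}"])
  show "inverse holomorphic_on - {0 :: complex}"
    by (rule holomorphic_on_inverse[OF holomorphic_on_ident]) simp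
qed (use assms in auto)

lemma smooth_on_divide_complex:
  fixes f :: "'a::real_normed_vector \<Rightarrow> complex"
  assumes "smooth_on S f" "smooth_on S g" "open S" "\<And>x. x \<in> S \<Longrightarrow> g x \<noteq> 0"
  shows "smooth_on S (\<lambda>x. f x / g x)"
  unfolding divide_inverse by (rule smooth_on_mult[OF assms(3,1) smooth_on_inverse_complex[OF assms(2-4)]])

lemma smooth_on_divide_real:
  fixes f :: "'a::real_normed_vector \<Rightarrow> real"
  assumes "smooth_on S f" "smooth_on S g" "open S" "\<And>x. x \<in> S \<Longrightarrow> g x \<noteq> 0"
  shows "smooth_on S (\<lambda>x. f x / g x)"
proof -
  have "smooth_on S (\<lambda>x. Re (complex_of_real (f x) / complex_of_real (g x)))"
    by (rule smooth_on_Re[OF smooth_on_divide_complex[OF smooth_on_of_real[OF assms(1,3)] smooth_on_of_real[OF assms(2,3)]]])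
       (use assms in auto)
  then show ?thesis by simp
qed

lemma smooth_on_exp:
  fixes f :: "'a::real_normed_vector \<Rightarrow> real"
  assumes "smooth_on S f" "open S"
  shows "smooth_on S (\<lambda>x. exp (f x))"
proof -
  have "smooth_on S (\<lambda>x. Re (exp (complex_of_real (f x))))"
    by (rule smooth_on_Re[OF smooth_on_compose_holomorphic[where f=exp and T=UNIV, OF smooth_on_of_real[OF assms] assms(2)]])
       (use assms in \<open>auto intro: holomorphic_on_exp\<close>)
  then show ?thesis by (simp add: exp_of_real)
qed

lemma smooth_on_csqrt:
  assumes "smooth_on S f" "open S" "\<And>x. x \<in> S \<Longrightarrow> f x \<notin> \<real>\<^sub>\<le>\<^sub>0"
  shows "smooth_on S (\<lambda>x. csqrt (f x))"
proof (rule smooth_on_compose_holomorphic[where f=csqrt and T="- \<real>\<^sub>\<le>\<^sub>0"])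
  show "csqrt holomorphic_on - \<real>\<^sub>\<le>\<^sub>0"
    by (rule holomorphic_on_csqrt)
qed (use assms in auto)

lemma smooth_on_sqrt:
  fixes f :: "'a::real_normed_vector \<Rightarrow> real"
  assumes "smooth_on S f" "open S" "\<And>x. x \<in> S \<Longrightarrow> f x > 0"
  shows "smooth_on S (\<lambda>x. sqrt (f x))"
proof -
  have "smooth_on S (\<lambda>x. Re (csqrt (complex_of_real (f x))))"
    by (rule smooth_on_Re[OF smooth_on_csqrt[OF smooth_on_of_real[OF assms(1,2)] assms(2)]])
      (use assms in \<open>force simp: complex_nonpos_Reals_iff\<close>)+
  then show ?thesis
    using assms smooth_on_cong[OF assms(2), of "\<lambda>x. Re (csqrt (complex_of_real (f x)))" "\<lambda>x. sqrt (f x)"]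
    by (force simp: of_real_sqrt[symmetric])
qed

lemma smooth_on_vec_nth:
  fixes f :: "'a::real_normed_vector \<Rightarrow> ('b::real_normed_vector)^'n"
  shows "smooth_on S f \<Longrightarrow> open S \<Longrightarrow> smooth_on S (\<lambda>x. f x $ i)"
  by (rule smooth_on_bounded_linear[OF bounded_linear_vec_nth])

lemma bounded_linear_axis: "bounded_linear (axis i :: 'b::euclidean_space \<Rightarrow> 'b^'n)"
  unfolding linear_conv_bounded_linear[symmetric]
  by (rule linearI) (auto simp: vec_eq_iff axis_def)

lemma smooth_on_vecI:
  fixes f :: "'a::real_normed_vector \<Rightarrow> ('b::euclidean_space)^'n"
  assumes "open S" "\<And>i. smooth_on S (\<lambda>x. f x $ i)"
  shows "smooth_on S f"
proof -
  have "f = (\<lambda>x. \<Sum>i\<in>UNIV. axis i (f x $ i))"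
    by (auto simp: vec_eq_iff axis_def fun_eq_iff)
  moreover have "smooth_on S (\<lambda>x. \<Sum>i\<in>UNIV. axis i (f x $ i))"
    using assms by (intro smooth_on_sum smooth_on_bounded_linear[OF bounded_linear_axis]) auto
  ultimately show ?thesis by simp
qed

lemma smooth_on_matI:
  fixes f :: "'a::real_normed_vector \<Rightarrow> ('b::euclidean_space)^'n^'m"
  assumes "open S" "\<And>i j. smooth_on S (\<lambda>x. f x $ i $ j)"
  shows "smooth_on S f"
  using assms by (intro smooth_on_vecI)

lemma smooth_on_mat_nth:
  fixes f :: "'a::real_normed_vector \<Rightarrow> ('b::real_normed_vector)^'n^'m"
  shows "smooth_on S f \<Longrightarrow> open S \<Longrightarrow> smooth_on S (\<lambda>x. f x $ i $ j)"
  by (intro smooth_on_vec_nth)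

section \<open>Primitives of closed one-forms and local diffeomorphisms\<close>

lemma has_vector_derivative_along_line:
  assumes "f differentiable (at (y + t *\<^sub>R v))"
  shows "((\<lambda>t. f (y + t *\<^sub>R v)) has_vector_derivative frechet_derivative f (at (y + t *\<^sub>R v)) v) (at t within X)"
proof -
  let ?D = "frechet_derivative f (at (y + t *\<^sub>R v))"
  have D: "(f has_derivative ?D) (at (y + t *\<^sub>R v))"
    using assms frechet_derivative_works by blast
  have "((\<lambda>t. y + t *\<^sub>R v) has_derivative (\<lambda>s. s *\<^sub>R v)) (at t within X)"
    by (auto intro!: derivative_eq_intros)
  from has_derivative_compose[OF this D]
  show ?thesis
    by (simp add: has_vector_derivative_def linear_cmul[OF has_derivative_linear[OF D]])
qed

text \<open>The increment of \<open>f\<close> along \<open>t *\<^sub>R v\<close> is the integral of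
  \<open>dirD f v\<close>. Differentiating this in the direction \<open>u\<close> under the integral
  sign, and then in \<open>t\<close> at \<open>0\<close> by the fundamental theorem, produces the
  two mixed derivatives.\<close>

lemma dirD_commute:
  fixes f :: "'a::real_normed_vector \<Rightarrow> 'b::banach"
  assumes f: "smooth_on S f" and S: "open S" and x: "x \<in> S"
  shows "dirD (dirD f u) v x = dirD (dirD f v) u x"
proof -
  obtain r where r: "r > 0" "cball x r \<subseteq> S"
    using S x open_contains_cball by blast
  \<comment> \<open>This size keeps the whole parallelogram spanned by \<open>e *\<^sub>R u\<close>
    and \<open>e *\<^sub>R v\<close> in the ball; the summand \<open>1\<close> covers
    \<open>u = v = 0\<close>.\<close>
  define e where "e = r / (norm u + norm v + 1)"
  have pos: "norm u + norm v + 1 > 0" by (smt (verit) norm_ge_zero)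
  then have e: "e > 0" using r by (simp add: e_def)
  have inS: "x + s *\<^sub>R u + t *\<^sub>R v \<in> S" if "\<bar>s\<bar> \<le> e" "\<bar>t\<bar> \<le> e" for s t
  proof -
    have "norm (s *\<^sub>R u + t *\<^sub>R v) \<le> \<bar>s\<bar> * norm u + \<bar>t\<bar> * norm v"
      by (metis norm_scaleR norm_triangle_ineq)
    also have "\<dots> \<le> e * norm u + e * norm v"
      using that by (intro add_mono mult_right_mono) auto
    also have "\<dots> \<le> e * (norm u + norm v + 1)" using e by (simp add: algebra_simps)
    also have "\<dots> = r" using pos by (simp add: e_def)
    finally have "x + (s *\<^sub>R u + t *\<^sub>R v) \<in> cball x r"
      by (simp only: mem_cball dist_norm norm_minus_commute[of x] add_diff_cancel_left')
    then show ?thesis using r by (auto simp: add.assoc)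
  qed
  have diff: "dirD g w differentiable (at y)" "g differentiable (at y)" if "smooth_on S g" "y \<in> S" for y w and g :: "'a \<Rightarrow> 'b"
    using that smooth_on_dirD smooth_on_differentiable by blast+
  have cont: "continuous_on X (\<lambda>p. dirD g w (h p))"
    if "smooth_on S g" "continuous_on X h" "h ` X \<subseteq> S" for X :: "'z::topological_space set" and h w and g :: "'a \<Rightarrow> 'b"
    by (rule continuous_on_compose2[OF smooth_on_imp_continuous_on[OF smooth_on_dirD[OF that(1)]] that(2,3)])
  have *: "dirD f u (x + t *\<^sub>R v) = dirD f u x + integral {0..t} (\<lambda>\<tau>. dirD (dirD f v) u (x + \<tau> *\<^sub>R v))"
    if t: "t \<in> {0..e}" for t
  proof -
    have 1: "f (x + s *\<^sub>R u + t *\<^sub>R v) - f (x + s *\<^sub>R u) = integral {0..t} (\<lambda>\<tau>. dirD f v (x + s *\<^sub>R u + \<tau> *\<^sub>R v))"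
      if s: "s \<in> {-e..e}" for s
    proof -
      have "((\<lambda>\<tau>. dirD f v (x + s *\<^sub>R u + \<tau> *\<^sub>R v)) has_integral
             f (x + s *\<^sub>R u + t *\<^sub>R v) - f (x + s *\<^sub>R u + 0 *\<^sub>R v)) {0..t}"
        using t s by (intro fundamental_theorem_of_calculus has_vector_derivative_along_line diff(2)[OF f] inS) auto
      then show ?thesis by (simp add: integral_unique)
    qed
    have 2: "((\<lambda>s. integral (cbox 0 t) (\<lambda>\<tau>. dirD f v (x + \<tau> *\<^sub>R v + s *\<^sub>R u))) has_vector_derivative
        integral (cbox 0 t) (\<lambda>\<tau>. dirD (dirD f v) u (x + \<tau> *\<^sub>R v + 0 *\<^sub>R u))) (at 0 within {-e..e})"
    proof (rule leibniz_rule_vector_derivative)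
      have eq: "x + \<tau> *\<^sub>R v + s *\<^sub>R u = x + s *\<^sub>R u + \<tau> *\<^sub>R v" for s \<tau> by simp
      have in': "x + \<tau> *\<^sub>R v + s *\<^sub>R u \<in> S" if "s \<in> {-e..e}" "\<tau> \<in> cbox 0 t" for s \<tau>
        unfolding eq using that t by (intro inS) auto
      show "((\<lambda>s. dirD f v (x + \<tau> *\<^sub>R v + s *\<^sub>R u)) has_vector_derivative dirD (dirD f v) u (x + \<tau> *\<^sub>R v + s *\<^sub>R u)) (at s within {-e..e})"
        if "s \<in> {-e..e}" "\<tau> \<in> cbox 0 t" for s \<tau>
        by (intro has_vector_derivative_along_line diff f in' that)
      show "(\<lambda>\<tau>. dirD f v (x + \<tau> *\<^sub>R v + s *\<^sub>R u)) integrable_on cbox 0 t" if "s \<in> {-e..e}" for s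
        using in'[OF that] by (intro integrable_continuous cont[OF f]) (auto intro!: continuous_intros)
      show "continuous_on ({- e..e} \<times> cbox 0 t) (\<lambda>(s, \<tau>). dirD (dirD f v) u (x + \<tau> *\<^sub>R v + s *\<^sub>R u))"
        unfolding split_beta using in'
        by (intro cont[OF smooth_on_dirD[OF f]]) (auto intro!: continuous_intros)
    qed (use e in auto)
    have 3: "((\<lambda>s. f ((x + t *\<^sub>R v) + s *\<^sub>R u) - f (x + s *\<^sub>R u)) has_vector_derivative
        dirD f u (x + t *\<^sub>R v + 0 *\<^sub>R u) - dirD f u (x + 0 *\<^sub>R u)) (at 0 within {-e..e})"
      using inS[of 0 t] t e x
      by (intro has_vector_derivative_diff has_vector_derivative_along_line diff(2)[OF f]) auto
    have 4: "((\<lambda>s. f ((x + t *\<^sub>R v) + s *\<^sub>R u) - f (x + s *\<^sub>R u)) has_vector_derivative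
        integral (cbox 0 t) (\<lambda>\<tau>. dirD (dirD f v) u (x + \<tau> *\<^sub>R v + 0 *\<^sub>R u))) (at 0 within {-e..e})"
      by (rule has_vector_derivative_transform[OF _ _ 2]) (use e 1 in \<open>auto simp: algebra_simps\<close>)
    have "dirD f u (x + t *\<^sub>R v + 0 *\<^sub>R u) - dirD f u (x + 0 *\<^sub>R u) = integral (cbox 0 t) (\<lambda>\<tau>. dirD (dirD f v) u (x + \<tau> *\<^sub>R v + 0 *\<^sub>R u))"
      by (rule vector_derivative_unique_within[OF _ 3 4]) (use e in \<open>simp add: at_within_Icc_at\<close>)
    then show ?thesis by (simp add: algebra_simps)
  qed
  have A: "((\<lambda>t. dirD f u (x + t *\<^sub>R v)) has_vector_derivative dirD (dirD f u) v (x + 0 *\<^sub>R v)) (at 0 within {0..e})"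
    by (intro has_vector_derivative_along_line diff f) (use x in simp)
  have "((\<lambda>t. integral {0..t} (\<lambda>\<tau>. dirD (dirD f v) u (x + \<tau> *\<^sub>R v))) has_vector_derivative dirD (dirD f v) u (x + 0 *\<^sub>R v)) (at 0 within {0..e})"
    using e inS[of 0] by (intro integral_has_vector_derivative cont[OF smooth_on_dirD[OF f]]) (auto intro!: continuous_intros)
  then have "((\<lambda>t. dirD f u x + integral {0..t} (\<lambda>\<tau>. dirD (dirD f v) u (x + \<tau> *\<^sub>R v))) has_vector_derivative 0 + dirD (dirD f v) u (x + 0 *\<^sub>R v)) (at 0 within {0..e})"
    by (intro has_vector_derivative_add has_vector_derivative_const)
  then have B: "((\<lambda>t. dirD f u (x + t *\<^sub>R v)) has_vector_derivative 0 + dirD (dirD f v) u (x + 0 *\<^sub>R v)) (at 0 within {0..e})"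
    by (rule has_vector_derivative_transform[rotated 2]) (use e * in auto)
  have "dirD (dirD f u) v (x + 0 *\<^sub>R v) = 0 + dirD (dirD f v) u (x + 0 *\<^sub>R v)"
    by (rule vector_derivative_unique_within[OF _ A B]) (use e in \<open>simp add: at_within_Icc_at_right\<close>)
  then show ?thesis by simp
qed

section \<open>The Poincare lemma on a disc\<close>

lemma linear_complex_expand:
  fixes L :: "complex \<Rightarrow> 'b::real_vector"
  assumes "linear L"
  shows "L v = Re v *\<^sub>R L 1 + Im v *\<^sub>R L \<i>"
proof -
  have "v = Re v *\<^sub>R 1 + Im v *\<^sub>R \<i>" by (simp add: complex_eq_iff)
  then show ?thesis
    using assms by (metis linear_add linear_cmul)
qed

lemma dirD_expand:
  "f differentiable (at z) \<Longrightarrow> dirD f v z = Re v *\<^sub>R dirD f 1 z + Im v *\<^sub>R dirD f \<i> z"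
  by (rule linear_complex_expand[OF linear_frechet_derivative])

text \<open>The primitive is the integral of e1 dx + e2 dy along the segment from the centre,
  differentiated under the integral sign. Closedness turns the derivative of the integrand in
  \<open>z\<close> into an exact derivative in \<open>t\<close>.\<close>

lemma Poincare_ball:
  fixes e1 e2 :: "complex \<Rightarrow> 'b::euclidean_space"
  assumes e: "smooth_on (ball c r) e1" "smooth_on (ball c r) e2"
    and closed: "\<And>z. z \<in> ball c r \<Longrightarrow> dirD e1 \<i> z = dirD e2 1 z"
  obtains f where "\<And>z. z \<in> ball c r \<Longrightarrow> (f has_derivative (\<lambda>v. Re v *\<^sub>R e1 z + Im v *\<^sub>R e2 z)) (at z)"
proof -
  let ?w = "\<lambda>z t. c + t *\<^sub>R (z - c)"
  define g where "g z t = Re (z - c) *\<^sub>R e1 (?w z t) + Im (z - c) *\<^sub>R e2 (?w z t)" for z t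
  \<comment> \<open>\<open>A e z t\<close> is the \<open>t\<close>-derivative of
    \<open>t *\<^sub>R e (c + t *\<^sub>R (z - c))\<close>, so its integral over the unit interval
    is \<open>e z\<close>.\<close>
  define A where "A e z t = e (?w z t) + t *\<^sub>R (Re (z - c) *\<^sub>R dirD e 1 (?w z t) + Im (z - c) *\<^sub>R dirD e \<i> (?w z t))"
    for e :: "complex \<Rightarrow> 'b" and z t
  define fx where "fx z t = (blinfun_scaleR_left (A e1 z t) o\<^sub>L Blinfun Re) + (blinfun_scaleR_left (A e2 z t) o\<^sub>L Blinfun Im)" for z t
  have fx_apply: "fx z t v = Re v *\<^sub>R A e1 z t + Im v *\<^sub>R A e2 z t" for z t v
    by (simp add: fx_def blinfun.add_left bounded_linear_Blinfun_apply bounded_linear_Re bounded_linear_Im)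
  have inb: "?w z t \<in> ball c r" if "z \<in> ball c r" "t \<in> {0..1}" for z t
  proof -
    have "norm (t *\<^sub>R (z - c)) \<le> 1 * norm (z - c)"
      unfolding norm_scaleR using that by (intro mult_right_mono) auto
    with that show ?thesis by (simp add: dist_norm norm_minus_commute)
  qed
  have cont: "continuous_on X (\<lambda>p. h (?w (k p) (l p)))"
    if "smooth_on (ball c r) h" "continuous_on X k" "continuous_on X l" "k ` X \<subseteq> ball c r" "l ` X \<subseteq> {0..1}"
    for X :: "'z::topological_space set" and h :: "complex \<Rightarrow> 'b" and k l
  proof (rule continuous_on_compose2[OF smooth_on_imp_continuous_on[OF that(1)]])
    show "continuous_on X (\<lambda>p. ?w (k p) (l p))"
      using that by (auto intro!: continuous_intros)
    show "(\<lambda>p. ?w (k p) (l p)) ` X \<subseteq> ball c r"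
    proof
      fix y assume "y \<in> (\<lambda>p. ?w (k p) (l p)) ` X"
      then obtain p where "p \<in> X" "y = ?w (k p) (l p)" by blast
      then show "y \<in> ball c r" using inb[of "k p" "l p"] that by blast
    qed
  qed
  have contA: "continuous_on X (\<lambda>p. A h (k p) (l p))"
    if "smooth_on (ball c r) h" "continuous_on X k" "continuous_on X l" "k ` X \<subseteq> ball c r" "l ` X \<subseteq> {0..1}"
    for X :: "'z::topological_space set" and h k l
    unfolding A_def using that
    by (intro continuous_intros cont smooth_on_dirD)
  have chain: "((\<lambda>z. h (?w z t)) has_derivative (\<lambda>v. dirD h (t *\<^sub>R v) (?w z t))) (at z within X)"
    if "smooth_on (ball c r) h" "z \<in> ball c r" "t \<in> {0..1}" for h :: "complex \<Rightarrow> 'b" and z t X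
  proof -
    have "((\<lambda>z. ?w z t) has_derivative (\<lambda>v. t *\<^sub>R v)) (at z within X)"
      by (auto intro!: derivative_eq_intros)
    from has_derivative_compose[OF this smooth_on_has_derivative[OF that(1) inb[OF that(2,3)]]]
    show ?thesis .
  qed
  have dsc: "dirD h (t *\<^sub>R v) (?w z t) = t *\<^sub>R (Re v *\<^sub>R dirD h 1 (?w z t) + Im v *\<^sub>R dirD h \<i> (?w z t))"
    if "smooth_on (ball c r) h" "z \<in> ball c r" "t \<in> {0..1}" for h :: "complex \<Rightarrow> 'b" and z t v
    using dirD_expand[OF smooth_on_differentiable[OF that(1) inb[OF that(2,3)]], of "t *\<^sub>R v"]
    by (simp add: algebra_simps)
  have der: "((\<lambda>z. integral (cbox 0 1) (g z)) has_derivative integral (cbox 0 1) (fx z)) (at z within ball c r)"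
    if z: "z \<in> ball c r" for z
  proof (rule leibniz_rule[OF _ _ _ z])
    show "((\<lambda>z. g z t) has_derivative blinfun_apply (fx z t)) (at z within ball c r)"
      if zt: "z \<in> ball c r" "t \<in> cbox 0 1" for z and t :: real
    proof -
      have t: "t \<in> {0..1}" using zt by simp
      have "((\<lambda>z. g z t) has_derivative (\<lambda>v. (Re (z - c) *\<^sub>R dirD e1 (t *\<^sub>R v) (?w z t) + Re v *\<^sub>R e1 (?w z t)) +
          (Im (z - c) *\<^sub>R dirD e2 (t *\<^sub>R v) (?w z t) + Im v *\<^sub>R e2 (?w z t)))) (at z within ball c r)"
        unfolding g_def
        by (intro has_derivative_add has_derivative_scaleR chain e zt t)
           (auto intro!: derivative_eq_intros)
      \<comment> \<open>\<open>closed\<close> replaces \<open>dirD e1 \<i>\<close> by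
        \<open>dirD e2 1\<close>; only after this exchange do the terms group into
        \<open>A e1\<close> and \<open>A e2\<close>.\<close>
      moreover have "(\<lambda>v. (Re (z - c) *\<^sub>R dirD e1 (t *\<^sub>R v) (?w z t) + Re v *\<^sub>R e1 (?w z t)) +
          (Im (z - c) *\<^sub>R dirD e2 (t *\<^sub>R v) (?w z t) + Im v *\<^sub>R e2 (?w z t))) = blinfun_apply (fx z t)"
        unfolding dsc[OF e(1) zt(1) t] dsc[OF e(2) zt(1) t] fx_apply A_def closed[OF inb[OF zt(1) t]]
        by (simp add: fun_eq_iff algebra_simps)
      ultimately show ?thesis by simp
    qed
    show "g z integrable_on cbox 0 1" if "z \<in> ball c r" for z
      unfolding g_def using that by (intro integrable_continuous continuous_intros cont e) auto
    show "continuous_on (ball c r \<times> cbox 0 1) (\<lambda>(z, t). fx z t)"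
      unfolding split_beta fx_def
      by (intro continuous_intros contA e) auto
  qed auto
  have int: "blinfun_apply (integral (cbox 0 1) (fx z)) v = Re v *\<^sub>R e1 z + Im v *\<^sub>R e2 z"
    if z: "z \<in> ball c r" for z v
  proof -
    have FTC: "(A h z has_integral h z) (cbox 0 1)" if h: "smooth_on (ball c r) h" for h
    proof -
      have "(A h z has_integral (1::real) *\<^sub>R h (c + 1 *\<^sub>R (z - c)) - 0 *\<^sub>R h (c + 0 *\<^sub>R (z - c))) {0..1}"
      proof (rule fundamental_theorem_of_calculus)
        fix t :: real assume t: "t \<in> {0..1}"
        have "((\<lambda>t. t *\<^sub>R h (c + t *\<^sub>R (z - c))) has_vector_derivative
            t *\<^sub>R dirD h (z - c) (c + t *\<^sub>R (z - c)) + 1 *\<^sub>R h (c + t *\<^sub>R (z - c))) (at t within {0..1})"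
          by (intro has_vector_derivative_scaleR has_vector_derivative_along_line smooth_on_differentiable[OF h] inb z t)
             (auto intro!: derivative_eq_intros)
        moreover have "dirD h (z - c) (?w z t) = Re (z - c) *\<^sub>R dirD h 1 (?w z t) + Im (z - c) *\<^sub>R dirD h \<i> (?w z t)"
          by (rule dirD_expand[OF smooth_on_differentiable[OF h inb[OF z t]]])
        ultimately show "((\<lambda>t. t *\<^sub>R h (c + t *\<^sub>R (z - c))) has_vector_derivative A h z t) (at t within {0..1})"
          by (simp add: A_def add.commute)
      qed simp
      then show ?thesis by simp
    qed
    have fxi: "fx z integrable_on cbox 0 1"
      unfolding fx_def using z by (intro integrable_continuous continuous_intros contA e) auto
    have "blinfun_apply (integral (cbox 0 1) (fx z)) v = integral (cbox 0 1) (\<lambda>t. fx z t v)"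
      using integral_linear[OF fxi blinfun.bounded_linear_left[of v]] by (simp add: o_def)
    also have "\<dots> = Re v *\<^sub>R e1 z + Im v *\<^sub>R e2 z"
      unfolding fx_apply
      by (intro integral_unique has_integral_add has_integral_cmul FTC e)
    finally show ?thesis .
  qed
  have "((\<lambda>z. integral (cbox 0 1) (g z)) has_derivative (\<lambda>v. Re v *\<^sub>R e1 z + Im v *\<^sub>R e2 z)) (at z)"
    if z: "z \<in> ball c r" for z
  proof -
    have "at z within ball c r = at z" using z by (intro at_within_open) auto
    moreover have "blinfun_apply (integral (cbox 0 1) (fx z)) = (\<lambda>v. Re v *\<^sub>R e1 z + Im v *\<^sub>R e2 z)"
      using int[OF z] by blast
    ultimately show ?thesis using der[OF z] by simp
  qed
  with that show ?thesis by blast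
qed

text \<open>\<open>Im (cnj (dirD w 1 z) * dirD w \<i> z)\<close> is the Jacobian determinant of
  \<open>w\<close> as a map of the real plane. The inverse function theorem gives a differentiable
  inverse \<open>h\<close> with derivative \<open>P (h y)\<close>. As \<open>P\<close> is smooth,
  \<open>h\<close> of class k has a derivative of class k and so is of class k + 1; this bootstraps
  to smoothness.\<close>

lemma local_diffeo:
  fixes w :: "complex \<Rightarrow> complex"
  assumes U: "open U" "z0 \<in> U" and w: "smooth_on U w"
    and nz: "\<And>z. z \<in> U \<Longrightarrow> Im (cnj (dirD w 1 z) * dirD w \<i> z) \<noteq> 0"
  obtains U' V h where "open U'" "U' \<subseteq> U" "z0 \<in> U'" "open V" "homeomorphism U' V w h" "smooth_on V h"
proof -
  define J where "J z = Im (cnj (dirD w 1 z) * dirD w \<i> z)" for z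
  define W where "W z = (blinfun_scaleR_left (dirD w 1 z) o\<^sub>L Blinfun Re) + (blinfun_scaleR_left (dirD w \<i> z) o\<^sub>L Blinfun Im)" for z
  have W_apply: "W z v = Re v *\<^sub>R dirD w 1 z + Im v *\<^sub>R dirD w \<i> z" for z v
    by (simp add: W_def blinfun.add_left bounded_linear_Blinfun_apply bounded_linear_Re bounded_linear_Im)
  \<comment> \<open>Cramer's rule for the inverse of \<open>W z\<close>, with determinant
    \<open>J z\<close>; explicit, so that its smoothness in \<open>z\<close> can be read
    off.\<close>
  define P where "P z v = Complex (Im (cnj v * dirD w \<i> z) / J z) (Im (cnj (dirD w 1 z) * v) / J z)" for z v
  have Jnz: "J z \<noteq> 0" if "z \<in> U" for z using nz that by (simp add: J_def)
  have PW: "P z (W z v) = v" if "z \<in> U" for z v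
  proof -
    have "Im (cnj (W z v) * dirD w \<i> z) = Re v * J z" "Im (cnj (dirD w 1 z) * W z v) = Im v * J z"
      unfolding W_apply J_def by (simp_all add: algebra_simps)
    then show ?thesis using Jnz[OF that] by (simp add: P_def)
  qed
  have WP: "W z (P z v) = v" if "z \<in> U" for z v
  proof -
    have "J z *\<^sub>R W z (P z v) = (J z * Re (P z v)) *\<^sub>R dirD w 1 z + (J z * Im (P z v)) *\<^sub>R dirD w \<i> z"
      unfolding W_apply by (simp add: scaleR_add_right)
    also have "\<dots> = Im (cnj v * dirD w \<i> z) *\<^sub>R dirD w 1 z + Im (cnj (dirD w 1 z) * v) *\<^sub>R dirD w \<i> z"
      using Jnz[OF that] by (simp add: P_def)
    also have "\<dots> = J z *\<^sub>R v"
      by (simp add: complex_eq_iff J_def algebra_simps)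
    finally show ?thesis using Jnz[OF that] by simp
  qed
  have P_eq: "P z v = of_real (Im (cnj v * dirD w \<i> z) / J z) + \<i> * of_real (Im (cnj (dirD w 1 z) * v) / J z)" for z v
    by (simp add: P_def complex_eq_iff)
  have linP: "bounded_linear (P z)" for z
    unfolding P_eq divide_inverse
    by (intro bounded_linear_add bounded_linear_const_mult bounded_linear_compose[OF bounded_linear_of_real]
        bounded_linear_mult_const bounded_linear_compose[OF bounded_linear_Im] bounded_linear_cnj bounded_linear_ident)
  have smP: "smooth_on U (\<lambda>z. P z v)" for v
  proof -
    show ?thesis
      unfolding P_eq J_def
      by (intro smooth_on_add smooth_on_mult smooth_on_of_real smooth_on_divide_real smooth_on_Im smooth_on_cnj
          smooth_on_dirD[OF w] smooth_on_const U(1) nz)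
  qed
  have derw: "(w has_derivative W z) (at z)" if "z \<in> U" for z
  proof -
    have "frechet_derivative w (at z) = W z"
      by (rule ext) (simp only: W_apply, rule dirD_expand[OF smooth_on_differentiable[OF w that]])
    with smooth_on_has_derivative[OF w that] show ?thesis by simp
  qed
  have contW: "continuous_on U W"
    unfolding W_def by (intro continuous_intros smooth_on_imp_continuous_on[OF smooth_on_dirD[OF w]])
  have "Blinfun (P z0) o\<^sub>L W z0 = id_blinfun"
    using PW[OF U(2)] by (intro blinfun_eqI) (simp add: bounded_linear_Blinfun_apply linP)
  from inverse_function_theorem[OF U(1) derw contW U(2) this]
  obtain U' V h h' where h: "open U'" "U' \<subseteq> U" "z0 \<in> U'" "open V" "homeomorphism U' V w h"
    "\<And>y. y \<in> V \<Longrightarrow> (h has_derivative h' y) (at y)" "\<And>y. y \<in> V \<Longrightarrow> h' y = inv (W (h y))"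
    by metis
  have hV: "h y \<in> U'" if "y \<in> V" for y
    using h(5) that by (auto simp: homeomorphism_def)
  have h': "h' y = P (h y)" if "y \<in> V" for y
  proof -
    have "h y \<in> U" using hV that h(2) by blast
    then have "inv (W (h y)) = P (h y)"
      by (intro inv_unique_comp) (auto simp: fun_eq_iff PW WP)
    then show ?thesis using h(7)[OF that] by simp
  qed
  have hd: "(h has_derivative P (h y)) (at y)" if "y \<in> V" for y
    using h(6)[OF that] h'[OF that] by simp
  have "C_k_on k V h" for k
  proof (induction k)
    case 0
    show ?case using hd by (auto intro!: continuous_at_imp_continuous_on has_derivative_continuous)
  next
    case (Suc k)
    have "C_k_on k V (\<lambda>y. P (h y) v)" for v
      by (rule C_k_on_compose[OF h(4) Suc, where T=U and f="\<lambda>z. P z v"])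
         (use smP hV h(2) in \<open>auto simp: smooth_on_def\<close>)
    from C_k_on_SucI[OF h(4) hd this] show ?case .
  qed
  then have "smooth_on V h" by (simp add: smooth_on_def)
  with h that show ?thesis by blast
qed

section \<open>Curvature of a metric given by a null coframe\<close>

lemma partial_mult:
  assumes "f differentiable (at z)" "g differentiable (at z)"
  shows "partial i (\<lambda>w. f w * g w) z = f z * partial i g z + partial i f z * g z"
  unfolding partial_def
  using frechet_derivative_at[OF has_derivative_mult[OF assms[unfolded frechet_derivative_works]]]
  by metis

lemma partial_add:
  assumes "f differentiable (at z)" "g differentiable (at z)"
  shows "partial i (\<lambda>w. f w + g w) z = partial i f z + partial i g z"
  unfolding partial_def
  using frechet_derivative_at[OF has_derivative_add[OF assms[unfolded frechet_derivative_works]]]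
  by metis

lemma partial_diff:
  assumes "f differentiable (at z)" "g differentiable (at z)"
  shows "partial i (\<lambda>w. f w - g w) z = partial i f z - partial i g z"
  unfolding partial_def
  using frechet_derivative_at[OF has_derivative_diff[OF assms[unfolded frechet_derivative_works]]]
  by metis

lemma partial_cong_open:
  "open S \<Longrightarrow> z \<in> S \<Longrightarrow> (\<And>w. w \<in> S \<Longrightarrow> f w = g w) \<Longrightarrow> partial i f z = partial i g z"
  unfolding partial_def using frechet_derivative_cong_open by metis

lemma smooth_on_partial: "smooth_on S f \<Longrightarrow> smooth_on S (partial i f)"
  unfolding partial_def[abs_def] by (rule smooth_on_dirD)

lemma partial_commute:
  "smooth_on S f \<Longrightarrow> open S \<Longrightarrow> z \<in> S \<Longrightarrow> partial i (partial j f) z = partial j (partial i f) z"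
  unfolding partial_def[abs_def] by (rule dirD_commute)

lemma matrix_inv_2:
  fixes A :: "'a::field^2^2"
  assumes "det A \<noteq> 0"
  shows "matrix_inv A = vector [vector [A $ 2 $ 2 / det A, - A $ 1 $ 2 / det A],
     vector [- A $ 2 $ 1 / det A, A $ 1 $ 1 / det A]]" (is "_ = ?B")
proof -
  have k: "inverse (det A) * (A $ 1 $ 1 * A $ 2 $ 2 - A $ 1 $ 2 * A $ 2 $ 1) = 1" using assms by (simp add: det_2)
  have AB: "A ** ?B = mat 1"
    by (simp add: vec_eq_iff forall_2 matrix_matrix_mult_def sum_2 mat_def divide_inverse) (use k in \<open>intro conjI; algebra\<close>)
  have BA: "?B ** A = mat 1"
    by (simp add: vec_eq_iff forall_2 matrix_matrix_mult_def sum_2 mat_def divide_inverse) (use k in \<open>intro conjI; algebra\<close>)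
  have "invertible A" using AB BA unfolding invertible_def by blast
  then have "matrix_inv A ** A = mat 1"
    unfolding invertible_def matrix_inv_def by (rule someI2_ex) simp
  then have "matrix_inv A ** (A ** ?B) = ?B" by (simp add: matrix_mul_assoc)
  then show ?thesis by (simp only: AB matrix_mul_rid)
qed

text \<open>The variables stand for components and their partial derivatives at a point,
  \<open>pij\<close> for \<open>\<partial>\<^sub>i p\<^sub>j\<close>. The left side is twice the
  lowered Christoffel symbol of the metric \<open>p\<^sub>i q\<^sub>j + p\<^sub>j q\<^sub>i\<close>.
  The structure equations remove the antisymmetric parts of the derivatives, and what remains
  involves \<open>pij + hi * pj\<close> and \<open>qij - hi * qj\<close> only.\<close>

lemma lower_christoffel_identity:
  fixes pi pj pm qi qj qm hi hj hm :: real
  assumes "pij - pji = - (hi * pj - hj * pi)" "pim - pmi = - (hi * pm - hm * pi)" "pjm - pmj = - (hj * pm - hm * pj)"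
    "qij - qji = hi * qj - hj * qi" "qim - qmi = hi * qm - hm * qi" "qjm - qmj = hj * qm - hm * qj"
  shows "(pj * qim + pij * qm + (pm * qij + pim * qj)) + (pi * qjm + pji * qm + (pm * qji + pjm * qi))
    - (pi * qmj + pmi * qj + (pj * qmi + pmj * qi))
    = 2 * (pm * (qij - hi * qj) + qm * (pij + hi * pj))"
proof -
  have e: "pji = pij + (hi * pj - hj * pi)" "pmi = pim + (hi * pm - hm * pi)" "pmj = pjm + (hj * pm - hm * pj)"
    "qji = qij - (hi * qj - hj * qi)" "qmi = qim - (hi * qm - hm * qi)" "qmj = qjm - (hj * qm - hm * qj)"
    using assms by linarith+
  show ?thesis unfolding e by (simp add: algebra_simps)
qed

text \<open>A metric written as a product of two one-forms \<open>p\<close> and \<open>q\<close> has a connection form \<open>h\<close>,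
  determined by \<open>dp = - h \<and> p\<close> and \<open>dq = h \<and> q\<close>, and its curvature is \<open>dh\<close>.\<close>

locale null_coframe =
  fixes S :: "complex set" and p q h :: "2 \<Rightarrow> complex \<Rightarrow> real" and G :: "complex \<Rightarrow> real^2^2"
  assumes open_S: "open S"
    and smooth_p: "\<And>i. smooth_on S (p i)" and smooth_q: "\<And>i. smooth_on S (q i)"
    and smooth_h: "\<And>i. smooth_on S (h i)"
    and G_eq: "\<And>z i j. z \<in> S \<Longrightarrow> G z $ i $ j = p i z * q j z + p j z * q i z"
    and indep: "\<And>z. z \<in> S \<Longrightarrow> p 1 z * q 2 z - p 2 z * q 1 z \<noteq> 0"
    and dp: "\<And>z i j. z \<in> S \<Longrightarrow> partial i (p j) z - partial j (p i) z = - (h i z * p j z - h j z * p i z)"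
    and dq: "\<And>z i j. z \<in> S \<Longrightarrow> partial i (q j) z - partial j (q i) z = h i z * q j z - h j z * q i z"
begin

text \<open>\<open>X i j\<close> and \<open>Y i j\<close> turn out to be the contractions of
  \<Gamma> with \<open>p\<close> and \<open>q\<close>. This says \<nabla>p = - h \<otimes> p and
  \<nabla>q = h \<otimes> q, so that \<open>h\<close> is the connection form of the null
  coframe.\<close>

definition X where "X i j z = partial i (p j) z + h i z * p j z"
definition Y where "Y i j z = partial i (q j) z - h i z * q j z"
definition \<Delta> where "\<Delta> z = p 1 z * q 2 z - p 2 z * q 1 z"

lemmas diff_pq = smooth_on_differentiable[OF smooth_p] smooth_on_differentiable[OF smooth_q]
  smooth_on_differentiable[OF smooth_h]

lemma partial_G:
  assumes "z \<in> S"
  shows "partial i (\<lambda>w. G w $ j $ l) z =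
    (p j z * partial i (q l) z + partial i (p j) z * q l z) + (p l z * partial i (q j) z + partial i (p l) z * q j z)"
proof -
  have "partial i (\<lambda>w. G w $ j $ l) z = partial i (\<lambda>w. p j w * q l w + p l w * q j w) z"
    by (rule partial_cong_open[OF open_S assms]) (simp add: G_eq)
  then show ?thesis
    using assms by (simp add: partial_add partial_mult diff_pq)
qed

lemma det_G: "z \<in> S \<Longrightarrow> det (G z) = - (\<Delta> z)\<^sup>2"
  by (simp add: det_2 G_eq \<Delta>_def power2_eq_square algebra_simps)

text \<open>The lowered symbol is \<open>p m z * Y i j z + q m z * X i j z\<close>, and raising the
  index amounts to solving a linear system with coefficient rows \<open>p\<close> and
  \<open>q\<close>, whose determinant is \<Delta>.\<close>

lemma christoffel_eq:
  assumes z: "z \<in> S"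
  shows "christoffel G 1 i j z = (X i j z * q 2 z - Y i j z * p 2 z) / \<Delta> z"
    "christoffel G 2 i j z = (Y i j z * p 1 z - X i j z * q 1 z) / \<Delta> z"
proof -
  have S: "partial i (\<lambda>w. G w $ j $ m) z + partial j (\<lambda>w. G w $ i $ m) z - partial m (\<lambda>w. G w $ i $ j) z
     = 2 * (p m z * Y i j z + q m z * X i j z)" for m
    unfolding partial_G[OF z] X_def Y_def
    by (rule lower_christoffel_identity[OF dp dp dp dq dq dq]) (rule z)+
  have D: "\<Delta> z \<noteq> 0" using indep[OF z] by (simp add: \<Delta>_def)
  have d: "det (G z) \<noteq> 0" using D det_G[OF z] by simp
  have comb: "(a / - D\<^sup>2 * s + b / - D\<^sup>2 * t) / 2 = (a * s + b * t) / (- 2 * D\<^sup>2)"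
    if "D \<noteq> 0" for a b s t D :: real
    using that by (simp_all add: field_simps)
  \<comment> \<open>The numerator has a factor \<open>D\<close> to spare: it is
    \<open>- 2 * D\<close> times the numerator on the right, which cancels one of the two factors
    \<open>D\<close> that the determinant of the metric contributes.\<close>
  have lin1: "((p2 * q2 + p2 * q2) / - D\<^sup>2 * (2 * (p1 * y + q1 * x)) + - (p1 * q2 + p2 * q1) / - D\<^sup>2 * (2 * (p2 * y + q2 * x))) / 2
     = (x * q2 - y * p2) / D" (is "?L = _") if D: "D = p1 * q2 - p2 * q1" "D \<noteq> 0" for p1 p2 q1 q2 x y D :: real
  proof -
    have "?L = ((p2 * q2 + p2 * q2) * (2 * (p1 * y + q1 * x)) + - (p1 * q2 + p2 * q1) * (2 * (p2 * y + q2 * x))) / (- 2 * D\<^sup>2)"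
      by (rule comb(1)[OF D(2)])
    also have "(p2 * q2 + p2 * q2) * (2 * (p1 * y + q1 * x)) + - (p1 * q2 + p2 * q1) * (2 * (p2 * y + q2 * x)) = (- 2 * D) * (x * q2 - y * p2)"
      unfolding D(1) by (simp add: algebra_simps)
    also have "(- 2 * D) * (x * q2 - y * p2) / (- 2 * D\<^sup>2) = (x * q2 - y * p2) / D"
      using D(2) by (simp add: power2_eq_square)
    finally show ?thesis .
  qed
  have lin2: "(- (p2 * q1 + p1 * q2) / - D\<^sup>2 * (2 * (p1 * y + q1 * x)) + (p1 * q1 + p1 * q1) / - D\<^sup>2 * (2 * (p2 * y + q2 * x))) / 2
     = (y * p1 - x * q1) / D" (is "?L = _") if D: "D = p1 * q2 - p2 * q1" "D \<noteq> 0" for p1 p2 q1 q2 x y D :: real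
  proof -
    have "?L = (- (p2 * q1 + p1 * q2) * (2 * (p1 * y + q1 * x)) + (p1 * q1 + p1 * q1) * (2 * (p2 * y + q2 * x))) / (- 2 * D\<^sup>2)"
      by (rule comb(1)[OF D(2)])
    also have "- (p2 * q1 + p1 * q2) * (2 * (p1 * y + q1 * x)) + (p1 * q1 + p1 * q1) * (2 * (p2 * y + q2 * x)) = (- 2 * D) * (y * p1 - x * q1)"
      unfolding D(1) by (simp add: algebra_simps)
    also have "(- 2 * D) * (y * p1 - x * q1) / (- 2 * D\<^sup>2) = (y * p1 - x * q1) / D"
      using D(2) by (simp add: power2_eq_square)
    finally show ?thesis .
  qed
  show "christoffel G 1 i j z = (X i j z * q 2 z - Y i j z * p 2 z) / \<Delta> z"
    unfolding christoffel_def S sum_2 matrix_inv_2[OF d] det_G[OF z]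
    by (simp only: vector_2 G_eq[OF z] lin1[OF \<Delta>_def D])
  show "christoffel G 2 i j z = (Y i j z * p 1 z - X i j z * q 1 z) / \<Delta> z"
    unfolding christoffel_def S sum_2 matrix_inv_2[OF d] det_G[OF z]
    by (simp only: vector_2 G_eq[OF z] lin2[OF \<Delta>_def D])
qed

lemma contract:
  assumes z: "z \<in> S"
  shows "p 1 z * christoffel G 1 i j z + p 2 z * christoffel G 2 i j z = X i j z"
    "q 1 z * christoffel G 1 i j z + q 2 z * christoffel G 2 i j z = Y i j z"
proof -
  have D: "\<Delta> z \<noteq> 0" using indep[OF z] by (simp add: \<Delta>_def)
  have "p 1 z * (X i j z * q 2 z - Y i j z * p 2 z) + p 2 z * (Y i j z * p 1 z - X i j z * q 1 z) = X i j z * \<Delta> z"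
    "q 1 z * (X i j z * q 2 z - Y i j z * p 2 z) + q 2 z * (Y i j z * p 1 z - X i j z * q 1 z) = Y i j z * \<Delta> z"
    by (simp_all add: \<Delta>_def algebra_simps)
  then show "p 1 z * christoffel G 1 i j z + p 2 z * christoffel G 2 i j z = X i j z"
    "q 1 z * christoffel G 1 i j z + q 2 z * christoffel G 2 i j z = Y i j z"
    using D by (simp_all add: christoffel_eq[OF z] add_divide_distrib[symmetric])
qed

lemma smooth_X: "smooth_on S (X i j)"
  unfolding X_def[abs_def]
  by (intro smooth_on_add smooth_on_mult smooth_on_partial smooth_p smooth_h open_S)

lemma smooth_Y: "smooth_on S (Y i j)"
  unfolding Y_def[abs_def]
  by (intro smooth_on_diff smooth_on_mult smooth_on_partial smooth_q smooth_h open_S)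

lemma smooth_christoffel: "smooth_on S (christoffel G l i j)"
proof -
  have D: "smooth_on S \<Delta>" "\<And>z. z \<in> S \<Longrightarrow> \<Delta> z \<noteq> 0"
    using indep unfolding \<Delta>_def[abs_def]
    by (intro smooth_on_diff smooth_on_mult smooth_p smooth_q open_S, blast)
  have 1: "smooth_on S (\<lambda>z. (X i j z * q 2 z - Y i j z * p 2 z) / \<Delta> z)"
    by (intro smooth_on_divide_real smooth_on_diff smooth_on_mult smooth_X smooth_Y smooth_p smooth_q open_S D)
  have 2: "smooth_on S (\<lambda>z. (Y i j z * p 1 z - X i j z * q 1 z) / \<Delta> z)"
    by (intro smooth_on_divide_real smooth_on_diff smooth_on_mult smooth_X smooth_Y smooth_p smooth_q open_S D)
  have "smooth_on S (christoffel G 1 i j)" "smooth_on S (christoffel G 2 i j)"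
    using 1 2 christoffel_eq smooth_on_cong[OF open_S, of "christoffel G 1 i j" "\<lambda>z. (X i j z * q 2 z - Y i j z * p 2 z) / \<Delta> z"]
      smooth_on_cong[OF open_S, of "christoffel G 2 i j" "\<lambda>z. (Y i j z * p 1 z - X i j z * q 1 z) / \<Delta> z"] by simp_all
  then show ?thesis using exhaust_2[of l] by auto
qed

text \<open>\<open>contract\<close>, differentiated: it yields the derivatives of \<Gamma>
  contracted with \<open>p\<close> and \<open>q\<close> without differentiating the quotients in
  \<open>christoffel_eq\<close>.\<close>

lemma contract_deriv:
  assumes z: "z \<in> S"
  shows "(p 1 z * partial m (christoffel G 1 i j) z + partial m (p 1) z * christoffel G 1 i j z)
      + (p 2 z * partial m (christoffel G 2 i j) z + partial m (p 2) z * christoffel G 2 i j z)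
      = partial m (partial i (p j)) z + (h i z * partial m (p j) z + partial m (h i) z * p j z)"
    "(q 1 z * partial m (christoffel G 1 i j) z + partial m (q 1) z * christoffel G 1 i j z)
      + (q 2 z * partial m (christoffel G 2 i j) z + partial m (q 2) z * christoffel G 2 i j z)
      = partial m (partial i (q j)) z - (h i z * partial m (q j) z + partial m (h i) z * q j z)"
proof -
  note d = diff_pq[OF z] smooth_on_differentiable[OF smooth_christoffel z]
    smooth_on_differentiable[OF smooth_on_partial[OF smooth_p] z] smooth_on_differentiable[OF smooth_on_partial[OF smooth_q] z]
  note r = partial_add partial_diff partial_mult d differentiable_mult
  have "partial m (\<lambda>z. p 1 z * christoffel G 1 i j z + p 2 z * christoffel G 2 i j z) z = partial m (X i j) z"
    by (rule partial_cong_open[OF open_S z contract(1)])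
  then show "(p 1 z * partial m (christoffel G 1 i j) z + partial m (p 1) z * christoffel G 1 i j z)
      + (p 2 z * partial m (christoffel G 2 i j) z + partial m (p 2) z * christoffel G 2 i j z)
      = partial m (partial i (p j)) z + (h i z * partial m (p j) z + partial m (h i) z * p j z)"
    unfolding X_def[abs_def] by (simp add: r)
  have "partial m (\<lambda>z. q 1 z * christoffel G 1 i j z + q 2 z * christoffel G 2 i j z) z = partial m (Y i j) z"
    by (rule partial_cong_open[OF open_S z contract(2)])
  then show "(q 1 z * partial m (christoffel G 1 i j) z + partial m (q 1) z * christoffel G 1 i j z)
      + (q 2 z * partial m (christoffel G 2 i j) z + partial m (q 2) z * christoffel G 2 i j z)
      = partial m (partial i (q j)) z - (h i z * partial m (q j) z + partial m (h i) z * q j z)"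
    unfolding Y_def[abs_def] by (simp add: r)
qed

text \<open>A Ricci identity: as \<nabla>p = - h \<otimes> p and \<nabla>q = h \<otimes> q, the
  quadratic terms cancel, and the curvature tensor contracted with \<open>p\<close> and
  \<open>q\<close> is dh times \<open>p\<close> and - dh times \<open>q\<close>. Lowering its index
  with the metric combines the two into - dh times \<Delta>, and division by the determinant
  \<open>- (\<Delta> z)\<^sup>2\<close> leaves the quotient.\<close>

lemma gauss_curvature_eq:
  assumes z: "z \<in> S"
  shows "gauss_curvature G z = (partial 1 (h 2) z - partial 2 (h 1) z) / \<Delta> z"
proof -
  let ?R = "\<lambda>l. riemann_tensor G l 1 2 2 z" and ?dh = "partial 1 (h 2) z - partial 2 (h 1) z"
  let ?C = "\<lambda>l i j. christoffel G l i j z"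
  have D: "\<Delta> z \<noteq> 0" using indep[OF z] by (simp add: \<Delta>_def)
  note R = riemann_tensor_def[of G _ 1 2 2 z, unfolded sum_2]
  have comm: "partial 1 (partial 2 (p 2)) z = partial 2 (partial 1 (p 2)) z"
    "partial 1 (partial 2 (q 2)) z = partial 2 (partial 1 (q 2)) z"
    by (rule partial_commute[OF smooth_p open_S z] partial_commute[OF smooth_q open_S z])+
  have pR: "p 1 z * ?R 1 + p 2 z * ?R 2 = ?dh * p 2 z"
  proof -
    have "p 1 z * ?R 1 + p 2 z * ?R 2 =
      (p 1 z * partial 1 (christoffel G 1 2 2) z + p 2 z * partial 1 (christoffel G 2 2 2) z)
      - (p 1 z * partial 2 (christoffel G 1 1 2) z + p 2 z * partial 2 (christoffel G 2 1 2) z)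
      + ((p 1 z * ?C 1 1 1 + p 2 z * ?C 2 1 1) * ?C 1 2 2 + (p 1 z * ?C 1 1 2 + p 2 z * ?C 2 1 2) * ?C 2 2 2)
      - ((p 1 z * ?C 1 2 1 + p 2 z * ?C 2 2 1) * ?C 1 1 2 + (p 1 z * ?C 1 2 2 + p 2 z * ?C 2 2 2) * ?C 2 1 2)"
      unfolding R by (simp add: algebra_simps)
    also have "\<dots> = (partial 1 (partial 2 (p 2)) z + (h 2 z * partial 1 (p 2) z + partial 1 (h 2) z * p 2 z)
         - partial 1 (p 1) z * ?C 1 2 2 - partial 1 (p 2) z * ?C 2 2 2)
       - (partial 2 (partial 1 (p 2)) z + (h 1 z * partial 2 (p 2) z + partial 2 (h 1) z * p 2 z)
         - partial 2 (p 1) z * ?C 1 1 2 - partial 2 (p 2) z * ?C 2 1 2)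
       + (X 1 1 z * ?C 1 2 2 + X 1 2 z * ?C 2 2 2) - (X 2 1 z * ?C 1 1 2 + X 2 2 z * ?C 2 1 2)"
      using contract_deriv(1)[OF z, of 1 2 2] contract_deriv(1)[OF z, of 2 1 2]
      by (simp add: contract[OF z])
    also have "\<dots> = (h 2 z * partial 1 (p 2) z + partial 1 (h 2) z * p 2 z)
       - (h 1 z * partial 2 (p 2) z + partial 2 (h 1) z * p 2 z)
       + h 1 z * (p 1 z * ?C 1 2 2 + p 2 z * ?C 2 2 2) - h 2 z * (p 1 z * ?C 1 1 2 + p 2 z * ?C 2 1 2)"
      unfolding X_def comm by (simp add: algebra_simps)
    also have "\<dots> = ?dh * p 2 z"
      unfolding contract[OF z] X_def by (simp add: algebra_simps)
    finally show ?thesis .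
  qed
  have qR: "q 1 z * ?R 1 + q 2 z * ?R 2 = - ?dh * q 2 z"
  proof -
    have "q 1 z * ?R 1 + q 2 z * ?R 2 =
      (q 1 z * partial 1 (christoffel G 1 2 2) z + q 2 z * partial 1 (christoffel G 2 2 2) z)
      - (q 1 z * partial 2 (christoffel G 1 1 2) z + q 2 z * partial 2 (christoffel G 2 1 2) z)
      + ((q 1 z * ?C 1 1 1 + q 2 z * ?C 2 1 1) * ?C 1 2 2 + (q 1 z * ?C 1 1 2 + q 2 z * ?C 2 1 2) * ?C 2 2 2)
      - ((q 1 z * ?C 1 2 1 + q 2 z * ?C 2 2 1) * ?C 1 1 2 + (q 1 z * ?C 1 2 2 + q 2 z * ?C 2 2 2) * ?C 2 1 2)"
      unfolding R by (simp add: algebra_simps)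
    also have "\<dots> = (partial 1 (partial 2 (q 2)) z - (h 2 z * partial 1 (q 2) z + partial 1 (h 2) z * q 2 z)
         - partial 1 (q 1) z * ?C 1 2 2 - partial 1 (q 2) z * ?C 2 2 2)
       - (partial 2 (partial 1 (q 2)) z - (h 1 z * partial 2 (q 2) z + partial 2 (h 1) z * q 2 z)
         - partial 2 (q 1) z * ?C 1 1 2 - partial 2 (q 2) z * ?C 2 1 2)
       + (Y 1 1 z * ?C 1 2 2 + Y 1 2 z * ?C 2 2 2) - (Y 2 1 z * ?C 1 1 2 + Y 2 2 z * ?C 2 1 2)"
      using contract_deriv(2)[OF z, of 1 2 2] contract_deriv(2)[OF z, of 2 1 2]
      by (simp add: contract[OF z])
    also have "\<dots> = - (h 2 z * partial 1 (q 2) z + partial 1 (h 2) z * q 2 z)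
       + (h 1 z * partial 2 (q 2) z + partial 2 (h 1) z * q 2 z)
       - h 1 z * (q 1 z * ?C 1 2 2 + q 2 z * ?C 2 2 2) + h 2 z * (q 1 z * ?C 1 1 2 + q 2 z * ?C 2 1 2)"
      unfolding Y_def comm by (simp add: algebra_simps)
    also have "\<dots> = - ?dh * q 2 z"
      unfolding contract[OF z] Y_def by (simp add: algebra_simps)
    finally show ?thesis .
  qed
  have "(\<Sum>l\<in>UNIV. G z $ 1 $ l * ?R l) = p 1 z * (q 1 z * ?R 1 + q 2 z * ?R 2) + q 1 z * (p 1 z * ?R 1 + p 2 z * ?R 2)"
    by (simp add: sum_2 G_eq[OF z] algebra_simps)
  also have "\<dots> = - ?dh * \<Delta> z"
    unfolding pR qR by (simp add: \<Delta>_def algebra_simps)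
  finally have eq: "(\<Sum>l\<in>UNIV. G z $ 1 $ l * ?R l) = - ?dh * \<Delta> z" .
  have "- a * d / - d\<^sup>2 = a / d" if "d \<noteq> 0" for a d :: real
    using that by (simp add: power2_eq_square)
  then show ?thesis
    unfolding gauss_curvature_def det_G[OF z] eq using D by blast
qed

end

section \<open>Null one-forms of a metric of signature (1,1)\<close>

lemma smooth_on_nbhd:
  assumes "smooth_on S f" "open S" "x \<in> S" "open T" "f x \<in> T"
  obtains r where "r > 0" "ball x r \<subseteq> S" "\<And>y. y \<in> ball x r \<Longrightarrow> f y \<in> T"
proof -
  have "open (f -` T \<inter> S)"
    using continuous_on_open_vimage[OF assms(2)] smooth_on_imp_continuous_on[OF assms(1)] assms(4) by blast
  moreover have "x \<in> f -` T \<inter> S" using assms by simp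
  ultimately obtain r where "r > 0" "ball x r \<subseteq> f -` T \<inter> S"
    using open_contains_ball by blast
  then show ?thesis by (intro that[of r]) auto
qed

lemma bilinear_complex_expand:
  assumes "bilinear b"
  shows "b u v = Re u * Re v * b 1 1 + Re u * Im v * b 1 \<i> + Im u * Re v * b \<i> 1 + Im u * Im v * b \<i> \<i>"
proof -
  have l: "b u v = Re u * b 1 v + Im u * b \<i> v" for u v
    using linear_complex_expand[of "\<lambda>u. b u v" u] assms by (simp add: bilinear_def)
  have r: "b u v = Re v * b u 1 + Im v * b u \<i>" for u v
    using linear_complex_expand[of "b u" v] assms by (simp add: bilinear_def)
  show ?thesis
    unfolding l[of u v] r[of 1 v] r[of \<i> v] by (simp add: algebra_simps)
qed

text \<open>The Gram determinant of the pseudo-orthonormal pair is -1, and it is the determinant of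
  \<open>b\<close> times the square of the determinant of the pair.\<close>

lemma signature_1_1_discriminant:
  assumes "signature_1_1 b"
  shows "b 1 1 * b \<i> \<i> < (b 1 \<i>)\<^sup>2"
proof -
  obtain u v where uv: "b u u = 1" "b v v = -1" "b u v = 0" and sym: "symmetric_bilinear b"
    using assms by (auto simp: signature_1_1_def)
  have s: "b \<i> 1 = b 1 \<i>" and bil: "bilinear b" using sym by (auto simp: symmetric_bilinear_def)
  note ex = bilinear_complex_expand[OF bil]
  have "b u u * b v v - (b u v)\<^sup>2 = (b 1 1 * b \<i> \<i> - (b 1 \<i>)\<^sup>2) * (Re u * Im v - Im u * Re v)\<^sup>2"
    unfolding ex[of u u] ex[of v v] ex[of u v] s by (simp add: power2_eq_square algebra_simps)
  then have "(b 1 1 * b \<i> \<i> - (b 1 \<i>)\<^sup>2) * (Re u * Im v - Im u * Re v)\<^sup>2 = - 1"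
    using uv by simp
  then show ?thesis
    by (smt (verit) mult_nonneg_nonneg zero_le_power2)
qed

lemma partial_12: "partial 1 f = dirD f 1" "partial 2 f = dirD f \<i>"
  unfolding partial_def[abs_def] unit_dir_def by simp_all

text \<open>The matrix of the metric plus \<open>\<plusminus>\<surd>(- det)\<close> times the standard symplectic matrix has rank one;
  its factors are the two null one-forms.\<close>

lemma null_coframe_exists:
  fixes g :: "complex \<Rightarrow> complex \<Rightarrow> complex \<Rightarrow> real"
  assumes S: "open S" "z0 \<in> S" and g: "\<And>u v. smooth_on S (\<lambda>z. g z u v)"
    and sig: "\<And>z. z \<in> S \<Longrightarrow> signature_1_1 (g z)"
  obtains r p q h where "r > 0" "ball z0 r \<subseteq> S" "null_coframe (ball z0 r) p q h (gram g)"
proof -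
  define E F K where "E z = g z 1 1" and "F z = g z 1 \<i>" and "K z = g z \<i> \<i>" for z
  \<comment> \<open>This sign prevents cancellation in \<open>N = F + d\<close> at
    \<open>z0\<close>: \<open>N z0\<close> is at least as large in absolute value as the root of the
    discriminant, even if \<open>E\<close> or \<open>K\<close> vanishes there.\<close>
  define s :: real where "s = (if F z0 \<ge> 0 then 1 else - 1)"
  define d where "d z = s * sqrt ((F z)\<^sup>2 - E z * K z)" for z
  define N where "N z = F z + d z" for z
  have disc: "(F z)\<^sup>2 - E z * K z > 0" if "z \<in> S" for z
    unfolding E_def F_def K_def using signature_1_1_discriminant[OF sig[OF that]] by linarith
  have smE: "smooth_on S E" "smooth_on S F" "smooth_on S K"
    unfolding E_def[abs_def] F_def[abs_def] K_def[abs_def] by (rule g)+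
  have smd: "smooth_on S d"
    unfolding d_def[abs_def] power2_eq_square
    by (intro smooth_on_mult smooth_on_const smooth_on_sqrt smooth_on_diff smE S(1) disc[unfolded power2_eq_square])
  have smN: "smooth_on S N"
    unfolding N_def[abs_def] by (intro smooth_on_add smE smd S(1))
  have d2: "d z * d z = F z * F z - E z * K z" "d z \<noteq> 0" if "z \<in> S" for z
  proof -
    let ?t = "sqrt ((F z)\<^sup>2 - E z * K z)"
    have "s * s = 1" "s \<noteq> 0" by (auto simp: s_def)
    moreover have "?t * ?t = F z * F z - E z * K z" "?t \<noteq> 0"
      using disc[OF that] by (simp_all add: power2_eq_square)
    moreover have "d z * d z = (s * s) * (?t * ?t)" by (simp add: d_def)
    ultimately show "d z * d z = F z * F z - E z * K z" "d z \<noteq> 0"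
      by (simp_all only: mult_1_left d_def mult_eq_0_iff not_False_eq_True simp_thms)
  qed
  have "N z0 \<noteq> 0"
  proof -
    have signed_add_nonzero: "a + (if a \<ge> 0 then 1 else - 1) * t \<noteq> 0" if "t > 0" for a t :: real
      using that by (auto split: if_splits)
    have "sqrt ((F z0)\<^sup>2 - E z0 * K z0) > 0"
      using disc[OF S(2)] by simp
    then show ?thesis unfolding N_def d_def s_def by (rule signed_add_nonzero)
  qed
  then have "N z0 \<in> - {0}" by simp
  then obtain r where r: "r > 0" "ball z0 r \<subseteq> S" "\<And>z. z \<in> ball z0 r \<Longrightarrow> N z \<in> - {0}"
    using smooth_on_nbhd[OF smN S, of "- {0}"] by auto
  then have N0: "N z \<noteq> 0" if "z \<in> ball z0 r" for z
    using that by blast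
  let ?B = "ball z0 r"
  have oB: "open ?B" by simp
  \<comment> \<open>The quadratic form is factored: since \<open>E * K = (F - d) * N\<close>, the
    mixed coefficient \<open>N / 2 + K * E / (2 * N)\<close> is \<open>F\<close>.\<close>
  define p where "p i z = (if i = 1 then N z else K z)" for i :: 2 and z
  define q where "q i z = (if i = 1 then E z / (2 * N z) else 1 / 2)" for i :: 2 and z
  note smB = smooth_on_subset[OF _ r(2)]
  have smp: "smooth_on ?B (p i)" for i
    using smB[OF smN] smB[OF smE(3)] by (cases "i = 1") (simp_all add: p_def[abs_def])
  have smq: "smooth_on ?B (q i)" for i
  proof -
    have "smooth_on ?B (\<lambda>z. E z / (2 * N z))"
      by (intro smooth_on_divide_real smooth_on_mult smooth_on_const smB[OF smN] smB[OF smE(1)] oB) (use N0 in simp)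
    then show ?thesis by (cases "i = 1") (simp_all add: q_def[abs_def])
  qed
  define \<Delta> where "\<Delta> z = p 1 z * q 2 z - p 2 z * q 1 z" for z
  have \<Delta>: "\<Delta> z \<noteq> 0" if "z \<in> ?B" for z
  proof -
    have zS: "z \<in> S" and n: "N z \<noteq> 0" using that r(2) N0 by auto
    have "2 * N z * \<Delta> z = N z * N z - K z * E z"
      using n by (simp add: \<Delta>_def p_def q_def field_simps)
    also have "\<dots> = 2 * d z * N z"
      using d2(1)[OF zS] unfolding N_def by (simp add: algebra_simps)
    finally show ?thesis using n d2(2)[OF zS] by auto
  qed
  define dp dq where "dp z = partial 1 (p 2) z - partial 2 (p 1) z" and "dq z = partial 1 (q 2) z - partial 2 (q 1) z" for z
  \<comment> \<open>Cramer's rule for the linear equations dp = - h \<and> p and dq = h \<and> q in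
    the two components of \<open>h\<close>.\<close>
  define h where "h i z = (p i z * dq z + q i z * dp z) / \<Delta> z" for i z
  have smh: "smooth_on ?B (h i)" for i
    unfolding h_def[abs_def] dp_def dq_def using \<Delta> unfolding \<Delta>_def
    by (intro smooth_on_divide_real smooth_on_add smooth_on_diff smooth_on_mult smooth_on_partial smp smq oB) blast+
  have hp: "dp z = - (h 1 z * p 2 z - h 2 z * p 1 z)" and hq: "dq z = h 1 z * q 2 z - h 2 z * q 1 z" if "z \<in> ?B" for z
  proof -
    have h1: "h i z * \<Delta> z = p i z * dq z + q i z * dp z" for i using \<Delta>[OF that] by (simp add: h_def)
    have "(h 1 z * p 2 z - h 2 z * p 1 z) * \<Delta> z = (h 1 z * \<Delta> z) * p 2 z - (h 2 z * \<Delta> z) * p 1 z" by (simp add: algebra_simps)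
    also have "\<dots> = - dp z * \<Delta> z" unfolding h1 by (simp add: \<Delta>_def algebra_simps)
    finally have "h 1 z * p 2 z - h 2 z * p 1 z = - dp z" using mult_right_cancel[OF \<Delta>[OF that]] by blast
    then show "dp z = - (h 1 z * p 2 z - h 2 z * p 1 z)" by linarith
    have "(h 1 z * q 2 z - h 2 z * q 1 z) * \<Delta> z = (h 1 z * \<Delta> z) * q 2 z - (h 2 z * \<Delta> z) * q 1 z" by (simp add: algebra_simps)
    also have "\<dots> = dq z * \<Delta> z" unfolding h1 by (simp add: \<Delta>_def algebra_simps)
    finally have "h 1 z * q 2 z - h 2 z * q 1 z = dq z" using mult_right_cancel[OF \<Delta>[OF that]] by blast
    then show "dq z = h 1 z * q 2 z - h 2 z * q 1 z" by linarith
  qed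
  have G: "gram g z $ i $ j = p i z * q j z + p j z * q i z" if "z \<in> ?B" for z i j
  proof -
    have zS: "z \<in> S" and n: "N z \<noteq> 0" using that r(2) N0 by auto
    have sym: "g z \<i> 1 = F z" using sig[OF zS] by (auto simp: F_def signature_1_1_def symmetric_bilinear_def)
    have "K z * E z = (F z - d z) * N z" using d2(1)[OF zS] by (simp add: N_def algebra_simps)
    then have KE: "K z * (E z / N z) = F z - d z" using n by (simp add: field_simps)
    have "N z / 2 + K z * (E z / N z) / 2 = F z"
      unfolding KE by (simp add: N_def field_simps)
    then show ?thesis
      using exhaust_2[of i] exhaust_2[of j] n sym
      by (auto simp: gram_def unit_dir_def p_def q_def E_def[symmetric] F_def[symmetric] K_def[symmetric])
  qed
  have "null_coframe ?B p q h (gram g)"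
  proof
    fix z :: complex and i j :: 2 assume z: "z \<in> ?B"
    show "partial i (p j) z - partial j (p i) z = - (h i z * p j z - h j z * p i z)"
      using hp[OF z] exhaust_2[of i] exhaust_2[of j] by (auto simp: dp_def algebra_simps)
    show "partial i (q j) z - partial j (q i) z = h i z * q j z - h j z * q i z"
      using hq[OF z] exhaust_2[of i] exhaust_2[of j] by (auto simp: dq_def algebra_simps)
  qed (use smp smq smh G \<Delta> in \<open>simp_all add: \<Delta>_def\<close>)
  with r that show ?thesis by blast
qed

text \<open>Zero curvature makes the connection form closed, so h = df on a disc. Then
  \<open>exp f\<close> times \<open>p\<close> and \<open>exp (- f)\<close> times \<open>q\<close>
  are closed: the rescaling cancels \<open>h\<close> in both structure equations and leaves the
  product of the two forms, which is the metric, unchanged.\<close>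

lemma flat_null_coordinates:
  fixes g :: "complex \<Rightarrow> complex \<Rightarrow> complex \<Rightarrow> real"
  assumes S: "open S" "z0 \<in> S" and g: "\<And>u v. smooth_on S (\<lambda>z. g z u v)"
    and sig: "\<And>z. z \<in> S \<Longrightarrow> signature_1_1 (g z)"
    and flat: "\<And>z. z \<in> S \<Longrightarrow> gauss_curvature (gram g) z = 0"
  obtains r a1 a2 b1 b2 where "r > 0" "ball z0 r \<subseteq> S"
    "smooth_on (ball z0 r) a1" "smooth_on (ball z0 r) a2" "smooth_on (ball z0 r) b1" "smooth_on (ball z0 r) b2"
    "\<And>z. z \<in> ball z0 r \<Longrightarrow> dirD a2 1 z = dirD a1 \<i> z"
    "\<And>z. z \<in> ball z0 r \<Longrightarrow> dirD b2 1 z = dirD b1 \<i> z"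
    "\<And>z. z \<in> ball z0 r \<Longrightarrow> a1 z * b2 z - a2 z * b1 z \<noteq> 0"
    "\<And>z u v. z \<in> ball z0 r \<Longrightarrow> g z u v =
       (Re u * a1 z + Im u * a2 z) * (Re v * b1 z + Im v * b2 z) + (Re v * a1 z + Im v * a2 z) * (Re u * b1 z + Im u * b2 z)"
proof -
  obtain r p q h where r: "r > 0" "ball z0 r \<subseteq> S" and nc: "null_coframe (ball z0 r) p q h (gram g)"
    using null_coframe_exists[OF S g sig] by metis
  interpret null_coframe "ball z0 r" p q h "gram g" by (rule nc)
  let ?B = "ball z0 r"
  have dh: "dirD (h 1) \<i> z = dirD (h 2) 1 z" if "z \<in> ?B" for z
    using gauss_curvature_eq[OF that] flat[of z] indep[OF that] that r(2)
    by (auto simp: \<Delta>_def partial_12)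
  obtain f where f: "\<And>z. z \<in> ?B \<Longrightarrow> (f has_derivative (\<lambda>v. Re v *\<^sub>R h 1 z + Im v *\<^sub>R h 2 z)) (at z)"
    using Poincare_ball[OF smooth_h smooth_h dh] by blast
  have smf: "smooth_on ?B f"
    by (rule smooth_onI[OF open_S f], assumption)
      (intro smooth_on_add smooth_on_bilinear[OF bounded_bilinear_scaleR] smooth_h smooth_on_const open_S)
  define a where "a i z = exp (f z) * p i z" for i z
  define b where "b i z = exp (- f z) * q i z" for i z
  have sma: "smooth_on ?B (a i)" and smb: "smooth_on ?B (b i)" for i
    unfolding a_def[abs_def] b_def[abs_def]
    by (intro smooth_on_mult smooth_on_exp smooth_on_minus smf smooth_p smooth_q open_S)+
  have hd: "((\<lambda>z. exp (f z)) has_derivative (\<lambda>v. exp (f z) * (Re v * h 1 z + Im v * h 2 z))) (at z)"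
    "((\<lambda>z. exp (- f z)) has_derivative (\<lambda>v. - exp (- f z) * (Re v * h 1 z + Im v * h 2 z))) (at z)" if "z \<in> ?B" for z
    using f[OF that] by (auto intro!: derivative_eq_intros simp: algebra_simps)
  have da: "dirD (a i) v z = exp (f z) * (dirD (p i) v z + (Re v * h 1 z + Im v * h 2 z) * p i z)"
    and db: "dirD (b i) v z = exp (- f z) * (dirD (q i) v z - (Re v * h 1 z + Im v * h 2 z) * q i z)" if z: "z \<in> ?B" for i v z
  proof -
    have "(a i has_derivative (\<lambda>v. exp (f z) * dirD (p i) v z + exp (f z) * (Re v * h 1 z + Im v * h 2 z) * p i z)) (at z)"
      unfolding a_def by (intro has_derivative_mult hd(1)[OF z] smooth_on_has_derivative[OF smooth_p z])
    from frechet_derivative_at[OF this, symmetric]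
    show "dirD (a i) v z = exp (f z) * (dirD (p i) v z + (Re v * h 1 z + Im v * h 2 z) * p i z)"
      by (simp add: algebra_simps)
    have "(b i has_derivative (\<lambda>v. exp (- f z) * dirD (q i) v z + - exp (- f z) * (Re v * h 1 z + Im v * h 2 z) * q i z)) (at z)"
      unfolding b_def by (intro has_derivative_mult hd(2)[OF z] smooth_on_has_derivative[OF smooth_q z])
    from frechet_derivative_at[OF this, symmetric]
    show "dirD (b i) v z = exp (- f z) * (dirD (q i) v z - (Re v * h 1 z + Im v * h 2 z) * q i z)"
      by (simp add: algebra_simps)
  qed
  show ?thesis
  proof (rule that[OF r sma sma smb smb])
    fix z assume z: "z \<in> ?B"
    show "dirD (a 2) 1 z = dirD (a 1) \<i> z"
      using dp[OF z, of 1 2] unfolding da[OF z] by (simp add: partial_12)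
    show "dirD (b 2) 1 z = dirD (b 1) \<i> z"
      using dq[OF z, of 1 2] unfolding db[OF z] by (simp add: partial_12)
    have e: "exp (f z) * exp (- f z) = 1" by (simp add: exp_minus)
    have ab: "a i z * b j z = p i z * q j z" for i j
    proof -
      have "a i z * b j z = (exp (f z) * exp (- f z)) * (p i z * q j z)" by (simp add: a_def b_def)
      then show ?thesis unfolding e by simp
    qed
    then show "a 1 z * b 2 z - a 2 z * b 1 z \<noteq> 0" using indep[OF z] by simp
    fix u v
    have bil: "bilinear (g z)" using sig[of z] z r(2) by (auto simp: signature_1_1_def symmetric_bilinear_def)
    have gr: "g z (unit_dir i) (unit_dir j) = a i z * b j z + a j z * b i z" for i j
      using G_eq[OF z, of i j] unfolding ab by (simp add: gram_def)
    show "g z u v = (Re u * a 1 z + Im u * a 2 z) * (Re v * b 1 z + Im v * b 2 z) + (Re v * a 1 z + Im v * a 2 z) * (Re u * b 1 z + Im u * b 2 z)"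
      using gr[of 1 1] gr[of 1 2] gr[of 2 1] gr[of 2 2] unfolding bilinear_complex_expand[OF bil, of u v]
      by (simp add: unit_dir_def algebra_simps)
  qed
qed

section \<open>Null frames in Minkowski space\<close>

lemma mat2_eq_iff:
  fixes A B :: "'a^2^2"
  shows "A = B \<longleftrightarrow> A $ 1 $ 1 = B $ 1 $ 1 \<and> A $ 1 $ 2 = B $ 1 $ 2 \<and> A $ 2 $ 1 = B $ 2 $ 1 \<and> A $ 2 $ 2 = B $ 2 $ 2"
  by (auto simp: vec_eq_iff forall_2)

lemma mat2_mult_nth:
  fixes A B :: "'a::semiring_1^2^2"
  shows "(A ** B) $ i $ j = A $ i $ 1 * B $ 1 $ j + A $ i $ 2 * B $ 2 $ j"
  by (simp add: matrix_matrix_mult_def sum_2)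

lemma conj_transpose_nth [simp]: "conj_transpose X $ i $ j = cnj (X $ j $ i)"
  by (simp add: conj_transpose_def)

lemma J_mat_nth [simp]: "J_mat $ 1 $ 1 = 0" "J_mat $ 1 $ 2 = \<i>" "J_mat $ 2 $ 1 = \<i>" "J_mat $ 2 $ 2 = 0"
  by (simp_all add: J_mat_def)

text \<open>The null vectors \<open>diag2 (2 * \<i>) 0\<close> and \<open>diag2 0 (2 * \<i>)\<close>
  have product -2 and are orthogonal to the unit vector \<open>J_mat\<close>; the three form the
  reference frame that an adapted frame moves.\<close>

definition diag2 :: "complex \<Rightarrow> complex \<Rightarrow> complex^2^2" where
  "diag2 x y = vector [vector [x, 0], vector [0, y]]"

lemma diag2_nth [simp]: "diag2 x y $ 1 $ 1 = x" "diag2 x y $ 1 $ 2 = 0" "diag2 x y $ 2 $ 1 = 0" "diag2 x y $ 2 $ 2 = y"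
  by (simp_all add: diag2_def)

text \<open>The adjugate, which is the inverse on Sl_2. Unlike the inverse it is linear in the
  matrix, so its smoothness and its derivative are immediate.\<close>

definition adj2 :: "complex^2^2 \<Rightarrow> complex^2^2" where
  "adj2 X = vector [vector [X $ 2 $ 2, - X $ 1 $ 2], vector [- X $ 2 $ 1, X $ 1 $ 1]]"

lemma adj2_nth [simp]: "adj2 X $ 1 $ 1 = X $ 2 $ 2" "adj2 X $ 1 $ 2 = - X $ 1 $ 2"
  "adj2 X $ 2 $ 1 = - X $ 2 $ 1" "adj2 X $ 2 $ 2 = X $ 1 $ 1"
  by (simp_all add: adj2_def)

lemma matrix_inv_eq_adj2: "det X = 1 \<Longrightarrow> matrix_inv X = adj2 X"
  by (subst matrix_inv_2) (simp_all add: adj2_def)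

lemma adj2_mult: "det X = 1 \<Longrightarrow> adj2 X ** X = mat 1" "det X = 1 \<Longrightarrow> X ** adj2 X = mat 1"
  by (auto simp: mat2_eq_iff mat2_mult_nth det_2 mat_def algebra_simps)

lemma det_adj2: "det (adj2 X) = det X"
  by (simp add: det_2 mult.commute)

lemma conj_transpose_mult: "conj_transpose (A ** B) = conj_transpose B ** conj_transpose A" for A B :: "complex^2^2"
  by (simp add: mat2_eq_iff mat2_mult_nth algebra_simps)

lemma det_conj_transpose: "det (conj_transpose A) = cnj (det A)" for A :: "complex^2^2"
  by (simp add: det_2)

lemma conj_transpose_i_Herm2: "X \<in> i_Herm2 \<longleftrightarrow> conj_transpose X = - X"
proof
  assume "X \<in> i_Herm2"
  then obtain A where X: "X = scalar_i A" and A: "conj_transpose A = A" by (auto simp: i_Herm2_def)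
  have "cnj (A $ j $ i) = A $ i $ j" for i j
    using A by (metis conj_transpose_nth)
  then show "conj_transpose X = - X"
    by (simp add: X scalar_i_def vec_eq_iff)
next
  assume X: "conj_transpose X = - X"
  define A :: "complex^2^2" where "A = (\<chi> i j. - \<i> * X $ i $ j)"
  have c: "cnj (X $ j $ i) = - X $ i $ j" for i j
    using X by (metis conj_transpose_nth vector_uminus_component)
  have "X = scalar_i A" by (simp add: A_def scalar_i_def vec_eq_iff)
  moreover have "conj_transpose A = A" by (simp add: A_def vec_eq_iff c)
  ultimately show "X \<in> i_Herm2" by (auto simp: i_Herm2_def)
qed

lemma i_Herm2_iff: "X \<in> i_Herm2 \<longleftrightarrow> Re (X $ 1 $ 1) = 0 \<and> Re (X $ 2 $ 2) = 0 \<and> X $ 2 $ 1 = - cnj (X $ 1 $ 2)"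
proof -
  have h: "cnj z = - z \<longleftrightarrow> Re z = 0" for z by (auto simp: complex_eq_iff)
  have k: "cnj a = - b \<longleftrightarrow> b = - cnj a" "b = - cnj a \<longleftrightarrow> a = - cnj b" for a b by auto
  show ?thesis
    unfolding conj_transpose_i_Herm2 mat2_eq_iff conj_transpose_nth vector_uminus_component h k(1)
    by (metis k(2))
qed

lemma minkowski_eq: "minkowski X Y = Re (X $ 1 $ 1 * Y $ 2 $ 2 + Y $ 1 $ 1 * X $ 2 $ 2 - X $ 1 $ 2 * Y $ 2 $ 1 - Y $ 1 $ 2 * X $ 2 $ 1) / 2"
proof -
  have "det (X + Y) - det X - det Y = X $ 1 $ 1 * Y $ 2 $ 2 + Y $ 1 $ 1 * X $ 2 $ 2 - X $ 1 $ 2 * Y $ 2 $ 1 - Y $ 1 $ 2 * X $ 2 $ 1"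
    by (simp add: det_2 algebra_simps)
  then show ?thesis by (simp only: minkowski_def)
qed

text \<open>The action of Sl_2 on Minkowski space by isometries; on \<open>J_mat\<close> it gives
  the surface belonging to a frame.\<close>

definition conjg :: "complex^2^2 \<Rightarrow> complex^2^2 \<Rightarrow> complex^2^2" where
  "conjg B X = B ** X ** conj_transpose B"

lemma conjg_add: "conjg B (X + Y) = conjg B X + conjg B Y"
  by (simp add: conjg_def mat2_eq_iff mat2_mult_nth algebra_simps)

lemma conjg_conjg: "conjg A (conjg B X) = conjg (A ** B) X"
  by (simp add: conjg_def conj_transpose_mult matrix_mul_assoc)

lemma det_conjg: "det B = 1 \<Longrightarrow> det (conjg B X) = det X"
  by (simp add: conjg_def det_mul det_conj_transpose)

lemma minkowski_conjg: "det B = 1 \<Longrightarrow> minkowski (conjg B X) (conjg B Y) = minkowski X Y"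
  by (simp add: minkowski_def conjg_add[symmetric] det_conjg)

lemma conjg_i_Herm2: "X \<in> i_Herm2 \<Longrightarrow> conjg B X \<in> i_Herm2"
proof -
  assume "X \<in> i_Herm2"
  then have X: "conj_transpose X = - X" by (simp add: conj_transpose_i_Herm2)
  have ct2: "conj_transpose (conj_transpose B) = B" by (simp add: mat2_eq_iff)
  have "conj_transpose (conjg B X) = B ** (- X) ** conj_transpose B"
    by (simp add: conjg_def conj_transpose_mult ct2 X matrix_mul_assoc)
  also have "\<dots> = - conjg B X"
    by (simp add: conjg_def mat2_eq_iff mat2_mult_nth algebra_simps)
  finally show ?thesis by (simp add: conj_transpose_i_Herm2)
qed

lemma conjg_one [simp]: "conjg (mat 1) X = X"
  by (simp add: conjg_def mat2_eq_iff mat2_mult_nth) (simp add: mat_def)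

lemma conjg_adj2: "det B = 1 \<Longrightarrow> conjg (adj2 B) (conjg B X) = X" "det B = 1 \<Longrightarrow> conjg B (conjg (adj2 B) X) = X"
  by (simp_all add: conjg_conjg adj2_mult)

lemma conjg_inject: "det B = 1 \<Longrightarrow> conjg B X = conjg B Y \<longleftrightarrow> X = Y"
  by (metis conjg_adj2(1))

lemma conjg_nth: "conjg B X $ i $ j =
    (B $ i $ 1 * X $ 1 $ 1 + B $ i $ 2 * X $ 2 $ 1) * cnj (B $ j $ 1) + (B $ i $ 1 * X $ 1 $ 2 + B $ i $ 2 * X $ 2 $ 2) * cnj (B $ j $ 2)"
  by (simp add: conjg_def mat2_mult_nth)

text \<open>A future directed null vector is \<i> times a positive semidefinite Hermitian matrix of
  rank one, that is 2 \<i> times the product of a column with its conjugate transpose. This column,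
  completed to determinant 1, is \<open>C\<close>.\<close>

lemma null_vector_normal_form:
  assumes X: "X \<in> i_Herm2" "minkowski X X = 0" "Im (X $ 1 $ 1 + X $ 2 $ 2) > 0"
  obtains C where "det C = 1" "X = conjg C (diag2 (2 * \<i>) 0)"
proof -
  define a d w where "a = Im (X $ 1 $ 1)" and "d = Im (X $ 2 $ 2)" and "w = - \<i> * X $ 1 $ 2"
  have X11: "X $ 1 $ 1 = \<i> * of_real a" and X22: "X $ 2 $ 2 = \<i> * of_real d"
    and X12: "X $ 1 $ 2 = \<i> * w" and X21: "X $ 2 $ 1 = \<i> * cnj w"
    using X(1) by (simp_all add: a_def d_def w_def i_Herm2_iff complex_eq_iff)
  have ad: "complex_of_real (a * d) = w * cnj w"
  proof -
    have "a * d = (Re w)\<^sup>2 + (Im w)\<^sup>2"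
      using X(2) unfolding minkowski_eq X11 X12 X21 X22 by (simp add: power2_eq_square)
    then show ?thesis by (simp only: complex_mult_cnj)
  qed
  show ?thesis
  \<comment> \<open>The column is read off from a nonzero diagonal entry; if \<open>a\<close>
    vanishes, so does \<open>w\<close>, and \<open>d\<close> serves instead.\<close>
  proof (cases "a > 0")
    case True
    define s where "s = sqrt (a / 2)"
    have "s * s = a / 2" using True by (simp add: s_def)
    moreover have "s > 0" using True by (simp add: s_def)
    ultimately have s: "s > 0" "a = 2 * s * s" by simp_all
    define C :: "complex^2^2" where "C = vector [vector [of_real s, 0], vector [cnj w / (2 * of_real s), 1 / of_real s]]"
    have C: "C $ 1 $ 1 = of_real s" "C $ 1 $ 2 = 0" "C $ 2 $ 1 = cnj w / (2 * of_real s)" "C $ 2 $ 2 = 1 / of_real s"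
      by (simp_all add: C_def)
    have s0: "complex_of_real s \<noteq> 0" using s by simp
    have ds: "of_real d * (2 * (of_real s * of_real s)) = w * cnj w"
      using ad s(2) by (simp add: algebra_simps)
    have "X = conjg C (diag2 (2 * \<i>) 0)"
      unfolding mat2_eq_iff conjg_nth C X11 X12 X21 X22 s(2)
      using s0 ds by (simp add: field_simps)
    moreover have "det C = 1" using s0 by (simp add: det_2 C)
    ultimately show ?thesis using that by blast
  next
    case False
    have "a * d \<ge> 0" using ad by (metis complex_norm_square of_real_eq_iff zero_le_power2)
    moreover have "a + d > 0" using X(3) by (simp add: a_def d_def)
    ultimately have a0: "a = 0" and d: "d > 0" using False
      by (smt (verit) mult_neg_pos)+
    then have w0: "w = 0" using ad by simp
    define s where "s = sqrt (d / 2)"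
    have "s * s = d / 2" using d by (simp add: s_def)
    moreover have "s > 0" using d by (simp add: s_def)
    ultimately have s: "s > 0" "d = 2 * s * s" by simp_all
    define C :: "complex^2^2" where "C = vector [vector [0, - 1 / of_real s], vector [of_real s, 0]]"
    have C: "C $ 1 $ 1 = 0" "C $ 1 $ 2 = - 1 / of_real s" "C $ 2 $ 1 = of_real s" "C $ 2 $ 2 = 0"
      by (simp_all add: C_def)
    have "X = conjg C (diag2 (2 * \<i>) 0)"
      unfolding mat2_eq_iff conjg_nth C X11 X12 X21 X22 s(2) a0 w0 by simp
    moreover have "det C = 1" using s by (simp add: det_2 C)
    ultimately show ?thesis using that by blast
  qed
qed

text \<open>The stabilizer of \<open>diag2 (2 * \<i>) 0\<close> consists of the upper triangular
  matrices with diagonal \<open>e\<close>, \<open>cnj e\<close>, where \<open>e\<close> has modulus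
  1. The scalar products leave free only the off-diagonal entry of \<open>Y\<close> and the phase of
  the off-diagonal entry of \<open>F\<close>; a square root of that phase gives \<open>e\<close>,
  the entry of \<open>Y\<close> gives the corner of \<open>U\<close>.\<close>

lemma null_frame_normal_form:
  assumes Y: "Y \<in> i_Herm2" "minkowski Y Y = 0" "minkowski (diag2 (2 * \<i>) 0) Y = - 2"
    and F: "F \<in> i_Herm2" "minkowski F F = 1" "minkowski F (diag2 (2 * \<i>) 0) = 0" "minkowski F Y = 0"
  obtains U where "det U = 1" "diag2 (2 * \<i>) 0 = conjg U (diag2 (2 * \<i>) 0)" "Y = conjg U (diag2 0 (2 * \<i>))" "F = conjg U J_mat"
proof -
  define y f where "y = - \<i> * Y $ 1 $ 2" and "f = - \<i> * F $ 1 $ 2"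
  define y1 f1 where "y1 = Im (Y $ 1 $ 1)" and "f1 = Im (F $ 1 $ 1)"
  have Y22: "Y $ 2 $ 2 = 2 * \<i>" using Y(1,3) by (simp add: minkowski_eq i_Herm2_iff complex_eq_iff)
  have F22: "F $ 2 $ 2 = 0" using F(1,3) by (simp add: minkowski_eq i_Herm2_iff complex_eq_iff)
  have YF: "Y $ 1 $ 1 = \<i> * of_real y1" "Y $ 1 $ 2 = \<i> * y" "Y $ 2 $ 1 = \<i> * cnj y"
    "F $ 1 $ 1 = \<i> * of_real f1" "F $ 1 $ 2 = \<i> * f" "F $ 2 $ 1 = \<i> * cnj f"
    using Y(1) F(1) by (simp_all add: y_def f_def y1_def f1_def i_Herm2_iff complex_eq_iff)
  have "2 * y1 = (Re y)\<^sup>2 + (Im y)\<^sup>2"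
    using Y(2) unfolding minkowski_eq YF Y22 by (simp add: power2_eq_square)
  then have y1: "2 * complex_of_real y1 = y * cnj y"
    by (metis complex_mult_cnj of_real_mult of_real_numeral)
  have "(Re f)\<^sup>2 + (Im f)\<^sup>2 = 1"
    using F(2) unfolding minkowski_eq YF F22 by (simp add: power2_eq_square)
  then have f: "f * cnj f = 1" by (simp only: complex_mult_cnj of_real_1)
  have "2 * f1 = 2 * Re (f * cnj y)"
    using F(4) unfolding minkowski_eq YF F22 Y22 by (simp add: algebra_simps)
  then have f1: "2 * complex_of_real f1 = f * cnj y + cnj f * y"
    by (simp add: complex_eq_iff algebra_simps)
  define e where "e = csqrt f"
  have ef: "e * e = f" by (metis e_def power2_csqrt power2_eq_square)
  have "complex_of_real ((cmod f)\<^sup>2) = 1" unfolding complex_norm_square by (rule f)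
  then have "cmod f = 1" by (metis norm_ge_zero of_real_eq_1_iff power2_eq_1_iff real_norm_def norm_minus_cancel
      norm_one abs_of_nonneg abs_minus_cancel)
  then have "cmod e = 1" by (simp add: e_def norm_csqrt)
  then have ee: "e * cnj e = 1" by (simp add: complex_norm_square[symmetric])
  define U :: "complex^2^2" where "U = vector [vector [e, y * cnj e / 2], vector [0, cnj e]]"
  have U: "U $ 1 $ 1 = e" "U $ 1 $ 2 = y * cnj e / 2" "U $ 2 $ 1 = 0" "U $ 2 $ 2 = cnj e"
    by (simp_all add: U_def)
  have "det U = 1" using ee by (simp add: det_2 U)
  moreover have "diag2 (2 * \<i>) 0 = conjg U (diag2 (2 * \<i>) 0)"
    unfolding mat2_eq_iff conjg_nth U using ee by simp
  moreover have "Y = conjg U (diag2 0 (2 * \<i>))"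
  proof -
    have "conjg U (diag2 0 (2 * \<i>)) $ 1 $ 1 = \<i> * (y * cnj y / 2) * (e * cnj e)"
      unfolding conjg_nth U by (simp add: algebra_simps)
    also have "\<dots> = Y $ 1 $ 1" unfolding ee YF y1[symmetric] by simp
    finally have 1: "conjg U (diag2 0 (2 * \<i>)) $ 1 $ 1 = Y $ 1 $ 1" .
    have "conjg U (diag2 0 (2 * \<i>)) $ 1 $ 2 = \<i> * y * (e * cnj e)" "conjg U (diag2 0 (2 * \<i>)) $ 2 $ 1 = \<i> * cnj y * (e * cnj e)"
      "conjg U (diag2 0 (2 * \<i>)) $ 2 $ 2 = 2 * \<i> * (e * cnj e)"
      unfolding conjg_nth U by (simp_all add: algebra_simps)
    then show ?thesis unfolding ee mat2_eq_iff using 1 YF Y22 by simp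
  qed
  moreover have "F = conjg U J_mat"
  proof -
    have "conjg U J_mat $ 1 $ 1 = \<i> / 2 * ((e * e) * cnj y + cnj (e * e) * y)"
      unfolding conjg_nth U by (simp add: algebra_simps)
    also have "\<dots> = F $ 1 $ 1" unfolding ef f1[symmetric] YF by simp
    finally have 1: "conjg U J_mat $ 1 $ 1 = F $ 1 $ 1" .
    have "conjg U J_mat $ 1 $ 2 = \<i> * (e * e)" "conjg U J_mat $ 2 $ 1 = \<i> * cnj (e * e)" "conjg U J_mat $ 2 $ 2 = 0"
      unfolding conjg_nth U by simp_all
    then show ?thesis unfolding ef mat2_eq_iff using 1 YF F22 by simp
  qed
  ultimately show ?thesis using that by blast
qed

text \<open>Sl_2 acts transitively on time oriented null frames: some \<open>C\<close> normalizes
  \<open>X\<close>, and the stabilizer of the normal form takes care of the rest. This is existence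
  at a single point, with no continuity in the point.\<close>

lemma frame_exists:
  assumes X: "X \<in> i_Herm2" "minkowski X X = 0" "Im (X $ 1 $ 1 + X $ 2 $ 2) > 0"
    and Y: "Y \<in> i_Herm2" "minkowski Y Y = 0" "minkowski X Y = - 2"
    and F: "F \<in> i_Herm2" "minkowski F F = 1" "minkowski F X = 0" "minkowski F Y = 0"
  obtains B where "det B = 1" "X = conjg B (diag2 (2 * \<i>) 0)" "Y = conjg B (diag2 0 (2 * \<i>))" "F = conjg B J_mat"
proof -
  obtain C where C: "det C = 1" "X = conjg C (diag2 (2 * \<i>) 0)"
    using null_vector_normal_form[OF X] .
  let ?A = "adj2 C"
  have A: "det ?A = 1" using C by (simp add: det_adj2)
  have AX: "conjg ?A X = diag2 (2 * \<i>) 0" using C by (simp add: conjg_adj2)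
  note m = minkowski_conjg[OF A]
  obtain U where U: "det U = 1" "diag2 (2 * \<i>) 0 = conjg U (diag2 (2 * \<i>) 0)"
    "conjg ?A Y = conjg U (diag2 0 (2 * \<i>))" "conjg ?A F = conjg U J_mat"
    by (rule null_frame_normal_form[of "conjg ?A Y" "conjg ?A F"])
       (use Y F in \<open>simp_all add: m conjg_i_Herm2 AX[symmetric]\<close>)
  show ?thesis
  proof (rule that[of "C ** U"])
    show "det (C ** U) = 1" using C U by (simp add: det_mul)
    show "X = conjg (C ** U) (diag2 (2 * \<i>) 0)" using C(2) U(2) by (simp add: conjg_conjg[symmetric])
    show "Y = conjg (C ** U) (diag2 0 (2 * \<i>))" "F = conjg (C ** U) J_mat"
      using U(3,4) conjg_adj2(2)[OF C(1)] by (metis conjg_conjg)+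
  qed
qed

text \<open>The symmetric square \<open>b b\<^sup>T\<close> of the first column of the frame is a bilinear expression in
  the surface and its tangent vectors, so a smooth frame only needs a smooth square root.\<close>

lemma frame_products:
  assumes "det B = 1"
  shows "(conjg B J_mat $ i $ 1 * conjg B (diag2 (2 * \<i>) 0) $ k $ 2 - conjg B J_mat $ i $ 2 * conjg B (diag2 (2 * \<i>) 0) $ k $ 1) / 2
      = B $ i $ 1 * B $ k $ 1"
    "(conjg B (diag2 0 (2 * \<i>)) $ i $ 1 * conjg B (diag2 (2 * \<i>) 0) $ k $ 2
      - conjg B (diag2 0 (2 * \<i>)) $ i $ 2 * conjg B (diag2 (2 * \<i>) 0) $ k $ 1) / 4
      = B $ i $ 2 * B $ k $ 1"
proof -
  have d: "cnj (B $ 1 $ 1) * cnj (B $ 2 $ 2) - cnj (B $ 1 $ 2) * cnj (B $ 2 $ 1) = 1"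
    using assms by (metis complex_cnj_diff complex_cnj_mult complex_cnj_one det_2)
  have "(conjg B J_mat $ i $ 1 * conjg B (diag2 (2 * \<i>) 0) $ k $ 2 - conjg B J_mat $ i $ 2 * conjg B (diag2 (2 * \<i>) 0) $ k $ 1) / 2
      = B $ i $ 1 * B $ k $ 1 * (cnj (B $ 1 $ 1) * cnj (B $ 2 $ 2) - cnj (B $ 1 $ 2) * cnj (B $ 2 $ 1))"
    unfolding conjg_nth by (simp add: field_simps)
  then show "(conjg B J_mat $ i $ 1 * conjg B (diag2 (2 * \<i>) 0) $ k $ 2 - conjg B J_mat $ i $ 2 * conjg B (diag2 (2 * \<i>) 0) $ k $ 1) / 2
      = B $ i $ 1 * B $ k $ 1" by (simp add: d)
  have "(conjg B (diag2 0 (2 * \<i>)) $ i $ 1 * conjg B (diag2 (2 * \<i>) 0) $ k $ 2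
      - conjg B (diag2 0 (2 * \<i>)) $ i $ 2 * conjg B (diag2 (2 * \<i>) 0) $ k $ 1) / 4
      = B $ i $ 2 * B $ k $ 1 * (cnj (B $ 1 $ 1) * cnj (B $ 2 $ 2) - cnj (B $ 1 $ 2) * cnj (B $ 2 $ 1))"
    unfolding conjg_nth by (simp add: field_simps)
  then show "(conjg B (diag2 0 (2 * \<i>)) $ i $ 1 * conjg B (diag2 (2 * \<i>) 0) $ k $ 2
      - conjg B (diag2 0 (2 * \<i>)) $ i $ 2 * conjg B (diag2 (2 * \<i>) 0) $ k $ 1) / 4
      = B $ i $ 2 * B $ k $ 1" by (simp add: d)
qed

section \<open>The Maurer-Cartan form of a frame\<close>

lemma dirD_bounded_linear:
  assumes "bounded_linear L" "f differentiable (at z)"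
  shows "dirD (\<lambda>z. L (f z)) v z = L (dirD f v z)"
  using frechet_derivative_at[OF bounded_linear.has_derivative[OF assms(1) assms(2)[unfolded frechet_derivative_works]]]
  by metis

lemma dirD_bounded_bilinear:
  assumes "bounded_bilinear p" "f differentiable (at z)" "g differentiable (at z)"
  shows "dirD (\<lambda>z. p (f z) (g z)) v z = p (f z) (dirD g v z) + p (dirD f v z) (g z)"
  using frechet_derivative_at[OF bounded_bilinear.FDERIV[OF assms(1) assms(2)[unfolded frechet_derivative_works] assms(3)[unfolded frechet_derivative_works]]]
  by metis

lemma dirD_diff:
  assumes "f differentiable (at z)" "g differentiable (at z)"
  shows "dirD (\<lambda>z. f z - g z) v z = dirD f v z - dirD g v z"
  using frechet_derivative_at[OF has_derivative_diff[OF assms[unfolded frechet_derivative_works]]]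
  by metis

lemma bounded_bilinear_mat2: "bounded_bilinear ((**) :: complex^2^2 \<Rightarrow> complex^2^2 \<Rightarrow> complex^2^2)"
  unfolding bilinear_conv_bounded_bilinear[symmetric] bilinear_def
  by (intro conjI allI linearI) (simp_all add: mat2_eq_iff mat2_mult_nth algebra_simps)

lemma bounded_linear_conj_transpose: "bounded_linear (conj_transpose :: complex^2^2 \<Rightarrow> _)"
  unfolding linear_conv_bounded_linear[symmetric] by (rule linearI) (simp_all add: mat2_eq_iff)

lemma bounded_linear_adj2: "bounded_linear adj2"
  unfolding linear_conv_bounded_linear[symmetric] by (rule linearI) (simp_all add: mat2_eq_iff)

lemma minkowski_linear_right: "bounded_linear (minkowski X)"
  unfolding linear_conv_bounded_linear[symmetric]
  by (rule linearI) (simp_all add: minkowski_eq algebra_simps add_divide_distrib diff_divide_distrib)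

lemma minkowski_commute: "minkowski X Y = minkowski Y X"
  by (simp add: minkowski_eq algebra_simps)

lemma bounded_bilinear_minkowski: "bounded_bilinear minkowski"
  unfolding bilinear_conv_bounded_bilinear[symmetric] bilinear_def
  using minkowski_linear_right minkowski_commute
  by (metis (no_types, lifting) ext linear_conv_bounded_linear)

lemma smooth_on_mat_mult:
  fixes f g :: "'a::real_normed_vector \<Rightarrow> complex^2^2"
  shows "open S \<Longrightarrow> smooth_on S f \<Longrightarrow> smooth_on S g \<Longrightarrow> smooth_on S (\<lambda>z. f z ** g z)"
  by (rule smooth_on_bilinear[OF bounded_bilinear_mat2])

lemma smooth_on_conjg:
  fixes B :: "'a::real_normed_vector \<Rightarrow> complex^2^2"
  assumes "open S" "smooth_on S B"
  shows "smooth_on S (\<lambda>z. conjg (B z) X)"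
  unfolding conjg_def using assms
  by (intro smooth_on_mat_mult smooth_on_bounded_linear[OF bounded_linear_conj_transpose] smooth_on_const)

text \<open>The Maurer-Cartan form of a frame that is smooth in the real sense, as a function of the
  real tangent vector. \<open>maurer_cartan\<close> is its counterpart for holomorphic frames, where
  one complex coefficient matrix suffices.\<close>

definition mc :: "(complex \<Rightarrow> complex^2^2) \<Rightarrow> complex \<Rightarrow> complex \<Rightarrow> complex^2^2" where
  "mc B z v = adj2 (B z) ** dirD B v z"

lemma smooth_on_mc: "open S \<Longrightarrow> smooth_on S B \<Longrightarrow> smooth_on S (\<lambda>z. mc B z v)"
  unfolding mc_def
  by (intro smooth_on_mat_mult smooth_on_bounded_linear[OF bounded_linear_adj2] smooth_on_dirD)

lemma dirD_nth:
  fixes f :: "complex \<Rightarrow> complex^2^2"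
  assumes "f differentiable (at z)"
  shows "dirD (\<lambda>z. f z $ i $ j) v z = dirD f v z $ i $ j"
proof -
  have "bounded_linear (\<lambda>X :: complex^2^2. X $ i $ j)"
    unfolding linear_conv_bounded_linear[symmetric] by (rule linearI) simp_all
  from dirD_bounded_linear[OF this assms] show ?thesis .
qed

locale sl2_field =
  fixes S :: "complex set" and B :: "complex \<Rightarrow> complex^2^2"
  assumes open_S: "open S" and smooth_B: "smooth_on S B" and det_B: "\<And>z. z \<in> S \<Longrightarrow> det (B z) = 1"
begin

lemma diff_B: "z \<in> S \<Longrightarrow> B differentiable (at z)"
  using smooth_B by (rule smooth_on_differentiable)

lemma dirD_B: "z \<in> S \<Longrightarrow> dirD B v z = B z ** mc B z v"
  by (simp add: mc_def matrix_mul_assoc adj2_mult det_B)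

lemma linear_mc: "z \<in> S \<Longrightarrow> linear (mc B z)"
proof -
  assume z: "z \<in> S"
  have "bounded_linear (frechet_derivative B (at z))"
    using diff_B[OF z] has_derivative_bounded_linear frechet_derivative_works by blast
  from bounded_linear_compose[OF bounded_bilinear.bounded_linear_right[OF bounded_bilinear_mat2] this]
  show ?thesis
    unfolding mc_def[abs_def] linear_conv_bounded_linear .
qed

lemma mc_expand: "z \<in> S \<Longrightarrow> mc B z v = Re v *\<^sub>R mc B z 1 + Im v *\<^sub>R mc B z \<i>"
  by (rule linear_complex_expand[OF linear_mc])

text \<open>The derivative of the determinant, constant on \<open>S\<close>, is the trace of
  \<open>mc\<close>.\<close>

lemma mc_trace:
  assumes z: "z \<in> S"
  shows "mc B z v $ 2 $ 2 = - mc B z v $ 1 $ 1"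
proof -
  have d: "(\<lambda>z. B z $ i $ j) differentiable (at z)" for i j
    using smooth_on_differentiable[OF smooth_on_mat_nth[OF smooth_B open_S] z] .
  have p: "dirD (\<lambda>z. B z $ i $ j * B z $ k $ l) v z = B z $ i $ j * dirD B v z $ k $ l + dirD B v z $ i $ j * B z $ k $ l" for i j k l
    unfolding dirD_bounded_bilinear[OF bounded_bilinear_mult d d] by (simp add: dirD_nth[OF diff_B[OF z]])
  have dm: "(\<lambda>z. B z $ i $ j * B z $ k $ l) differentiable (at z)" for i j k l
    by (intro differentiable_mult d)
  have "dirD (\<lambda>z. B z $ 1 $ 1 * B z $ 2 $ 2 - B z $ 1 $ 2 * B z $ 2 $ 1) v z = dirD (\<lambda>z. 1) v z"
    using frechet_derivative_cong_open[OF open_S z, of "\<lambda>z. B z $ 1 $ 1 * B z $ 2 $ 2 - B z $ 1 $ 2 * B z $ 2 $ 1" "\<lambda>z. 1"]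
      det_B by (simp add: det_2)
  also have "\<dots> = 0" by simp
  finally have "dirD (\<lambda>z. B z $ 1 $ 1 * B z $ 2 $ 2) v z - dirD (\<lambda>z. B z $ 1 $ 2 * B z $ 2 $ 1) v z = 0"
    by (simp only: dirD_diff[OF dm dm])
  then have "mc B z v $ 1 $ 1 + mc B z v $ 2 $ 2 = 0"
    unfolding p by (simp add: mc_def mat2_mult_nth algebra_simps)
  then show ?thesis by (simp add: eq_neg_iff_add_eq_0 add.commute)
qed

lemma dirD_conjg:
  assumes z: "z \<in> S"
  shows "dirD (\<lambda>z. conjg (B z) J_mat) v z = conjg (B z) (mc B z v ** J_mat + J_mat ** conj_transpose (mc B z v))"
proof -
  have c: "(\<lambda>z. J_mat :: complex^2^2) differentiable (at z)" by simp
  have ct: "(\<lambda>z. conj_transpose (B z)) differentiable (at z)"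
    using smooth_on_differentiable[OF smooth_on_bounded_linear[OF bounded_linear_conj_transpose smooth_B open_S] z] .
  have bj: "(\<lambda>z. B z ** J_mat) differentiable (at z)"
    using smooth_on_differentiable[OF smooth_on_mat_mult[OF open_S smooth_B smooth_on_const] z] .
  have "dirD (\<lambda>z. B z ** J_mat ** conj_transpose (B z)) v z =
      (B z ** J_mat) ** conj_transpose (dirD B v z) + (dirD B v z ** J_mat) ** conj_transpose (B z)"
    unfolding dirD_bounded_bilinear[OF bounded_bilinear_mat2 bj ct] dirD_bounded_bilinear[OF bounded_bilinear_mat2 diff_B[OF z] c]
      dirD_bounded_linear[OF bounded_linear_conj_transpose diff_B[OF z]]
    by (simp add: mat2_eq_iff mat2_mult_nth)
  also have "\<dots> = conjg (B z) (J_mat ** conj_transpose (mc B z v)) + conjg (B z) (mc B z v ** J_mat)"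
    unfolding dirD_B[OF z] conjg_def conj_transpose_mult by (simp add: matrix_mul_assoc)
  finally show ?thesis by (simp add: conjg_def[symmetric] conjg_add add.commute)
qed

lemma structure_matrix:
  assumes z: "z \<in> S"
  shows "mc B z v ** J_mat + J_mat ** conj_transpose (mc B z v) =
    vector [vector [2 * \<i> * Re (mc B z v $ 1 $ 2), - 2 * Im (mc B z v $ 1 $ 1)],
            vector [2 * Im (mc B z v $ 1 $ 1), 2 * \<i> * Re (mc B z v $ 2 $ 1)]]"
  unfolding mat2_eq_iff vector_add_component mat2_mult_nth
  using mc_trace[OF z, of v] by (simp add: complex_eq_iff)

text \<open>Equality of the mixed derivatives of \<open>B\<close>, with \<open>dirD_B\<close>
  inserted and the factor \<open>B z\<close> cancelled; this is d\<Omega> + \<Omega> \<and> \<Omega>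
  = 0 on two constant vector fields.\<close>

lemma structure_equation:
  assumes z: "z \<in> S"
  shows "dirD (\<lambda>w. mc B w v) u z + mc B z u ** mc B z v = dirD (\<lambda>w. mc B w u) v z + mc B z v ** mc B z u"
proof -
  have m: "(\<lambda>w. mc B w v) differentiable (at z)" for v
    using smooth_on_differentiable[OF smooth_on_mc[OF open_S smooth_B] z] .
  have "dirD (dirD B v) u z = B z ** (dirD (\<lambda>w. mc B w v) u z + mc B z u ** mc B z v)" for u v
  proof -
    have "dirD (dirD B v) u z = dirD (\<lambda>w. B w ** mc B w v) u z"
      using frechet_derivative_cong_open[OF open_S z, of "dirD B v" "\<lambda>w. B w ** mc B w v"] dirD_B by simp
    also have "\<dots> = B z ** dirD (\<lambda>w. mc B w v) u z + (B z ** mc B z u) ** mc B z v"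
      unfolding dirD_bounded_bilinear[OF bounded_bilinear_mat2 diff_B[OF z] m] dirD_B[OF z] ..
    finally show ?thesis by (simp add: matrix_add_ldistrib matrix_mul_assoc)
  qed
  then have "B z ** (dirD (\<lambda>w. mc B w v) u z + mc B z u ** mc B z v) = B z ** (dirD (\<lambda>w. mc B w u) v z + mc B z v ** mc B z u)"
    using dirD_commute[OF smooth_B open_S z, of v u] by simp
  then have "(adj2 (B z) ** B z) ** (dirD (\<lambda>w. mc B w v) u z + mc B z u ** mc B z v) = (adj2 (B z) ** B z) ** (dirD (\<lambda>w. mc B w u) v z + mc B z v ** mc B z u)"
    by (simp only: matrix_mul_assoc[symmetric])
  then show ?thesis by (simp add: adj2_mult det_B[OF z])
qed

lemma structure_equation_nth:
  assumes z: "z \<in> S"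
  shows "dirD (\<lambda>w. mc B w v $ i $ j) u z + (mc B z u $ i $ 1 * mc B z v $ 1 $ j + mc B z u $ i $ 2 * mc B z v $ 2 $ j) =
     dirD (\<lambda>w. mc B w u $ i $ j) v z + (mc B z v $ i $ 1 * mc B z u $ 1 $ j + mc B z v $ i $ 2 * mc B z u $ 2 $ j)"
proof -
  have m: "(\<lambda>w. mc B w v) differentiable (at z)" for v
    using smooth_on_differentiable[OF smooth_on_mc[OF open_S smooth_B] z] .
  show ?thesis
    using arg_cong[OF structure_equation[OF z, of v u], of "\<lambda>X. X $ i $ j"]
    by (simp add: dirD_nth[OF m] mat2_mult_nth)
qed

text \<open>The diagonal entry of the Maurer-Cartan form is a real one-form whose wedge products
  with the two closed null forms vanish, so it is zero.\<close>

lemma mc_diag_eq_0: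
  assumes cl: "\<And>z. z \<in> S \<Longrightarrow> dirD a2 1 z = dirD a1 \<i> z" "\<And>z. z \<in> S \<Longrightarrow> dirD b2 1 z = dirD b1 \<i> z"
    and ind: "\<And>z. z \<in> S \<Longrightarrow> a1 z * b2 z - a2 z * b1 z \<noteq> 0"
    and dF: "\<And>z v. z \<in> S \<Longrightarrow> dirD (\<lambda>z. conjg (B z) J_mat) v z =
      conjg (B z) (diag2 (2 * \<i> * of_real (Re v * a1 z + Im v * a2 z)) (2 * \<i> * of_real (Re v * b1 z + Im v * b2 z)))"
    and z: "z \<in> S"
  shows "mc B z v $ 1 $ 1 = 0" "mc B z v $ 2 $ 2 = 0"
proof -
  have ent: "Re (mc B z v $ 1 $ 2) = Re v * a1 z + Im v * a2 z" "Re (mc B z v $ 2 $ 1) = Re v * b1 z + Im v * b2 z"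
    "Im (mc B z v $ 1 $ 1) = 0" if z: "z \<in> S" for z v
  proof -
    have "mc B z v ** J_mat + J_mat ** conj_transpose (mc B z v) =
       diag2 (2 * \<i> * of_real (Re v * a1 z + Im v * a2 z)) (2 * \<i> * of_real (Re v * b1 z + Im v * b2 z))"
      using dF[OF z, of v] unfolding dirD_conjg[OF z] conjg_inject[OF det_B[OF z]] .
    then show "Re (mc B z v $ 1 $ 2) = Re v * a1 z + Im v * a2 z" "Re (mc B z v $ 2 $ 1) = Re v * b1 z + Im v * b2 z"
      "Im (mc B z v $ 1 $ 1) = 0"
      unfolding structure_matrix[OF z] mat2_eq_iff by (simp_all add: complex_eq_iff)
  qed
  have m: "(\<lambda>w. mc B w v $ i $ j) differentiable (at z)" for v i j
    using smooth_on_differentiable[OF smooth_on_mat_nth[OF smooth_on_mc[OF open_S smooth_B] open_S] z] .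
  have re: "Re (dirD (\<lambda>w. mc B w v $ i $ j) u z) = dirD (\<lambda>w. Re (mc B w v $ i $ j)) u z" for u v i j
    using dirD_bounded_linear[OF bounded_linear_Re m] by simp
  have eqs: "dirD (\<lambda>w. Re (mc B w 1 $ 1 $ 2)) \<i> z = dirD a1 \<i> z" "dirD (\<lambda>w. Re (mc B w \<i> $ 1 $ 2)) 1 z = dirD a2 1 z"
    "dirD (\<lambda>w. Re (mc B w 1 $ 2 $ 1)) \<i> z = dirD b1 \<i> z" "dirD (\<lambda>w. Re (mc B w \<i> $ 2 $ 1)) 1 z = dirD b2 1 z"
    by (rule fun_cong[OF frechet_derivative_cong_open[OF open_S z]], simp add: ent)+
  define m1 m2 where "m1 = Re (mc B z 1 $ 1 $ 1)" and "m2 = Re (mc B z \<i> $ 1 $ 1)"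
  have mm: "mc B z 1 $ 1 $ 1 = of_real m1" "mc B z \<i> $ 1 $ 1 = of_real m2"
    using ent(3)[OF z] by (simp_all add: m1_def m2_def complex_eq_iff)
  \<comment> \<open>In the real part the derivative terms cancel by closedness. As the diagonal is
    real and trace free, twice its wedge product with the first null form is left.\<close>
  have "Re (dirD (\<lambda>w. mc B w \<i> $ 1 $ 2) 1 z + (mc B z 1 $ 1 $ 1 * mc B z \<i> $ 1 $ 2 + mc B z 1 $ 1 $ 2 * mc B z \<i> $ 2 $ 2)) =
     Re (dirD (\<lambda>w. mc B w 1 $ 1 $ 2) \<i> z + (mc B z \<i> $ 1 $ 1 * mc B z 1 $ 1 $ 2 + mc B z \<i> $ 1 $ 2 * mc B z 1 $ 2 $ 2))"
    by (rule arg_cong[OF structure_equation_nth[OF z]])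
  then have 1: "m1 * a2 z - m2 * a1 z = 0"
    using cl(1)[OF z] by (simp add: mc_trace[OF z] mm re eqs ent[OF z])
  have "Re (dirD (\<lambda>w. mc B w \<i> $ 2 $ 1) 1 z + (mc B z 1 $ 2 $ 1 * mc B z \<i> $ 1 $ 1 + mc B z 1 $ 2 $ 2 * mc B z \<i> $ 2 $ 1)) =
     Re (dirD (\<lambda>w. mc B w 1 $ 2 $ 1) \<i> z + (mc B z \<i> $ 2 $ 1 * mc B z 1 $ 1 $ 1 + mc B z \<i> $ 2 $ 2 * mc B z 1 $ 2 $ 1))"
    by (rule arg_cong[OF structure_equation_nth[OF z]])
  then have 2: "m1 * b2 z - m2 * b1 z = 0"
    using cl(2)[OF z] by (simp add: mc_trace[OF z] mm re eqs ent[OF z])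
  have "m1 * (a1 z * b2 z - a2 z * b1 z) = a1 z * (m1 * b2 z - m2 * b1 z) - b1 z * (m1 * a2 z - m2 * a1 z)"
    "m2 * (a1 z * b2 z - a2 z * b1 z) = a2 z * (m1 * b2 z - m2 * b1 z) - b2 z * (m1 * a2 z - m2 * a1 z)"
    by (simp_all add: algebra_simps)
  then have "m1 = 0" "m2 = 0" using ind[OF z] unfolding 1 2 by simp_all
  then have "mc B z v $ 1 $ 1 = 0"
    using arg_cong[OF mc_expand[OF z, of v], of "\<lambda>X. X $ 1 $ 1"] mm by simp
  then show "mc B z v $ 1 $ 1 = 0" "mc B z v $ 2 $ 2 = 0" using mc_trace[OF z, of v] by simp_all
qed

end

section \<open>Adapted frames of flat timelike surfaces\<close>

text \<open>Both facts come from differentiating an equation that holds along \<open>f\<close>: the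
  values are anti-Hermitian and have square 1.\<close>

lemma dirD_minkowski_tangent:
  assumes S: "open S" and f: "smooth_on S f" and fS: "\<And>z. z \<in> S \<Longrightarrow> f z \<in> de_sitter" and z: "z \<in> S"
  shows "dirD f v z \<in> i_Herm2" "minkowski (f z) (dirD f v z) = 0"
proof -
  have d: "f differentiable (at z)" using smooth_on_differentiable[OF f z] .
  have ct: "conj_transpose (f w) = - f w" if "w \<in> S" for w
    using fS[OF that] by (simp add: de_sitter_def conj_transpose_i_Herm2)
  have "conj_transpose (dirD f v z) = dirD (\<lambda>w. conj_transpose (f w)) v z"
    using dirD_bounded_linear[OF bounded_linear_conj_transpose d] by simp
  also have "\<dots> = dirD (\<lambda>w. - f w) v z"
    using frechet_derivative_cong_open[OF S z, of "\<lambda>w. conj_transpose (f w)" "\<lambda>w. - f w"] ct by simp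
  also have "\<dots> = - dirD f v z"
    by (rule dirD_bounded_linear[OF bounded_linear_minus[OF bounded_linear_ident] d])
  finally show "dirD f v z \<in> i_Herm2" by (simp add: conj_transpose_i_Herm2)
  have "dirD (\<lambda>w. minkowski (f w) (f w)) v z = dirD (\<lambda>w. 1) v z"
    using frechet_derivative_cong_open[OF S z, of "\<lambda>w. minkowski (f w) (f w)" "\<lambda>w. 1"] fS by (simp add: de_sitter_def)
  then show "minkowski (f z) (dirD f v z) = 0"
    unfolding dirD_bounded_bilinear[OF bounded_bilinear_minkowski d d] by (simp add: minkowski_commute)
qed

lemma conjg_diag2: "conjg B (diag2 (2 * \<i> * of_real x) (2 * \<i> * of_real y)) =
   x *\<^sub>R conjg B (diag2 (2 * \<i>) 0) + y *\<^sub>R conjg B (diag2 0 (2 * \<i>))"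
  by (simp add: mat2_eq_iff conjg_nth scaleR_conv_of_real[where 'a=complex] algebra_simps)

lemma minkowski_scaleR: "minkowski (a *\<^sub>R X) Y = a * minkowski X Y" "minkowski X (a *\<^sub>R Y) = a * minkowski X Y"
  using bounded_bilinear.scaleR_left[OF bounded_bilinear_minkowski] bounded_bilinear.scaleR_right[OF bounded_bilinear_minkowski] by auto

lemma minkowski_add: "minkowski (X + Y) Z = minkowski X Z + minkowski Y Z" "minkowski Z (X + Y) = minkowski Z X + minkowski Z Y"
  using bounded_bilinear.add_left[OF bounded_bilinear_minkowski] bounded_bilinear.add_right[OF bounded_bilinear_minkowski] by auto

lemma minkowski_diff: "minkowski (X - Y) Z = minkowski X Z - minkowski Y Z" "minkowski Z (X - Y) = minkowski Z X - minkowski Z Y"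
  using bounded_bilinear.diff_left[OF bounded_bilinear_minkowski] bounded_bilinear.diff_right[OF bounded_bilinear_minkowski] by auto

lemma i_Herm2_add: "X \<in> i_Herm2 \<Longrightarrow> Y \<in> i_Herm2 \<Longrightarrow> X + Y \<in> i_Herm2"
  and i_Herm2_diff: "X \<in> i_Herm2 \<Longrightarrow> Y \<in> i_Herm2 \<Longrightarrow> X - Y \<in> i_Herm2"
  and i_Herm2_scaleR: "X \<in> i_Herm2 \<Longrightarrow> a *\<^sub>R X \<in> i_Herm2"
  by (auto simp: i_Herm2_iff)

lemma conjg_uminus: "conjg (- B) X = conjg B X"
  by (simp add: mat2_eq_iff conjg_nth algebra_simps)

lemma det_uminus2: "det (- B) = det B" for B :: "complex^2^2"
  by (simp add: det_2)

text \<open>At each point the frame exists and is determined up to sign, so the pointwise choices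
  have to be made coherent. The products \<open>P i\<close> and \<open>Q i\<close> of the entries
  with a nonvanishing entry of the first column are smooth. A smooth square root \<open>s\<close> of
  \<open>P k\<close> selects the sign, and all entries become quotients by \<open>s\<close>.\<close>

lemma smooth_frame:
  fixes X Y F :: "complex \<Rightarrow> complex^2^2"
  assumes S: "open S" "z0 \<in> S"
    and sm: "smooth_on S X" "smooth_on S Y" "smooth_on S F"
    and H: "\<And>z. z \<in> S \<Longrightarrow> X z \<in> i_Herm2" "\<And>z. z \<in> S \<Longrightarrow> Y z \<in> i_Herm2" "\<And>z. z \<in> S \<Longrightarrow> F z \<in> i_Herm2"
    and m: "\<And>z. z \<in> S \<Longrightarrow> minkowski (X z) (X z) = 0" "\<And>z. z \<in> S \<Longrightarrow> minkowski (Y z) (Y z) = 0"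
      "\<And>z. z \<in> S \<Longrightarrow> minkowski (X z) (Y z) = - 2" "\<And>z. z \<in> S \<Longrightarrow> minkowski (F z) (F z) = 1"
      "\<And>z. z \<in> S \<Longrightarrow> minkowski (F z) (X z) = 0" "\<And>z. z \<in> S \<Longrightarrow> minkowski (F z) (Y z) = 0"
    and pos: "Im (X z0 $ 1 $ 1 + X z0 $ 2 $ 2) > 0"
  obtains r B where "r > 0" "ball z0 r \<subseteq> S" "smooth_on (ball z0 r) B" "\<And>z. z \<in> ball z0 r \<Longrightarrow> det (B z) = 1"
    "\<And>z. z \<in> ball z0 r \<Longrightarrow> X z = conjg (B z) (diag2 (2 * \<i>) 0)"
    "\<And>z. z \<in> ball z0 r \<Longrightarrow> Y z = conjg (B z) (diag2 0 (2 * \<i>))"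
    "\<And>z. z \<in> ball z0 r \<Longrightarrow> F z = conjg (B z) J_mat"
proof -
  have "smooth_on S (\<lambda>z. Im (X z $ 1 $ 1 + X z $ 2 $ 2))"
    by (intro smooth_on_Im smooth_on_add smooth_on_mat_nth sm S(1))
  then obtain r1 where r1: "r1 > 0" "ball z0 r1 \<subseteq> S" "\<And>z. z \<in> ball z0 r1 \<Longrightarrow> Im (X z $ 1 $ 1 + X z $ 2 $ 2) \<in> {0<..}"
    by (rule smooth_on_nbhd[OF _ S, where T="{0<..}"]) (use pos in auto)
  have ex: "\<exists>B. det B = 1 \<and> X z = conjg B (diag2 (2 * \<i>) 0) \<and> Y z = conjg B (diag2 0 (2 * \<i>)) \<and> F z = conjg B J_mat"
    if z: "z \<in> ball z0 r1" for z
  proof -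
    have zS: "z \<in> S" using z r1 by blast
    show ?thesis
      by (rule frame_exists[of "X z" "Y z" "F z"]) (use r1(3)[OF z] H[OF zS] m[OF zS] in auto)
  qed
  have z0: "z0 \<in> ball z0 r1" using r1 by simp
  obtain B0 where B0: "det B0 = 1" "X z0 = conjg B0 (diag2 (2 * \<i>) 0)" "F z0 = conjg B0 J_mat" using ex[OF z0] by blast
  obtain k :: 2 where k: "B0 $ k $ 1 \<noteq> 0"
    using B0(1) by (metis det_2 diff_zero mult_zero_left mult_zero_right zero_neq_one)
  define P where "P i z = (F z $ i $ 1 * X z $ k $ 2 - F z $ i $ 2 * X z $ k $ 1) / 2" for i z
  define Q where "Q i z = (Y z $ i $ 1 * X z $ k $ 2 - Y z $ i $ 2 * X z $ k $ 1) / 4" for i z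
  have smP: "smooth_on S (P i)" and smQ: "smooth_on S (Q i)" for i
    unfolding P_def[abs_def] Q_def[abs_def] divide_inverse
    by (intro smooth_on_mult smooth_on_diff smooth_on_mat_nth sm S(1) smooth_on_const)+
  have Pk: "P k z0 = B0 $ k $ 1 * B0 $ k $ 1"
    unfolding P_def B0(2,3) by (rule frame_products[OF B0(1)])
  \<comment> \<open>Dividing by the value at \<open>z0\<close> puts the argument of the root near 1,
    away from the branch cut.\<close>
  define q where "q z = P k z / P k z0" for z
  have smq: "smooth_on S q" unfolding q_def[abs_def] divide_inverse
    by (intro smooth_on_mult smP smooth_on_const S(1))
  obtain r where r: "r > 0" "ball z0 r \<subseteq> ball z0 r1" "\<And>z. z \<in> ball z0 r \<Longrightarrow> q z \<in> - \<real>\<^sub>\<le>\<^sub>0"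
    by (rule smooth_on_nbhd[OF smooth_on_subset[OF smq r1(2)] open_ball z0, where T="- \<real>\<^sub>\<le>\<^sub>0"])
       (use Pk k in \<open>auto simp: q_def closed_nonpos_Reals_complex open_Compl\<close>)
  let ?B = "ball z0 r"
  define s where "s z = B0 $ k $ 1 * csqrt (q z)" for z
  have sms: "smooth_on ?B s"
    unfolding s_def[abs_def]
    by (intro smooth_on_mult smooth_on_const smooth_on_csqrt smooth_on_subset[OF smq]) (use r r1 in auto)
  have s2: "s z * s z = P k z" for z
  proof -
    have "s z * s z = (B0 $ k $ 1 * B0 $ k $ 1) * (csqrt (q z))\<^sup>2" by (simp add: s_def power2_eq_square)
    also have "\<dots> = P k z" using k Pk by (simp add: q_def)
    finally show ?thesis .
  qed
  have s0: "s z \<noteq> 0" if "z \<in> ?B" for z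
  proof -
    have "q z \<noteq> 0" using r(3)[OF that] by auto
    then show ?thesis using k by (simp add: s_def)
  qed
  \<comment> \<open>\<open>B\<close> and \<open>- B\<close> give the same frame, and one of them has
    \<open>s z\<close> in the chosen place.\<close>
  have "\<forall>z\<in>?B. \<exists>B. det B = 1 \<and> X z = conjg B (diag2 (2 * \<i>) 0) \<and> Y z = conjg B (diag2 0 (2 * \<i>)) \<and> F z = conjg B J_mat
      \<and> B $ k $ 1 = s z"
  proof
    fix z assume z: "z \<in> ?B"
    then have "z \<in> ball z0 r1" using r by blast
    then obtain B where B: "det B = 1" "X z = conjg B (diag2 (2 * \<i>) 0)" "Y z = conjg B (diag2 0 (2 * \<i>))" "F z = conjg B J_mat"
      using ex by blast
    have "B $ k $ 1 * B $ k $ 1 = P k z" unfolding P_def B(2,4) by (rule frame_products(1)[OF B(1), symmetric])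
    then have "B $ k $ 1 * B $ k $ 1 = s z * s z" by (simp add: s2)
    then have "B $ k $ 1 = s z \<or> (- B) $ k $ 1 = s z"
      by (auto simp: square_eq_iff)
    then show "\<exists>B. det B = 1 \<and> X z = conjg B (diag2 (2 * \<i>) 0) \<and> Y z = conjg B (diag2 0 (2 * \<i>)) \<and> F z = conjg B J_mat
      \<and> B $ k $ 1 = s z"
      using B conjg_uminus[of B] det_uminus2[of B] by metis
  qed
  then obtain B where B: "\<And>z. z \<in> ?B \<Longrightarrow> det (B z) = 1" "\<And>z. z \<in> ?B \<Longrightarrow> X z = conjg (B z) (diag2 (2 * \<i>) 0)"
    "\<And>z. z \<in> ?B \<Longrightarrow> Y z = conjg (B z) (diag2 0 (2 * \<i>))" "\<And>z. z \<in> ?B \<Longrightarrow> F z = conjg (B z) J_mat"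
    "\<And>z. z \<in> ?B \<Longrightarrow> B z $ k $ 1 = s z"
    by metis
  have ent: "B z $ i $ 1 = P i z / s z" "B z $ i $ 2 = Q i z / s z" if z: "z \<in> ?B" for z i
  proof -
    have "P i z = B z $ i $ 1 * s z" "Q i z = B z $ i $ 2 * s z"
      unfolding P_def Q_def B(2)[OF z] B(3)[OF z] B(4)[OF z] frame_products[OF B(1)[OF z]] B(5)[OF z] by simp_all
    then show "B z $ i $ 1 = P i z / s z" "B z $ i $ 2 = Q i z / s z" using s0[OF z] by simp_all
  qed
  have BS: "?B \<subseteq> S" using r r1 by blast
  have smB: "smooth_on ?B B"
  proof (rule smooth_on_matI)
    fix i j :: 2
    have 1: "smooth_on ?B (\<lambda>z. P i z / s z)" "smooth_on ?B (\<lambda>z. Q i z / s z)"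
      by (rule smooth_on_divide_complex[OF smooth_on_subset[OF smP BS] sms open_ball s0], assumption,
          rule smooth_on_divide_complex[OF smooth_on_subset[OF smQ BS] sms open_ball s0], assumption)
    then have "smooth_on ?B (\<lambda>z. B z $ i $ 1)" "smooth_on ?B (\<lambda>z. B z $ i $ 2)"
      using smooth_on_cong[OF open_ball, of z0 r "\<lambda>z. B z $ i $ 1" "\<lambda>z. P i z / s z"]
        smooth_on_cong[OF open_ball, of z0 r "\<lambda>z. B z $ i $ 2" "\<lambda>z. Q i z / s z"] ent by simp_all
    then show "smooth_on ?B (\<lambda>z. B z $ i $ j)" using exhaust_2[of j] by auto
  qed simp
  show ?thesis by (rule that[OF r(1) BS smB]) (use B in auto)
qed

text \<open>\<open>X\<close> and \<open>Y\<close> are the derivatives of \<open>f\<close> along the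
  vector fields dual to the forms, so that df = \<alpha> X + \<beta> Y. The shape of the metric
  makes them null with product -2, and \<open>pos\<close> says that \<open>X\<close> is future
  directed at \<open>z0\<close>; this is what \<open>smooth_frame\<close> asks for.\<close>

lemma adapted_frame:
  assumes S: "open S" "z0 \<in> S" and f: "smooth_on S f" and fS: "\<And>z. z \<in> S \<Longrightarrow> f z \<in> de_sitter"
    and sm: "smooth_on S a1" "smooth_on S a2" "smooth_on S b1" "smooth_on S b2"
    and cl: "\<And>z. z \<in> S \<Longrightarrow> dirD a2 1 z = dirD a1 \<i> z" "\<And>z. z \<in> S \<Longrightarrow> dirD b2 1 z = dirD b1 \<i> z"
    and ind: "\<And>z. z \<in> S \<Longrightarrow> a1 z * b2 z - a2 z * b1 z \<noteq> 0"
    and g: "\<And>z u v. z \<in> S \<Longrightarrow> minkowski (dirD f u z) (dirD f v z) =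
      - 2 * ((Re u * a1 z + Im u * a2 z) * (Re v * b1 z + Im v * b2 z) + (Re v * a1 z + Im v * a2 z) * (Re u * b1 z + Im u * b2 z))"
    and pos: "Im (trace (b2 z0 *\<^sub>R dirD f 1 z0 - b1 z0 *\<^sub>R dirD f \<i> z0)) / (a1 z0 * b2 z0 - a2 z0 * b1 z0) > 0"
  obtains r B where "r > 0" "ball z0 r \<subseteq> S" "sl2_field (ball z0 r) B"
    "\<And>z. z \<in> ball z0 r \<Longrightarrow> f z = conjg (B z) J_mat"
    "\<And>z v. z \<in> ball z0 r \<Longrightarrow> mc B z v $ 1 $ 1 = 0" "\<And>z v. z \<in> ball z0 r \<Longrightarrow> mc B z v $ 2 $ 2 = 0"
proof -
  define D where "D z = a1 z * b2 z - a2 z * b1 z" for z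
  define X where "X z = (b2 z / D z) *\<^sub>R dirD f 1 z + (- b1 z / D z) *\<^sub>R dirD f \<i> z" for z
  define Y where "Y z = (- a2 z / D z) *\<^sub>R dirD f 1 z + (a1 z / D z) *\<^sub>R dirD f \<i> z" for z
  have D: "D z \<noteq> 0" if "z \<in> S" for z using ind[OF that] by (simp add: D_def)
  have smD: "smooth_on S D" unfolding D_def[abs_def] by (intro smooth_on_diff smooth_on_mult sm S(1))
  note smooth_comb = smooth_on_add smooth_on_bilinear[OF bounded_bilinear_scaleR] smooth_on_divide_real smooth_on_minus
    smooth_on_dirD f sm smD S(1) D
  have smX: "smooth_on S X"
    unfolding X_def[abs_def] by (intro smooth_comb)
  have smY: "smooth_on S Y"
    unfolding Y_def[abs_def] by (intro smooth_comb)
  have f11: "minkowski (dirD f 1 z) (dirD f 1 z) = - 4 * a1 z * b1 z"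
    "minkowski (dirD f 1 z) (dirD f \<i> z) = - 2 * (a1 z * b2 z + a2 z * b1 z)"
    "minkowski (dirD f \<i> z) (dirD f 1 z) = - 2 * (a1 z * b2 z + a2 z * b1 z)"
    "minkowski (dirD f \<i> z) (dirD f \<i> z) = - 4 * a2 z * b2 z" if "z \<in> S" for z
    using g[OF that, of 1 1] g[OF that, of 1 \<i>] g[OF that, of \<i> 1] g[OF that, of \<i> \<i>] by simp_all
  have mXX: "minkowski (X z) (X z) = 0" and mYY: "minkowski (Y z) (Y z) = 0" and mXY: "minkowski (X z) (Y z) = - 2"
    if z: "z \<in> S" for z
  proof -
    have e: "minkowski ((x / D z) *\<^sub>R dirD f 1 z + (y / D z) *\<^sub>R dirD f \<i> z) ((x' / D z) *\<^sub>R dirD f 1 z + (y' / D z) *\<^sub>R dirD f \<i> z)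
      = (x * x' * (- 4 * a1 z * b1 z) + (x * y' + y * x') * (- 2 * (a1 z * b2 z + a2 z * b1 z)) + y * y' * (- 4 * a2 z * b2 z)) / (D z * D z)"
      for x y x' y'
      unfolding minkowski_add minkowski_scaleR f11[OF z] using D[OF z] by (simp add: field_simps)
    show "minkowski (X z) (X z) = 0" "minkowski (Y z) (Y z) = 0"
      unfolding X_def Y_def e by (simp_all add: algebra_simps)
    have "b2 z * - a2 z * (- 4 * a1 z * b1 z) + (b2 z * a1 z + - b1 z * - a2 z) * (- 2 * (a1 z * b2 z + a2 z * b1 z)) + - b1 z * a1 z * (- 4 * a2 z * b2 z)
       = - 2 * (D z * D z)" by (simp add: D_def algebra_simps)
    then show "minkowski (X z) (Y z) = - 2"
      unfolding X_def Y_def e using D[OF z] by simp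
  qed
  have df: "dirD f v z = (Re v * a1 z + Im v * a2 z) *\<^sub>R X z + (Re v * b1 z + Im v * b2 z) *\<^sub>R Y z" if z: "z \<in> S" for z v
  proof -
    let ?A = "Re v * a1 z + Im v * a2 z" and ?E = "Re v * b1 z + Im v * b2 z"
    have "?A *\<^sub>R X z + ?E *\<^sub>R Y z = (?A * (b2 z / D z) + ?E * (- a2 z / D z)) *\<^sub>R dirD f 1 z + (?A * (- b1 z / D z) + ?E * (a1 z / D z)) *\<^sub>R dirD f \<i> z"
    proof -
      have "A *\<^sub>R (x *\<^sub>R U + y *\<^sub>R V) + E *\<^sub>R (x' *\<^sub>R U + y' *\<^sub>R V) = (A * x + E * x') *\<^sub>R U + (A * y + E * y') *\<^sub>R V"
        for A E x y x' y' :: real and U V :: "complex^2^2"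
        by (simp add: algebra_simps)
      then show ?thesis unfolding X_def Y_def .
    qed
    also have "?A * (b2 z / D z) + ?E * (- a2 z / D z) = (Re v * D z) / D z"
      by (simp add: D_def add_divide_distrib[symmetric] diff_divide_distrib[symmetric] algebra_simps)
    also have "?A * (- b1 z / D z) + ?E * (a1 z / D z) = (Im v * D z) / D z"
      by (simp add: D_def add_divide_distrib[symmetric] diff_divide_distrib[symmetric] algebra_simps)
    finally have "?A *\<^sub>R X z + ?E *\<^sub>R Y z = Re v *\<^sub>R dirD f 1 z + Im v *\<^sub>R dirD f \<i> z" using D[OF z] by simp
    also have "\<dots> = dirD f v z" by (rule dirD_expand[OF smooth_on_differentiable[OF f z], symmetric])
    finally show ?thesis by simp
  qed
  have tan: "dirD f v z \<in> i_Herm2" "minkowski (f z) (dirD f v z) = 0" if "z \<in> S" for z v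
    using dirD_minkowski_tangent[OF S(1) f fS that] by auto
  have fH: "f z \<in> i_Herm2" "minkowski (f z) (f z) = 1" if "z \<in> S" for z using fS[OF that] by (auto simp: de_sitter_def)
  have XH: "X z \<in> i_Herm2" "Y z \<in> i_Herm2" "minkowski (f z) (X z) = 0" "minkowski (f z) (Y z) = 0" if "z \<in> S" for z
    unfolding X_def Y_def minkowski_add minkowski_scaleR tan(2)[OF that]
    by (simp_all add: i_Herm2_add i_Herm2_diff i_Herm2_scaleR tan(1)[OF that])
  have pos': "Im (X z0 $ 1 $ 1 + X z0 $ 2 $ 2) > 0"
  proof -
    have "Im (X z0 $ 1 $ 1 + X z0 $ 2 $ 2) = Im (trace (b2 z0 *\<^sub>R dirD f 1 z0 - b1 z0 *\<^sub>R dirD f \<i> z0)) / D z0"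
      by (simp add: X_def trace_def sum_2 diff_divide_distrib add_divide_distrib)
    then show ?thesis using pos by (simp add: D_def)
  qed
  show thesis
  proof (rule smooth_frame[OF S smX smY f XH(1,2) fH(1) mXX mYY mXY fH(2) XH(3,4) pos'])
    fix r B assume r: "r > 0" "ball z0 r \<subseteq> S" and smB: "smooth_on (ball z0 r) B"
      and B: "\<And>z. z \<in> ball z0 r \<Longrightarrow> det (B z) = 1"
      "\<And>z. z \<in> ball z0 r \<Longrightarrow> X z = conjg (B z) (diag2 (2 * \<i>) 0)"
      "\<And>z. z \<in> ball z0 r \<Longrightarrow> Y z = conjg (B z) (diag2 0 (2 * \<i>))"
      "\<And>z. z \<in> ball z0 r \<Longrightarrow> f z = conjg (B z) J_mat"
    interpret sl2_field "ball z0 r" B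
      by unfold_locales (use smB B in auto)
    have dF: "dirD (\<lambda>z. conjg (B z) J_mat) v z =
        conjg (B z) (diag2 (2 * \<i> * of_real (Re v * a1 z + Im v * a2 z)) (2 * \<i> * of_real (Re v * b1 z + Im v * b2 z)))"
      if z: "z \<in> ball z0 r" for z v
    proof -
      have "dirD (\<lambda>z. conjg (B z) J_mat) v z = dirD f v z"
        using frechet_derivative_cong_open[OF open_ball z, of "\<lambda>z. conjg (B z) J_mat" f] B(4) by simp
      then show ?thesis
        unfolding conjg_diag2 B(2)[OF z, symmetric] B(3)[OF z, symmetric] using df z r by auto
    qed
    have sub: "z \<in> S" if "z \<in> ball z0 r" for z using that r by blast
    note diag = mc_diag_eq_0[OF cl[OF sub] ind[OF sub] dF]
    show thesis
      by (rule that[OF r sl2_field_axioms B(4) diag])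
  qed
qed

text \<open>The imaginary part of the trace is, up to a factor, the time coordinate, and the metric
  is positive definite where it vanishes.\<close>

lemma trace_0_null_imp_0:
  assumes "X \<in> i_Herm2" "minkowski X X = 0" "Im (trace X) = 0"
  shows "X = 0"
proof -
  have d: "Im (X $ 2 $ 2) = - Im (X $ 1 $ 1)" using assms(3) by (simp add: trace_def sum_2)
  have "(Im (X $ 1 $ 1))\<^sup>2 + ((Re (X $ 1 $ 2))\<^sup>2 + (Im (X $ 1 $ 2))\<^sup>2) = 0"
    using assms(1,2) d by (simp add: minkowski_eq i_Herm2_iff power2_eq_square)
  then have "Im (X $ 1 $ 1) = 0" "Re (X $ 1 $ 2) = 0" "Im (X $ 1 $ 2) = 0"
    by (smt (verit) zero_le_power2 power2_eq_iff_nonneg power_zero_numeral zero_eq_power2)+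
  then show ?thesis using assms(1) d by (simp add: mat2_eq_iff i_Herm2_iff complex_eq_iff)
qed

text \<open>The closed forms a, b of the flat metric 2 a b enter as \<alpha> = \<sigma> a / 2 and
  \<beta> = - \<sigma> b, so that - 4 \<alpha> \<beta> is the metric for either sign \<sigma>. The
  sign is spent on making the first null vector future directed.\<close>

lemma local_frame:
  assumes S: "open S" "z0 \<in> S" and f: "smooth_on S f" and fS: "\<And>z. z \<in> S \<Longrightarrow> f z \<in> de_sitter"
    and g: "\<And>u v. smooth_on S (\<lambda>z. g z u v)" "\<And>z. z \<in> S \<Longrightarrow> signature_1_1 (g z)"
    and flat: "\<And>z. z \<in> S \<Longrightarrow> gauss_curvature (gram g) z = 0"
    and iso: "\<And>z u v. z \<in> S \<Longrightarrow> g z u v = minkowski (dirD f u z) (dirD f v z)"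
  obtains r B where "r > 0" "ball z0 r \<subseteq> S" "sl2_field (ball z0 r) B"
    "\<And>z. z \<in> ball z0 r \<Longrightarrow> f z = conjg (B z) J_mat"
    "\<And>z v. z \<in> ball z0 r \<Longrightarrow> mc B z v $ 1 $ 1 = 0" "\<And>z v. z \<in> ball z0 r \<Longrightarrow> mc B z v $ 2 $ 2 = 0"
proof -
  show thesis
  proof (rule flat_null_coordinates[OF S g flat])
    fix r a1 a2 b1 b2 assume r: "r > 0" "ball z0 r \<subseteq> S"
      and sm: "smooth_on (ball z0 r) a1" "smooth_on (ball z0 r) a2" "smooth_on (ball z0 r) b1" "smooth_on (ball z0 r) b2"
      and cl: "\<And>z. z \<in> ball z0 r \<Longrightarrow> dirD a2 1 z = dirD a1 \<i> z" "\<And>z. z \<in> ball z0 r \<Longrightarrow> dirD b2 1 z = dirD b1 \<i> z"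
      and ind: "\<And>z. z \<in> ball z0 r \<Longrightarrow> a1 z * b2 z - a2 z * b1 z \<noteq> 0"
      and geq: "\<And>z u v. z \<in> ball z0 r \<Longrightarrow> g z u v =
         (Re u * a1 z + Im u * a2 z) * (Re v * b1 z + Im v * b2 z) + (Re v * a1 z + Im v * a2 z) * (Re u * b1 z + Im u * b2 z)"
    let ?B = "ball z0 r"
    have z0: "z0 \<in> ?B" using r by simp
    have sub: "z \<in> S" if "z \<in> ?B" for z using that r by blast
    have fB: "smooth_on ?B f" using smooth_on_subset[OF f r(2)] .
    define V where "V = b2 z0 *\<^sub>R dirD f 1 z0 - b1 z0 *\<^sub>R dirD f \<i> z0"
    \<comment> \<open>\<open>V\<close> is a multiple of the null vector dual to the first form,
      \<open>W\<close> of the one dual to the second. Their product \<open>- (D * D)\<close> shows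
      that \<open>V\<close> is not 0, so it has a definite time direction.\<close>
    define W where "W = a2 z0 *\<^sub>R dirD f 1 z0 - a1 z0 *\<^sub>R dirD f \<i> z0"
    define D where "D = a1 z0 * b2 z0 - a2 z0 * b1 z0"
    have D: "D \<noteq> 0" using ind[OF z0] by (simp add: D_def)
    have f11: "minkowski (dirD f u z0) (dirD f v z0) = g z0 u v" for u v using iso[OF S(2)] by simp
    have VH: "V \<in> i_Herm2"
      unfolding V_def using dirD_minkowski_tangent(1)[OF S(1) f fS S(2)]
      by (simp add: i_Herm2_diff i_Herm2_scaleR)
    have V0: "minkowski V V = 0" and VW: "minkowski V W = - (D * D)"
      unfolding V_def W_def minkowski_diff minkowski_scaleR f11 geq[OF z0] D_def
      by (simp_all add: algebra_simps)
    have t: "Im (trace V) \<noteq> 0"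
    proof
      assume "Im (trace V) = 0"
      then have "V = 0" by (rule trace_0_null_imp_0[OF VH V0])
      then have "minkowski V W = 0" by (simp add: minkowski_eq)
      then show False using VW D by simp
    qed
    define \<sigma> :: real where "\<sigma> = (if Im (trace V) / D > 0 then 1 else - 1)"
    have s2: "\<sigma> * \<sigma> = 1" "\<sigma> \<noteq> 0" by (auto simp: \<sigma>_def)
    have tr: "trace (x *\<^sub>R X) = of_real x * trace X" for x and X :: "complex^2^2"
      by (simp add: trace_def sum_2 scaleR_conv_of_real[where 'a=complex] algebra_simps)
    have dsc: "dirD (\<lambda>z. c * h z) v z = c * dirD h v z" if "smooth_on ?B h" "z \<in> ?B" for c :: real and h v z
      by (rule dirD_bounded_linear[OF bounded_linear_mult_right smooth_on_differentiable[OF that]])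
    let ?a = "\<sigma> / 2"
    show thesis
    proof (rule adapted_frame[OF open_ball z0 fB fS[OF sub], of "\<lambda>z. ?a * a1 z" "\<lambda>z. ?a * a2 z" "\<lambda>z. - \<sigma> * b1 z" "\<lambda>z. - \<sigma> * b2 z"])
      show "smooth_on ?B (\<lambda>z. ?a * a1 z)" "smooth_on ?B (\<lambda>z. ?a * a2 z)" "smooth_on ?B (\<lambda>z. - \<sigma> * b1 z)" "smooth_on ?B (\<lambda>z. - \<sigma> * b2 z)"
        by (intro smooth_on_mult smooth_on_const sm open_ball)+
      show "dirD (\<lambda>z. ?a * a2 z) 1 z = dirD (\<lambda>z. ?a * a1 z) \<i> z" if "z \<in> ?B" for z
        unfolding dsc[OF sm(1) that] dsc[OF sm(2) that] cl(1)[OF that] ..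
      show "dirD (\<lambda>z. - \<sigma> * b2 z) 1 z = dirD (\<lambda>z. - \<sigma> * b1 z) \<i> z" if "z \<in> ?B" for z
        unfolding dsc[OF sm(3) that] dsc[OF sm(4) that] cl(2)[OF that] ..
      show "?a * a1 z * (- \<sigma> * b2 z) - ?a * a2 z * (- \<sigma> * b1 z) \<noteq> 0" if "z \<in> ?B" for z
      proof -
        have "?a * a1 z * (- \<sigma> * b2 z) - ?a * a2 z * (- \<sigma> * b1 z) = - (\<sigma> * \<sigma>) / 2 * (a1 z * b2 z - a2 z * b1 z)"
          by (simp add: field_simps)
        then show ?thesis using ind[OF that] s2 by simp
      qed
      show "minkowski (dirD f u z) (dirD f v z) = - 2 * ((Re u * (?a * a1 z) + Im u * (?a * a2 z)) * (Re v * (- \<sigma> * b1 z) + Im v * (- \<sigma> * b2 z))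
         + (Re v * (?a * a1 z) + Im v * (?a * a2 z)) * (Re u * (- \<sigma> * b1 z) + Im u * (- \<sigma> * b2 z)))" if "z \<in> ?B" for z u v
      proof -
        have "- 2 * ((Re u * (?a * a1 z) + Im u * (?a * a2 z)) * (Re v * (- \<sigma> * b1 z) + Im v * (- \<sigma> * b2 z))
         + (Re v * (?a * a1 z) + Im v * (?a * a2 z)) * (Re u * (- \<sigma> * b1 z) + Im u * (- \<sigma> * b2 z))) = (\<sigma> * \<sigma>) * g z u v"
          unfolding geq[OF that] by (simp add: field_simps)
        then show ?thesis using iso[OF sub[OF that]] s2 by simp
      qed
      have e1: "(- \<sigma> * b2 z0) *\<^sub>R dirD f 1 z0 - (- \<sigma> * b1 z0) *\<^sub>R dirD f \<i> z0 = (- \<sigma>) *\<^sub>R V"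
        by (simp add: V_def algebra_simps)
      have e2: "?a * a1 z0 * (- \<sigma> * b2 z0) - ?a * a2 z0 * (- \<sigma> * b1 z0) = - (\<sigma> * \<sigma>) / 2 * D"
        by (simp add: D_def field_simps)
      have "Im (trace ((- \<sigma> * b2 z0) *\<^sub>R dirD f 1 z0 - (- \<sigma> * b1 z0) *\<^sub>R dirD f \<i> z0)) / (?a * a1 z0 * (- \<sigma> * b2 z0) - ?a * a2 z0 * (- \<sigma> * b1 z0))
        = 2 * (\<sigma> * (Im (trace V) / D))"
        unfolding e1 e2 tr s2(1) using D by (simp add: field_simps)
      moreover have "\<sigma> * (Im (trace V) / D) > 0"
      proof -
        have "Im (trace V) / D \<noteq> 0" using t D by simp
        moreover have "(if x > 0 then 1 else - 1) * x > 0" if "x \<noteq> 0" for x :: real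
          using that by auto
        ultimately show ?thesis unfolding \<sigma>_def by blast
      qed
      ultimately show "Im (trace ((- \<sigma> * b2 z0) *\<^sub>R dirD f 1 z0 - (- \<sigma> * b1 z0) *\<^sub>R dirD f \<i> z0)) / (?a * a1 z0 * (- \<sigma> * b2 z0) - ?a * a2 z0 * (- \<sigma> * b1 z0)) > 0"
        by linarith
    next
      fix r' B assume *: "r' > 0" "ball z0 r' \<subseteq> ?B" "sl2_field (ball z0 r') B"
        "\<And>z. z \<in> ball z0 r' \<Longrightarrow> f z = conjg (B z) J_mat"
        "\<And>z v. z \<in> ball z0 r' \<Longrightarrow> mc B z v $ 1 $ 1 = 0" "\<And>z v. z \<in> ball z0 r' \<Longrightarrow> mc B z v $ 2 $ 2 = 0"
      show thesis
        by (rule that[OF *(1) _ *(3-6)]) (use *(2) r(2) in auto)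
    qed
  qed
qed

section \<open>Local systems over simply connected spaces\<close>

text \<open>A family of local sections over open subsets of \<open>M\<close> in which two sections agree on an open and
  disagree on an open set, and every value of a section near a point is taken by a section over a
  fixed neighbourhood: a local system.  Over a simply connected \<open>M\<close> it has global sections, by
  transport along paths.\<close>

locale local_system =
  fixes M :: "'a::topological_space set" and L :: "('a set \<times> ('a \<Rightarrow> 'b)) set"
  assumes openin_L: "\<And>U s. (U, s) \<in> L \<Longrightarrow> openin (top_of_set M) U"
    and agree: "\<And>U s V t. (U, s) \<in> L \<Longrightarrow> (V, t) \<in> L \<Longrightarrow> openin (top_of_set M) {p \<in> U \<inter> V. s p = t p}"
    and disagree: "\<And>U s V t. (U, s) \<in> L \<Longrightarrow> (V, t) \<in> L \<Longrightarrow> openin (top_of_set M) {p \<in> U \<inter> V. s p \<noteq> t p}"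
    and transitive: "\<And>p. p \<in> M \<Longrightarrow> \<exists>U. openin (top_of_set M) U \<and> p \<in> U \<and>
          (\<forall>V t q. (V, t) \<in> L \<and> q \<in> U \<inter> V \<longrightarrow> (\<exists>s. (U, s) \<in> L \<and> s q = t q))"
begin

text \<open>A continuous lift to the space of germs, phrased without constructing that space or a
  topology on it: near every point the lift is a section composed with \<open>h\<close>.\<close>

definition lift :: "('c::topological_space \<Rightarrow> 'a) \<Rightarrow> 'c set \<Rightarrow> ('c \<Rightarrow> 'b) \<Rightarrow> bool" where
  "lift h S \<sigma> \<longleftrightarrow> (\<forall>x\<in>S. \<exists>U s T. (U, s) \<in> L \<and> open T \<and> x \<in> T \<and> (\<forall>y\<in>S \<inter> T. h y \<in> U \<and> \<sigma> y = s (h y)))"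

text \<open>By \<open>agree\<close> a section is determined near a point by its value there, so
  values stand in for germs. These are the ones that occur over \<open>q\<close>.\<close>

definition admissible :: "'a \<Rightarrow> 'b \<Rightarrow> bool" where
  "admissible q b \<longleftrightarrow> (\<exists>U s. (U, s) \<in> L \<and> q \<in> U \<and> s q = b)"

lemma lift_admissible: "lift h S \<sigma> \<Longrightarrow> x \<in> S \<Longrightarrow> admissible (h x) (\<sigma> x)"
proof -
  assume "lift h S \<sigma>" and x: "x \<in> S"
  then obtain U s T where "(U, s) \<in> L" "x \<in> T" "\<forall>y\<in>S \<inter> T. h y \<in> U \<and> \<sigma> y = s (h y)"
    unfolding lift_def by blast
  then show ?thesis
    unfolding admissible_def using x by (intro exI[of _ U] exI[of _ s]) auto
qed

lemma lift_subset: "lift h S \<sigma> \<Longrightarrow> S' \<subseteq> S \<Longrightarrow> lift h S' \<sigma>"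
proof -
  assume l: "lift h S \<sigma>" and S': "S' \<subseteq> S"
  show ?thesis
    unfolding lift_def
  proof
    fix x assume "x \<in> S'"
    then have "x \<in> S" using S' by blast
    with l obtain U s T where "(U, s) \<in> L" "open T" "x \<in> T" "\<forall>y\<in>S \<inter> T. h y \<in> U \<and> \<sigma> y = s (h y)"
      unfolding lift_def by blast
    then show "\<exists>U s T. (U, s) \<in> L \<and> open T \<and> x \<in> T \<and> (\<forall>y\<in>S' \<inter> T. h y \<in> U \<and> \<sigma> y = s (h y))"
      using S' by (intro exI[of _ U] exI[of _ s] exI[of _ T]) auto
  qed
qed

lemma lift_precompose:
  assumes l: "lift h S \<sigma>" and k: "continuous_on S' k" "k ` S' \<subseteq> S"
  shows "lift (h \<circ> k) S' (\<sigma> \<circ> k)"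
  unfolding lift_def
proof
  fix x assume x: "x \<in> S'"
  then have "k x \<in> S" using k by blast
  then obtain U s T where UT: "(U, s) \<in> L" "open T" "k x \<in> T" "\<forall>y\<in>S \<inter> T. h y \<in> U \<and> \<sigma> y = s (h y)"
    using l unfolding lift_def by blast
  obtain T' where "open T'" "T' \<inter> S' = k -` T \<inter> S'"
    using continuous_on_open_invariant[of S' k] k(1) UT(2) by blast
  then show "\<exists>U s T. (U, s) \<in> L \<and> open T \<and> x \<in> T \<and> (\<forall>y\<in>S' \<inter> T. (h \<circ> k) y \<in> U \<and> (\<sigma> \<circ> k) y = s ((h \<circ> k) y))"
    using UT k(2) x by (intro exI[of _ U] exI[of _ s] exI[of _ T']) auto
qed

lemma lift_cong: "(\<And>x. x \<in> S \<Longrightarrow> f x = g x) \<Longrightarrow> lift f S \<rho> \<longleftrightarrow> lift g S \<rho>"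
  unfolding lift_def by (intro ball_cong refl ex_cong1 conj_cong) auto

lemma lift_section:
  assumes "(U, s) \<in> L" "h ` S \<subseteq> U"
  shows "lift h S (s \<circ> h)"
  unfolding lift_def
proof
  fix x assume "x \<in> S"
  then show "\<exists>U s' T. (U, s') \<in> L \<and> open T \<and> x \<in> T \<and> (\<forall>y\<in>S \<inter> T. h y \<in> U \<and> (s \<circ> h) y = s' (h y))"
    using assms by (intro exI[of _ U] exI[of _ s] exI[of _ UNIV]) auto
qed

lemma lift_const:
  assumes "admissible q b"
  shows "lift (\<lambda>_. q) S (\<lambda>_. b)"
proof -
  obtain U s where "(U, s) \<in> L" "q \<in> U" "s q = b" using assms unfolding admissible_def by blast
  then show ?thesis
    unfolding lift_def by (intro ballI exI[of _ U] exI[of _ s] exI[of _ UNIV]) auto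
qed

text \<open>Stated for a relation \<open>R\<close> because uniqueness of lifts uses it twice, for
  equality and for inequality.\<close>

lemma openin_preimage_lift:
  assumes h: "continuous_on S h" "h ` S \<subseteq> M"
    and l: "lift h S \<sigma>" "lift h S \<tau>"
    and E: "\<And>U s V t. (U, s) \<in> L \<Longrightarrow> (V, t) \<in> L \<Longrightarrow> openin (top_of_set M) {p \<in> U \<inter> V. R (s p) (t p)}"
  shows "openin (top_of_set S) {x \<in> S. R (\<sigma> x) (\<tau> x)}"
proof (subst openin_subopen, intro ballI)
  fix x assume x: "x \<in> {x \<in> S. R (\<sigma> x) (\<tau> x)}"
  obtain U s T where U: "(U, s) \<in> L" "open T" "x \<in> T" "\<forall>y\<in>S \<inter> T. h y \<in> U \<and> \<sigma> y = s (h y)"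
    using l(1) x unfolding lift_def by blast
  obtain V t T' where V: "(V, t) \<in> L" "open T'" "x \<in> T'" "\<forall>y\<in>S \<inter> T'. h y \<in> V \<and> \<tau> y = t (h y)"
    using l(2) x unfolding lift_def by blast
  let ?W = "S \<inter> h -` {p \<in> U \<inter> V. R (s p) (t p)}"
  have "openin (top_of_set S) ?W"
    using continuous_openin_preimage[OF h(1) _ E[OF U(1) V(1)], of] h(2) by (simp add: image_subset_iff_funcset)
  moreover have "openin (top_of_set S) (S \<inter> (T \<inter> T'))"
    using U(2) V(2) by (intro openin_open_Int open_Int)
  ultimately have o: "openin (top_of_set S) (?W \<inter> (S \<inter> (T \<inter> T')))" by blast
  have "x \<in> ?W \<inter> (S \<inter> (T \<inter> T'))" using x U V by auto
  moreover have "?W \<inter> (S \<inter> (T \<inter> T')) \<subseteq> {x \<in> S. R (\<sigma> x) (\<tau> x)}" using U V by auto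
  ultimately show "\<exists>T. openin (top_of_set S) T \<and> x \<in> T \<and> T \<subseteq> {x \<in> S. R (\<sigma> x) (\<tau> x)}"
    using o by blast
qed

lemma lift_unique:
  assumes h: "continuous_on S h" "h ` S \<subseteq> M" and S: "connected S"
    and l: "lift h S \<sigma>" "lift h S \<tau>" and x: "x \<in> S" "\<sigma> x = \<tau> x" and y: "y \<in> S"
  shows "\<sigma> y = \<tau> y"
proof (rule ccontr)
  assume ne: "\<sigma> y \<noteq> \<tau> y"
  have 1: "openin (top_of_set S) {x \<in> S. \<sigma> x = \<tau> x}"
    by (rule openin_preimage_lift[OF h l]) (rule agree)
  have 2: "openin (top_of_set S) {x \<in> S. \<sigma> x \<noteq> \<tau> x}"
    by (rule openin_preimage_lift[OF h l]) (rule disagree)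
  have "S \<subseteq> {x \<in> S. \<sigma> x = \<tau> x} \<union> {x \<in> S. \<sigma> x \<noteq> \<tau> x}"
    "{x \<in> S. \<sigma> x = \<tau> x} \<inter> {x \<in> S. \<sigma> x \<noteq> \<tau> x} = {}"
    "{x \<in> S. \<sigma> x = \<tau> x} \<noteq> {}" "{x \<in> S. \<sigma> x \<noteq> \<tau> x} \<noteq> {}"
    using x y ne by auto
  then show False using S 1 2 unfolding connected_openin by blast
qed

text \<open>The prescribed value may sit over any point of \<open>S\<close> instead of a fixed base
  point; this lets liftable pieces be joined in either order.\<close>

definition liftable :: "('c::topological_space \<Rightarrow> 'a) \<Rightarrow> 'c set \<Rightarrow> bool" where
  "liftable h S \<longleftrightarrow> (\<forall>x\<in>S. \<forall>b. admissible (h x) b \<longrightarrow> (\<exists>\<sigma>. lift h S \<sigma> \<and> \<sigma> x = b))"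

text \<open>As the pieces are closed, a point in only one of them has a neighbourhood that misses
  the other. At a common point the two sections take the same value, so by \<open>agree\<close> they
  coincide near its image and one of them serves both pieces.\<close>

lemma lift_paste:
  assumes l: "lift h S1 \<sigma>" "lift h S2 \<tau>" and c: "closed S1" "closed S2"
    and eq: "\<And>x. x \<in> S1 \<inter> S2 \<Longrightarrow> \<sigma> x = \<tau> x"
    and h: "continuous_on (S1 \<union> S2) h" "h ` (S1 \<union> S2) \<subseteq> M"
  shows "lift h (S1 \<union> S2) (\<lambda>x. if x \<in> S1 then \<sigma> x else \<tau> x)"
  unfolding lift_def
proof
  let ?\<rho> = "\<lambda>x. if x \<in> S1 then \<sigma> x else \<tau> x"
  fix x assume x: "x \<in> S1 \<union> S2"
  consider "x \<in> S1" "x \<notin> S2" | "x \<in> S2" "x \<notin> S1" | "x \<in> S1" "x \<in> S2" using x by blast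
  then show "\<exists>U s T. (U, s) \<in> L \<and> open T \<and> x \<in> T \<and> (\<forall>y\<in>(S1 \<union> S2) \<inter> T. h y \<in> U \<and> ?\<rho> y = s (h y))"
  proof cases
    case 1
    then obtain U s T where U: "(U, s) \<in> L" "open T" "x \<in> T" "\<forall>y\<in>S1 \<inter> T. h y \<in> U \<and> \<sigma> y = s (h y)"
      using l(1) unfolding lift_def by blast
    then show ?thesis using 1 c
      by (intro exI[of _ U] exI[of _ s] exI[of _ "T - S2"]) auto
  next
    case 2
    then obtain U s T where U: "(U, s) \<in> L" "open T" "x \<in> T" "\<forall>y\<in>S2 \<inter> T. h y \<in> U \<and> \<tau> y = s (h y)"
      using l(2) unfolding lift_def by blast
    then show ?thesis using 2 c
      by (intro exI[of _ U] exI[of _ s] exI[of _ "T - S1"]) auto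
  next
    case 3
    obtain U s T where U: "(U, s) \<in> L" "open T" "x \<in> T" "\<forall>y\<in>S1 \<inter> T. h y \<in> U \<and> \<sigma> y = s (h y)"
      using l(1) 3 unfolding lift_def by blast
    obtain V t T' where V: "(V, t) \<in> L" "open T'" "x \<in> T'" "\<forall>y\<in>S2 \<inter> T'. h y \<in> V \<and> \<tau> y = t (h y)"
      using l(2) 3 unfolding lift_def by blast
    let ?E = "{p \<in> U \<inter> V. s p = t p}"
    have "openin (top_of_set (S1 \<union> S2)) ((S1 \<union> S2) \<inter> h -` ?E)"
      using continuous_openin_preimage[OF h(1) _ agree[OF U(1) V(1)]] h(2) by (simp add: image_subset_iff_funcset)
    then obtain Z where Z: "open Z" "(S1 \<union> S2) \<inter> h -` ?E = (S1 \<union> S2) \<inter> Z"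
      by (auto simp: openin_open)
    have hx: "h x \<in> ?E" using U V 3 eq[of x] by auto
    have "x \<in> Z" using hx Z(2) x by blast
    moreover have "\<forall>y\<in>(S1 \<union> S2) \<inter> (T \<inter> T' \<inter> Z). h y \<in> U \<and> ?\<rho> y = s (h y)"
    proof
      fix y assume y: "y \<in> (S1 \<union> S2) \<inter> (T \<inter> T' \<inter> Z)"
      then have "h y \<in> ?E" using Z(2) by blast
      then show "h y \<in> U \<and> ?\<rho> y = s (h y)" using y U V by auto
    qed
    ultimately show ?thesis using U V Z by (intro exI[of _ U] exI[of _ s] exI[of _ "T \<inter> T' \<inter> Z"]) auto
  qed
qed

text \<open>A lift on one piece is continued into the other from a single common point; uniqueness
  on the connected intersection makes the two lifts agree there.\<close>

lemma liftable_Un: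
  assumes l: "liftable h S1" "liftable h S2" and c: "closed S1" "closed S2"
    and conn: "connected (S1 \<inter> S2)" "S1 \<inter> S2 \<noteq> {}"
    and h: "continuous_on (S1 \<union> S2) h" "h ` (S1 \<union> S2) \<subseteq> M"
  shows "liftable h (S1 \<union> S2)"
proof -
  have main: "\<exists>\<sigma>. lift h (A \<union> B) \<sigma> \<and> \<sigma> x = b"
    if H: "liftable h A" "liftable h B" "closed A" "closed B" "connected (A \<inter> B)" "A \<inter> B \<noteq> {}"
      "continuous_on (A \<union> B) h" "h ` (A \<union> B) \<subseteq> M" "x \<in> A" "admissible (h x) b" for A B x b
  proof -
    obtain \<sigma> where s: "lift h A \<sigma>" "\<sigma> x = b" using H unfolding liftable_def by blast
    obtain y where y: "y \<in> A \<inter> B" using H by blast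
    obtain \<tau> where t: "lift h B \<tau>" "\<tau> y = \<sigma> y"
      using H(2) lift_admissible[OF s(1), of y] y unfolding liftable_def by blast
    have eq: "\<sigma> z = \<tau> z" if "z \<in> A \<inter> B" for z
      by (rule lift_unique[OF _ _ \<open>connected (A \<inter> B)\<close> lift_subset[OF s(1)] lift_subset[OF t(1)] y t(2)[symmetric] that])
        (use \<open>continuous_on (A \<union> B) h\<close> \<open>h ` (A \<union> B) \<subseteq> M\<close> in \<open>auto intro: continuous_on_subset\<close>)
    have "lift h (A \<union> B) (\<lambda>x. if x \<in> A then \<sigma> x else \<tau> x)"
      by (rule lift_paste[OF s(1) t(1) H(3,4) eq H(7,8)])
    then show ?thesis using s(2) H(9) by force
  qed
  show ?thesis
    unfolding liftable_def
  proof (intro ballI allI impI)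
    fix x b assume x: "x \<in> S1 \<union> S2" "admissible (h x) b"
    then consider "x \<in> S1" | "x \<in> S2" by blast
    then show "\<exists>\<sigma>. lift h (S1 \<union> S2) \<sigma> \<and> \<sigma> x = b"
    proof cases
      case 1
      then show ?thesis using main[OF l c conn h _ x(2)] by blast
    next
      case 2
      then show ?thesis
        using main[of S2 S1 x b] l c conn h x(2) by (simp add: Int_commute Un_commute)
    qed
  qed
qed

lemma liftable_local:
  assumes h: "continuous_on S h" "h ` S \<subseteq> M" and x: "x \<in> S"
  obtains T where "open T" "x \<in> T" "\<And>S'. S' \<subseteq> S \<inter> T \<Longrightarrow> liftable h S'"
proof -
  have "h x \<in> M" using h x by blast
  then obtain U where U: "openin (top_of_set M) U" "h x \<in> U"
    "\<And>V t q. (V, t) \<in> L \<Longrightarrow> q \<in> U \<inter> V \<Longrightarrow> \<exists>s. (U, s) \<in> L \<and> s q = t q"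
    using transitive by metis
  have "openin (top_of_set S) (S \<inter> h -` U)"
    using continuous_openin_preimage[OF h(1) _ U(1)] h(2) by (simp add: image_subset_iff_funcset)
  then obtain T where T: "open T" "S \<inter> h -` U = S \<inter> T" by (auto simp: openin_open)
  show ?thesis
  proof (rule that[OF T(1)])
    show "x \<in> T" using T(2) U(2) x by blast
    fix S' assume S': "S' \<subseteq> S \<inter> T"
    have hU: "h ` S' \<subseteq> U" using S' T(2) by blast
    show "liftable h S'"
      unfolding liftable_def
    proof (intro ballI allI impI)
      fix y b assume y: "y \<in> S'" "admissible (h y) b"
      then obtain V t where "(V, t) \<in> L" "h y \<in> V" "t (h y) = b" unfolding admissible_def by blast
      then obtain s where "(U, s) \<in> L" "s (h y) = b" using U(3)[of V t "h y"] hU y(1) by blast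
      then show "\<exists>\<sigma>. lift h S' \<sigma> \<and> \<sigma> y = b" using lift_section[OF _ hU] by fastforce
    qed
  qed
qed

text \<open>Subdivision by bisection, in two rounds: small rectangles are joined to thin strips of
  full height, and strips to the square. Adjacent pieces meet in a segment, which is
  connected.\<close>

lemma liftable_square:
  fixes h :: "real \<times> real \<Rightarrow> 'a"
  assumes h: "continuous_on ({0..1} \<times> {0..1}) h" "h ` ({0..1} \<times> {0..1}) \<subseteq> M"
  shows "liftable h ({0..1} \<times> {0..1})"
proof -
  let ?K = "{0..1} \<times> {0..1} :: (real \<times> real) set"
  have sub: "continuous_on S h" "h ` S \<subseteq> M" if "S \<subseteq> ?K" for S
    using h that by (auto intro: continuous_on_subset)
  \<comment> \<open>Bisection tests small intervals around a point, and these may stick out of the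
    unit interval; the bounds on \<open>p\<close> and \<open>q\<close> make the property vacuous for
    them.\<close>
  define Q where "Q x p q \<longleftrightarrow> (0 \<le> p \<and> q \<le> 1 \<longrightarrow> (\<exists>d>0. \<forall>a b. a \<le> x \<and> x \<le> b \<and> b - a < d \<and> 0 \<le> a \<and> b \<le> 1
      \<longrightarrow> liftable h ({a..b} \<times> {p..q})))" for x p q :: real
  have strip: "Q x c e" if x: "0 \<le> x" "x \<le> 1" and ce: "c \<le> e" for x c e
    using ce
  proof (induction c e rule: Bolzano)
    case (trans p q r)
    show ?case
      unfolding Q_def
    proof
      assume pr: "0 \<le> p \<and> r \<le> 1"
      obtain d1 where d1: "d1 > 0" "\<And>a b. a \<le> x \<Longrightarrow> x \<le> b \<Longrightarrow> b - a < d1 \<Longrightarrow> 0 \<le> a \<Longrightarrow> b \<le> 1 \<Longrightarrow> liftable h ({a..b} \<times> {p..q})"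
        using trans pr unfolding Q_def by fastforce
      obtain d2 where d2: "d2 > 0" "\<And>a b. a \<le> x \<Longrightarrow> x \<le> b \<Longrightarrow> b - a < d2 \<Longrightarrow> 0 \<le> a \<Longrightarrow> b \<le> 1 \<Longrightarrow> liftable h ({a..b} \<times> {q..r})"
        using trans pr unfolding Q_def by fastforce
      show "\<exists>d>0. \<forall>a b. a \<le> x \<and> x \<le> b \<and> b - a < d \<and> 0 \<le> a \<and> b \<le> 1 \<longrightarrow> liftable h ({a..b} \<times> {p..r})"
      proof (intro exI[of _ "min d1 d2"] conjI allI impI)
        show "min d1 d2 > 0" using d1 d2 by simp
        fix a b assume ab: "a \<le> x \<and> x \<le> b \<and> b - a < min d1 d2 \<and> 0 \<le> a \<and> b \<le> 1"
        have un: "{a..b} \<times> {p..q} \<union> {a..b} \<times> {q..r} = {a..b} \<times> {p..r}" using trans by auto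
        have int: "{a..b} \<times> {p..q} \<inter> {a..b} \<times> {q..r} = {a..b} \<times> {q}" using trans by auto
        have K: "{a..b} \<times> {p..r} \<subseteq> ?K" using ab pr by auto
        have "liftable h ({a..b} \<times> {p..q} \<union> {a..b} \<times> {q..r})"
        proof (rule liftable_Un)
          show "liftable h ({a..b} \<times> {p..q})" "liftable h ({a..b} \<times> {q..r})" using d1 d2 ab by auto
          show "connected ({a..b} \<times> {p..q} \<inter> {a..b} \<times> {q..r})"
            unfolding int by (intro connected_Times) auto
          show "{a..b} \<times> {p..q} \<inter> {a..b} \<times> {q..r} \<noteq> {}" unfolding int using ab by auto
          show "closed ({a..b} \<times> {p..q})" "closed ({a..b} \<times> {q..r})"
            by (intro closed_Times closed_real_atLeastAtMost)+
          show "continuous_on ({a..b} \<times> {p..q} \<union> {a..b} \<times> {q..r}) h" "h ` ({a..b} \<times> {p..q} \<union> {a..b} \<times> {q..r}) \<subseteq> M"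
            unfolding un by (rule sub[OF K])+
        qed
        then show "liftable h ({a..b} \<times> {p..r})" by (simp only: un)
      qed
    qed
  next
    case (local y)
    show ?case
    proof (cases "0 \<le> y \<and> y \<le> 1")
      case True
      then have "(x, y) \<in> ?K" using x by simp
      then obtain T where T: "open T" "(x, y) \<in> T" "\<And>S'. S' \<subseteq> ?K \<inter> T \<Longrightarrow> liftable h S'"
        using liftable_local[OF h] by blast
      obtain r where r: "r > 0" "ball (x, y) r \<subseteq> T" using T open_contains_ball by blast
      have T': "{a..b} \<times> {p..q} \<subseteq> T" if "a \<le> x" "x \<le> b" "b - a < r / 2" "p \<le> y" "y \<le> q" "q - p < r / 2" for a b p q
      proof
        fix u assume "u \<in> {a..b} \<times> {p..q}"
        then have "a \<le> fst u" "fst u \<le> b" "p \<le> snd u" "snd u \<le> q" by auto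
        then have "\<bar>x - fst u\<bar> < r / 2" "\<bar>y - snd u\<bar> < r / 2" using that by linarith+
        moreover have "dist (x, y) u \<le> \<bar>x - fst u\<bar> + \<bar>y - snd u\<bar>"
          using sqrt_sum_squares_le_sum_abs[of "x - fst u" "y - snd u"]
          by (cases u) (simp add: dist_Pair_Pair dist_real_def)
        ultimately have "dist (x, y) u < r" by linarith
        then show "u \<in> T" using r by auto
      qed
      show ?thesis
      proof (intro exI[of _ "r / 2"] conjI allI impI)
        show "r / 2 > 0" using r by simp
        fix p q assume pq: "p \<le> y \<and> y \<le> q \<and> q - p < r / 2"
        show "Q x p q"
          unfolding Q_def
        proof (intro exI[of _ "r / 2"] conjI allI impI T(3))
          fix a b assume pq': "0 \<le> p \<and> q \<le> 1" and "a \<le> x \<and> x \<le> b \<and> b - a < r / 2 \<and> 0 \<le> a \<and> b \<le> 1"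
          then show "{a..b} \<times> {p..q} \<subseteq> ?K \<inter> T" using T'[of a b p q] pq by auto
        qed (use r in simp)
      qed
    next
      case False
      then consider "y < 0" | "y > 1" by linarith
      then show ?thesis
      proof cases
        case 1
        then show ?thesis unfolding Q_def by (intro exI[of _ 1]) auto
      next
        case 2
        then show ?thesis unfolding Q_def by (intro exI[of _ 1]) auto
      qed
    qed
  qed
  define R where "R p q \<longleftrightarrow> (0 \<le> p \<and> q \<le> 1 \<longrightarrow> liftable h ({p..q} \<times> {0..1}))" for p q :: real
  have "R 0 1"
  proof (rule Bolzano[of 0 1 R])
    fix p q r assume pqr: "R p q" "R q r" "p \<le> q" "q \<le> r"
    show "R p r"
      unfolding R_def
    proof
      assume pr: "0 \<le> p \<and> r \<le> 1"
      have un: "{p..q} \<times> {0..1} \<union> {q..r} \<times> {0..1} = {p..r} \<times> {0..1::real}" using pqr by auto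
      have int: "{p..q} \<times> {0..1} \<inter> {q..r} \<times> {0..1} = {q} \<times> {0..1::real}" using pqr by auto
      have K: "{p..r} \<times> {0..1} \<subseteq> ?K" using pr by auto
      have "liftable h ({p..q} \<times> {0..1} \<union> {q..r} \<times> {0..1})"
      proof (rule liftable_Un)
        show "liftable h ({p..q} \<times> {0..1})" "liftable h ({q..r} \<times> {0..1})" using pqr pr by (auto simp: R_def)
        show "connected ({p..q} \<times> {0..1} \<inter> {q..r} \<times> {0..1::real})"
          unfolding int by (intro connected_Times) auto
        show "{p..q} \<times> {0..1} \<inter> {q..r} \<times> {0..1::real} \<noteq> {}" unfolding int by auto
        show "closed ({p..q} \<times> {0..1::real})" "closed ({q..r} \<times> {0..1::real})"
          by (intro closed_Times closed_real_atLeastAtMost)+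
        show "continuous_on ({p..q} \<times> {0..1} \<union> {q..r} \<times> {0..1}) h" "h ` ({p..q} \<times> {0..1} \<union> {q..r} \<times> {0..1}) \<subseteq> M"
          unfolding un by (rule sub[OF K])+
      qed
      then show "liftable h ({p..r} \<times> {0..1})" by (simp only: un)
    qed
  next
    fix x :: real assume "0 \<le> x" "x \<le> 1"
    then have "Q x 0 1" by (rule strip) simp
    then obtain d where "d > 0" "\<forall>a b. a \<le> x \<and> x \<le> b \<and> b - a < d \<and> 0 \<le> a \<and> b \<le> 1 \<longrightarrow> liftable h ({a..b} \<times> {0..1})"
      unfolding Q_def by auto
    then show "\<exists>d>0. \<forall>a b. a \<le> x \<and> x \<le> b \<and> b - a < d \<longrightarrow> R a b"
      unfolding R_def by auto
  qed simp
  then show ?thesis by (simp add: R_def)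
qed

text \<open>A path is a square that does not depend on its second coordinate.\<close>

lemma liftable_path:
  assumes "continuous_on {0..1::real} \<gamma>" "\<gamma> ` {0..1} \<subseteq> M" "admissible (\<gamma> 0) b"
  obtains \<sigma> where "lift \<gamma> {0..1} \<sigma>" "\<sigma> 0 = b"
proof -
  let ?h = "\<gamma> \<circ> fst :: real \<times> real \<Rightarrow> 'a"
  have fst: "fst ` ({0..1} \<times> {0..1::real}) = {0..1::real}" by simp
  have "continuous_on ({0..1} \<times> {0..1 :: real}) ?h"
    by (rule continuous_on_compose[OF continuous_on_fst[OF continuous_on_id]]) (simp add: assms(1))
  moreover have "?h ` ({0..1} \<times> {0..1}) \<subseteq> M" unfolding image_comp[symmetric] fst by (rule assms(2))
  ultimately have "liftable ?h ({0..1} \<times> {0..1})" by (rule liftable_square)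
  moreover have "admissible (?h (0, 0)) b" using assms by simp
  ultimately obtain \<tau> where t: "lift ?h ({0..1} \<times> {0..1}) \<tau>" "\<tau> (0, 0) = b"
    unfolding liftable_def by (metis atLeastAtMost_iff mem_Sigma_iff order_refl zero_le_one)
  have "lift (?h \<circ> (\<lambda>t. (t, 0))) {0..1} (\<tau> \<circ> (\<lambda>t. (t, 0)))"
    by (rule lift_precompose[OF t(1)]) (auto intro!: continuous_intros)
  moreover have "?h \<circ> (\<lambda>t. (t, 0)) = \<gamma>" by auto
  ultimately show ?thesis using that[of "\<tau> \<circ> (\<lambda>t. (t, 0))"] t(2) by simp
qed

lemma lift_path_unique:
  assumes "path \<gamma>" "path_image \<gamma> \<subseteq> M" "lift \<gamma> {0..1} \<sigma>" "lift \<gamma> {0..1} \<tau>" "\<sigma> 0 = \<tau> 0" "t \<in> {0..1}"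
  shows "\<sigma> t = \<tau> t"
  by (rule lift_unique[of "{0..1}" \<gamma> \<sigma> \<tau> 0 t]) (use assms in \<open>auto simp: path_def path_image_def\<close>)

text \<open>The proof lifts a contraction of the loop to the square and compares the lift on its four sides.\<close>

lemma trivial_monodromy:
  assumes sc: "simply_connected M" and \<gamma>: "path \<gamma>" "path_image \<gamma> \<subseteq> M" "pathfinish \<gamma> = pathstart \<gamma>"
    and l: "lift \<gamma> {0..1} \<tau>"
  shows "\<tau> 0 = \<tau> 1"
proof -
  let ?p = "\<gamma> 0"
  have pM: "?p \<in> M" using \<gamma>(2) by (auto simp: path_image_def)
  have "path (\<lambda>_. ?p)" "pathfinish (\<lambda>_. ?p) = pathstart (\<lambda>_. ?p)" "path_image (\<lambda>_. ?p) \<subseteq> M"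
    using pM by (auto simp: path_def path_image_def pathfinish_def pathstart_def)
  then have "homotopic_loops M \<gamma> (\<lambda>_. ?p)"
    using sc \<gamma> unfolding simply_connected_def by blast
  then obtain h :: "real \<times> real \<Rightarrow> 'a" where h0: "continuous_on ({0..1} \<times> {0..1}) h" "h \<in> {0..1} \<times> {0..1} \<rightarrow> M"
    "\<forall>x\<in>{0..1}. h (0, x) = \<gamma> x" "\<forall>x\<in>{0..1}. h (1, x) = ?p"
    "\<forall>t\<in>{0..1}. pathfinish (h \<circ> Pair t) = pathstart (h \<circ> Pair t)"
    unfolding homotopic_loops by blast
  have h: "continuous_on ({0..1} \<times> {0..1}) h" "h ` ({0..1} \<times> {0..1}) \<subseteq> M"
    "\<And>x. x \<in> {0..1} \<Longrightarrow> h (0, x) = \<gamma> x" "\<And>x. x \<in> {0..1} \<Longrightarrow> h (1, x) = ?p"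
    "\<And>t. t \<in> {0..1} \<Longrightarrow> h (t, 0) = h (t, 1)"
    using h0 by (auto simp: pathfinish_def pathstart_def)
  have adm: "admissible (h (0, 0)) (\<tau> 0)" using lift_admissible[OF l, of 0] h(3)[of 0] by simp
  obtain \<sigma> where s: "lift h ({0..1} \<times> {0..1}) \<sigma>" "\<sigma> (0, 0) = \<tau> 0"
    using liftable_square[OF h(1,2)] adm unfolding liftable_def
    by (metis atLeastAtMost_iff mem_Sigma_iff order_refl zero_le_one)
  have lk: "lift (h \<circ> k) {0..1} (\<sigma> \<circ> k)" "continuous_on {0..1} (h \<circ> k)" "(h \<circ> k) ` {0..1} \<subseteq> M"
    if "continuous_on {0..1} k" "k ` {0..1} \<subseteq> {0..1} \<times> {0..1}" for k :: "real \<Rightarrow> real \<times> real"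
  proof -
    show "lift (h \<circ> k) {0..1} (\<sigma> \<circ> k)" by (rule lift_precompose[OF s(1) that])
    show "continuous_on {0..1} (h \<circ> k)"
      by (rule continuous_on_compose[OF that(1) continuous_on_subset[OF h(1) that(2)]])
    show "(h \<circ> k) ` {0..1} \<subseteq> M"
      unfolding image_comp[symmetric] using that(2) h(2) by (meson image_mono order_trans)
  qed
  have con: "connected {0..1::real}" by simp
  have k1: "continuous_on {0..1} (\<lambda>t::real. (0::real, t))" "(\<lambda>t. (0::real, t)) ` {0..1} \<subseteq> {0..1} \<times> {0..1}"
    "continuous_on {0..1} (\<lambda>t::real. (1::real, t))" "(\<lambda>t. (1::real, t)) ` {0..1} \<subseteq> {0..1} \<times> {0..1}"
    "continuous_on {0..1} (\<lambda>t::real. (t, 0::real))" "(\<lambda>t. (t, 0::real)) ` {0..1} \<subseteq> {0..1} \<times> {0..1}"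
    "continuous_on {0..1} (\<lambda>t::real. (t, 1::real))" "(\<lambda>t. (t, 1::real)) ` {0..1} \<subseteq> {0..1} \<times> {0..1}"
    by (auto intro!: continuous_intros)
  \<comment> \<open>This side of the square is a constant path, whose lift is constant by
    uniqueness.\<close>
  have top: "\<sigma> (1, 0) = \<sigma> (1, 1)"
  proof -
    have "lift (\<lambda>_. ?p) {0..1} (\<sigma> \<circ> (\<lambda>t. (1, t)))"
      using lk(1)[OF k1(3,4)] lift_cong[of "{0..1}" "h \<circ> (\<lambda>t. (1, t))" "\<lambda>_. ?p"] h(4) by simp
    moreover have "lift (\<lambda>_. ?p) {0..1} (\<lambda>_. \<sigma> (1, 0))"
      using lift_const lift_admissible[OF s(1), of "(1, 0)"] h(4)[of 0] by simp
    ultimately have "(\<sigma> \<circ> (\<lambda>t. (1, t))) 1 = (\<lambda>_. \<sigma> (1, 0)) (1 :: real)"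
      using lift_unique[of "{0..1}" "\<lambda>_. ?p" "\<sigma> \<circ> (\<lambda>t. (1, t))" "\<lambda>_. \<sigma> (1, 0)" 0 1] pM con by auto
    then show ?thesis by simp
  qed
  \<comment> \<open>The two sides compared here are the same path, as every stage of the homotopy is
    a loop. Their lifts agree at the end 1 by \<open>top\<close>, hence also at 0.\<close>
  have sides: "\<sigma> (0, 0) = \<sigma> (0, 1)"
  proof -
    have "lift (h \<circ> (\<lambda>t. (t, 0))) {0..1} (\<sigma> \<circ> (\<lambda>t. (t, 1)))"
      using lk(1)[OF k1(7,8)] lift_cong[of "{0..1}" "h \<circ> (\<lambda>t. (t, 0))" "h \<circ> (\<lambda>t. (t, 1))"] h(5) by simp
    from lift_unique[OF lk(2,3)[OF k1(5,6)] con lk(1)[OF k1(5,6)] this, of 1 0] top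
    show ?thesis by simp
  qed
  have "lift \<gamma> {0..1} (\<sigma> \<circ> (\<lambda>t. (0, t)))"
    using lk(1)[OF k1(1,2)] lift_cong[of "{0..1}" "h \<circ> (\<lambda>t. (0, t))" \<gamma>] h(3) by simp
  from lift_path_unique[OF \<gamma>(1,2) l this, of 1] s(2) have "\<tau> 1 = (\<sigma> \<circ> (\<lambda>t. (0, t))) 1"
    by simp
  then show ?thesis using sides s(2) by simp
qed

lemma lift_joinpaths:
  assumes "lift (\<gamma> +++ \<delta>) {0..1} \<tau>" "pathfinish \<gamma> = pathstart \<delta>"
  shows "lift \<gamma> {0..1} (\<lambda>t. \<tau> (t / 2))" "lift \<delta> {0..1} (\<lambda>t. \<tau> ((1 + t) / 2))"
proof -
  have "lift ((\<gamma> +++ \<delta>) \<circ> (\<lambda>t. t / 2)) {0..1} (\<tau> \<circ> (\<lambda>t. t / 2))"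
    by (rule lift_precompose[OF assms(1)]) (auto intro!: continuous_intros)
  then have "lift \<gamma> {0..1} (\<tau> \<circ> (\<lambda>t. t / 2))"
    by (rule iffD1[OF lift_cong, rotated]) (auto simp: joinpaths_def)
  then show "lift \<gamma> {0..1} (\<lambda>t. \<tau> (t / 2))" by (simp add: o_def)
  have "lift ((\<gamma> +++ \<delta>) \<circ> (\<lambda>t. (1 + t) / 2)) {0..1} (\<tau> \<circ> (\<lambda>t. (1 + t) / 2))"
    by (rule lift_precompose[OF assms(1)]) (auto intro!: continuous_intros)
  then have "lift \<delta> {0..1} (\<tau> \<circ> (\<lambda>t. (1 + t) / 2))"
  proof (rule iffD1[OF lift_cong, rotated])
    fix x :: real assume x: "x \<in> {0..1}"
    show "((\<gamma> +++ \<delta>) \<circ> (\<lambda>t. (1 + t) / 2)) x = \<delta> x"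
    proof (cases "x = 0")
      case True
      then show ?thesis using assms(2) by (simp add: joinpaths_def pathfinish_def pathstart_def)
    next
      case False
      then show ?thesis using x by (simp add: joinpaths_def add_divide_distrib)
    qed
  qed
  then show "lift \<delta> {0..1} (\<lambda>t. \<tau> ((1 + t) / 2))" by (simp add: o_def)
qed

text \<open>A value at \<open>p0\<close> is transported along paths. Trivial monodromy of the loop
  that goes out along one path and back along another makes the result independent of the path.
  Prolonging a path inside a small path connected set shows that the transported values follow a
  single section there.\<close>

theorem global_section:
  assumes sc: "simply_connected M"
    and lpc: "\<And>U q. openin (top_of_set M) U \<Longrightarrow> q \<in> U \<Longrightarrow> \<exists>V. openin (top_of_set M) V \<and> q \<in> V \<and> V \<subseteq> U \<and> path_connected V"
    and ne: "\<And>q. q \<in> M \<Longrightarrow> \<exists>U s. (U, s) \<in> L \<and> q \<in> U"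
  obtains s where "\<And>q. q \<in> M \<Longrightarrow> \<exists>U t V. (U, t) \<in> L \<and> openin (top_of_set M) V \<and> q \<in> V \<and> V \<subseteq> U \<and> (\<forall>r\<in>V. s r = t r)"
proof (cases "M = {}")
  case True
  then show ?thesis using that by blast
next
  case False
  then obtain p0 where p0: "p0 \<in> M" by blast
  obtain U0 s0 where "(U0, s0) \<in> L" "p0 \<in> U0" using ne[OF p0] by blast
  then obtain b0 where b0: "admissible p0 b0" unfolding admissible_def by blast
  define T where "T q b \<longleftrightarrow> (\<exists>\<gamma> \<sigma>. path \<gamma> \<and> path_image \<gamma> \<subseteq> M \<and> \<gamma> 0 = p0 \<and> \<gamma> 1 = q \<and> lift \<gamma> {0..1} \<sigma> \<and> \<sigma> 0 = b0 \<and> \<sigma> 1 = b)" for q b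
  have lifts: "\<exists>\<sigma>. lift \<gamma> {0..1} \<sigma> \<and> \<sigma> 0 = b" if "path \<gamma>" "path_image \<gamma> \<subseteq> M" "admissible (\<gamma> 0) b" for \<gamma> b
    using liftable_path[of \<gamma> b] that unfolding path_def path_image_def by metis
  have ex: "\<exists>b. T q b" if q: "q \<in> M" for q
  proof -
    have const: "path (\<lambda>_. p) \<and> pathfinish (\<lambda>_. p) = pathstart (\<lambda>_. p) \<and> path_image (\<lambda>_. p) \<subseteq> M" if "p \<in> M" for p
      using that by (auto simp: path_def path_image_def pathfinish_def pathstart_def)
    \<comment> \<open>Any two loops in a simply connected set are freely homotopic; a homotopy
      between two constant loops traces a path from \<open>p0\<close> to \<open>q\<close>.\<close>
    have "homotopic_loops M (\<lambda>_. p0) (\<lambda>_. q)"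
      using sc const[OF p0] const[OF q] unfolding simply_connected_def by blast
    then obtain h :: "real \<times> real \<Rightarrow> 'a" where h: "continuous_on ({0..1} \<times> {0..1}) h" "h \<in> {0..1} \<times> {0..1} \<rightarrow> M"
      "\<forall>x\<in>{0..1}. h (0, x) = p0" "\<forall>x\<in>{0..1}. h (1, x) = q"
      unfolding homotopic_loops by blast
    define \<gamma> where "\<gamma> t = h (t, 0)" for t
    have "path \<gamma>"
      unfolding path_def \<gamma>_def by (rule continuous_on_compose2[OF h(1)]) (auto intro!: continuous_intros)
    moreover have "path_image \<gamma> \<subseteq> M" "\<gamma> 0 = p0" "\<gamma> 1 = q"
      using h by (auto simp: path_image_def \<gamma>_def)
    ultimately show ?thesis
      using lifts[of \<gamma> b0] b0 unfolding T_def by metis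
  qed
  have uniq: "b = b'" if H: "T q b" "T q b'" for q b b'
  proof -
    obtain \<gamma> \<sigma> where g: "path \<gamma>" "path_image \<gamma> \<subseteq> M" "\<gamma> 0 = p0" "\<gamma> 1 = q" "lift \<gamma> {0..1} \<sigma>" "\<sigma> 0 = b0" "\<sigma> 1 = b"
      using H(1) unfolding T_def by blast
    obtain \<delta> \<tau> where d: "path \<delta>" "path_image \<delta> \<subseteq> M" "\<delta> 0 = p0" "\<delta> 1 = q" "lift \<delta> {0..1} \<tau>" "\<tau> 0 = b0" "\<tau> 1 = b'"
      using H(2) unfolding T_def by blast
    let ?l = "\<gamma> +++ reversepath \<delta>"
    have fin: "pathfinish \<gamma> = pathstart (reversepath \<delta>)" using g(4) d(4) by (simp add: pathfinish_def pathstart_def reversepath_def)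
    have l: "path ?l" "path_image ?l \<subseteq> M" "pathfinish ?l = pathstart ?l" "?l 0 = p0"
    proof -
      show "path ?l" using g d fin by simp
      show "path_image ?l \<subseteq> M" by (rule subset_path_image_join) (use g d in simp_all)
      show "?l 0 = p0" using g by (simp add: joinpaths_def)
      show "pathfinish ?l = pathstart ?l" using g d by (simp add: pathfinish_def pathstart_def joinpaths_def reversepath_def)
    qed
    obtain \<rho> where r: "lift ?l {0..1} \<rho>" "\<rho> 0 = b0" using lifts[OF l(1,2)] l(4) b0 by metis
    have r1: "\<rho> 1 = b0" using trivial_monodromy[OF sc l(1-3) r(1)] r(2) by simp
    note j = lift_joinpaths[OF r(1) fin]
    have 1: "\<rho> (1 / 2) = b"
      using lift_path_unique[OF g(1,2) j(1) g(5), of 1] g r by simp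
    have rev: "lift (reversepath \<delta>) {0..1} (\<tau> \<circ> (\<lambda>t. 1 - t))"
      using lift_precompose[OF d(5), of "{0..1}" "\<lambda>t. 1 - t"] by (simp add: reversepath_def o_def continuous_intros image_subset_iff)
    have conn: "connected {0..1::real}" by simp
    \<comment> \<open>The second half of the loop is compared with the reversed lift from the far
      end, where both have the value \<open>b0\<close>.\<close>
    have "\<rho> ((1 + 0) / 2) = (\<tau> \<circ> (\<lambda>t. 1 - t)) 0"
      by (rule lift_unique[OF _ _ conn j(2) rev, where x=1 and y=0])
        (use d r1 path_reversepath[of \<delta>] path_image_reversepath[of \<delta>] in \<open>auto simp: path_def path_image_def\<close>)
    then show ?thesis using 1 d by simp
  qed
  define s where "s q = (THE b. T q b)" for q
  have Ts: "T q (s q)" if "q \<in> M" for q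
    unfolding s_def using ex[OF that] uniq by (metis theI)
  have sT: "s q = b" if "T q b" for q b
    unfolding s_def using that uniq by (intro the_equality) auto
  show ?thesis
  proof (rule that)
    fix q assume q: "q \<in> M"
    obtain \<gamma> \<sigma> where g: "path \<gamma>" "path_image \<gamma> \<subseteq> M" "\<gamma> 0 = p0" "\<gamma> 1 = q" "lift \<gamma> {0..1} \<sigma>" "\<sigma> 0 = b0" "\<sigma> 1 = s q"
      using Ts[OF q] unfolding T_def by blast
    have "admissible q (s q)" using lift_admissible[OF g(5), of 1] g by simp
    then obtain U t where U: "(U, t) \<in> L" "q \<in> U" "t q = s q" unfolding admissible_def by blast
    obtain V where V: "openin (top_of_set M) V" "q \<in> V" "V \<subseteq> U" "path_connected V"
      using lpc[OF openin_L[OF U(1)] U(2)] by blast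
    have "s r = t r" if r: "r \<in> V" for r
    proof -
      obtain \<delta> where d: "path \<delta>" "path_image \<delta> \<subseteq> V" "pathstart \<delta> = q" "pathfinish \<delta> = r"
        using V(4) V(2) r unfolding path_connected_def by blast
      have dM: "path_image \<delta> \<subseteq> M" using d(2) openin_imp_subset[OF V(1)] by blast
      have fin: "pathfinish \<gamma> = pathstart \<delta>" using g(4) d(3) by (simp add: pathfinish_def)
      let ?l = "\<gamma> +++ \<delta>"
      have l: "path ?l" "path_image ?l \<subseteq> M" "?l 0 = p0" "?l 1 = r"
      proof -
        show "path ?l" using g d fin by simp
        show "path_image ?l \<subseteq> M" by (rule subset_path_image_join[OF g(2) dM])
        show "?l 0 = p0" "?l 1 = r" using g d by (simp_all add: joinpaths_def pathfinish_def)
      qed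
      obtain \<rho> where \<rho>: "lift ?l {0..1} \<rho>" "\<rho> 0 = b0" using lifts[OF l(1,2)] l(3) b0 by metis
      note j = lift_joinpaths[OF \<rho>(1) fin]
      have 1: "\<rho> (1 / 2) = s q"
        using lift_path_unique[OF g(1,2) j(1) g(5), of 1] g \<rho> by simp
      have td: "lift \<delta> {0..1} (t \<circ> \<delta>)"
        by (rule lift_section[OF U(1)]) (use d(2) V(3) in \<open>auto simp: path_image_def\<close>)
      have "\<rho> ((1 + 1) / 2) = (t \<circ> \<delta>) 1"
        by (rule lift_path_unique[OF d(1) dM j(2) td]) (use 1 U(3) d(3) in \<open>auto simp: pathstart_def\<close>)
      then have "\<rho> 1 = t r" using d(4) by (simp add: pathfinish_def)
      then have "T r (t r)" unfolding T_def using l \<rho> by blast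
      then show ?thesis by (rule sT)
    qed
    then show "\<exists>U t V. (U, t) \<in> L \<and> openin (top_of_set M) V \<and> q \<in> V \<and> V \<subseteq> U \<and> (\<forall>r\<in>V. s r = t r)"
      using U(1) V by blast
  qed
qed

end

section \<open>From holomorphic frames to flat surfaces\<close>

lemma chart_onD:
  assumes "chart_on M c"
  shows "openin (top_of_set M) (fst c)" "open (coords c)" "homeomorphism (fst c) (coords c) (snd c) (param c)"
  using assms by (auto simp: chart_on_def)

lemma param_in: "chart_on M c \<Longrightarrow> z \<in> coords c \<Longrightarrow> param c z \<in> fst c"
  using chart_onD(3)[of M c] unfolding homeomorphism_def by blast

lemma snd_param [simp]: "chart_on M c \<Longrightarrow> z \<in> coords c \<Longrightarrow> snd c (param c z) = z"
  using chart_onD(3)[of M c] unfolding homeomorphism_def by blast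

lemma param_snd [simp]: "chart_on M c \<Longrightarrow> p \<in> fst c \<Longrightarrow> param c (snd c p) = p"
  using chart_onD(3)[of M c] unfolding homeomorphism_def by blast

lemma snd_in_coords: "p \<in> fst c \<Longrightarrow> snd c p \<in> coords c"
  by (auto simp: coords_def)

lemma fst_chart_subset: "chart_on M c \<Longrightarrow> fst c \<subseteq> M"
  using chart_onD(1) openin_imp_subset by blast

lemma open_chart_image:
  assumes c: "chart_on M c" and U: "openin (top_of_set M) U"
  shows "open (snd c ` (U \<inter> fst c))"
proof -
  have "openin (top_of_set M) (U \<inter> fst c)" using U chart_onD(1)[OF c] by blast
  then have "openin (top_of_set (fst c)) (U \<inter> fst c)"
    using openin_subset_trans[of M "U \<inter> fst c" "fst c"] fst_chart_subset[OF c] by blast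
  then have "openin (top_of_set (coords c)) (snd c ` (U \<inter> fst c))"
    using homeomorphism_imp_open_map[OF chart_onD(3)[OF c]] by blast
  then show ?thesis using chart_onD(2)[OF c] openin_open_eq by blast
qed

lemma openin_param_image:
  assumes c: "chart_on M c" and W: "open W" "W \<subseteq> coords c"
  shows "openin (top_of_set M) (param c ` W)"
proof -
  have h: "homeomorphism (coords c) (fst c) (param c) (snd c)"
    using homeomorphism_sym chart_onD(3)[OF c] by blast
  have "openin (top_of_set (coords c)) W" using W by (simp add: open_subset)
  then have "openin (top_of_set (fst c)) (param c ` W)"
    using homeomorphism_imp_open_map[OF h] by blast
  then show ?thesis using chart_onD(1)[OF c] openin_trans by blast
qed

lemma open_overlap: "chart_on M c \<Longrightarrow> chart_on M d \<Longrightarrow> open (overlap c d)"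
  using open_chart_image[of M c "fst d"] chart_onD(1)[of M d] by (simp add: overlap_def Int_commute)

lemma overlap_coords: "z \<in> overlap c d \<Longrightarrow> z \<in> coords c"
  by (auto simp: overlap_def coords_def)

lemma transition_overlap:
  assumes c: "chart_on M c" and d: "chart_on M d" and z: "z \<in> overlap c d"
  shows "param c z \<in> fst c" "param c z \<in> fst d" "transition c d z \<in> overlap d c" "transition c d z \<in> coords d"
    "param d (transition c d z) = param c z" "transition d c (transition c d z) = z"
proof -
  obtain p where p: "p \<in> fst c" "p \<in> fst d" "z = snd c p" using z by (auto simp: overlap_def)
  then show "param c z \<in> fst c" "param c z \<in> fst d" "transition c d z \<in> overlap d c" "transition c d z \<in> coords d"
    "param d (transition c d z) = param c z" "transition d c (transition c d z) = z"
    using c d by (auto simp: overlap_def transition_def coords_def)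
qed

lemma smooth_surfaceD:
  assumes "smooth_surface M A"
  shows "c \<in> A \<Longrightarrow> chart_on M c" "c \<in> A \<Longrightarrow> d \<in> A \<Longrightarrow> smooth_on (overlap c d) (transition c d)"
    "p \<in> M \<Longrightarrow> \<exists>c\<in>A. p \<in> fst c"
  using assms by (auto simp: smooth_surface_def topological_surface_def)

lemma dirD_change_chart:
  fixes F :: "'a::topological_space \<Rightarrow> 'b::real_normed_vector"
  assumes c: "chart_on M c" and d: "chart_on M d" and z: "z \<in> overlap c d"
    and T: "transition c d differentiable (at z)" and F: "(F \<circ> param d) differentiable (at (transition c d z))"
  shows "dirD (F \<circ> param c) v z = dirD (F \<circ> param d) (dirD (transition c d) v z) (transition c d z)"
proof -
  have "dirD (F \<circ> param c) v z = dirD (\<lambda>w. (F \<circ> param d) (transition c d w)) v z"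
    using frechet_derivative_cong_open[OF open_overlap[OF c d] z, of "F \<circ> param c" "\<lambda>w. (F \<circ> param d) (transition c d w)"]
      transition_overlap(5)[OF c d] by simp
  also have "\<dots> = dirD (F \<circ> param d) (dirD (transition c d) v z) (transition c d z)"
    using frechet_derivative_at[OF has_derivative_compose[OF T[unfolded frechet_derivative_works] F[unfolded frechet_derivative_works]]]
    by metis
  finally show ?thesis .
qed

text \<open>With l = w / t and t v = x + \<i> k the second condition reads x Re l - k Im l = y, and
  Im l is not 0.\<close>

lemma real_coframe_surj:
  assumes "t \<noteq> 0" "Im (w / t) \<noteq> 0"
  obtains v where "Re (t * v) = x" "Re (w * v) = y"
proof -
  define l where "l = w / t"
  define k where "k = (Re l * x - y) / Im l"
  have "Im l \<noteq> 0" using assms by (simp add: l_def)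
  then have "Re (l * Complex x k) = y" by (simp add: k_def)
  moreover have "w * (Complex x k / t) = l * Complex x k" by (simp add: l_def)
  moreover have "t * (Complex x k / t) = Complex x k" using assms(1) by simp
  ultimately show ?thesis using that[of "Complex x k / t"] by simp
qed

text \<open>Up to sign, the right side is the determinant of the real one-forms Re (t dz) and Re (w
  dz): the condition on the imaginary part of the quotient says that they are independent.\<close>

lemma Re_Im_quotient:
  assumes "t \<noteq> 0"
  shows "(cmod t)\<^sup>2 * Im (w / t) = Re t * Im w - Im t * Re w"
proof -
  define l where "l = w / t"
  have "w = l * t" using assms by (simp add: l_def)
  then have "Re t * Im w - Im t * Re w = (cmod t)\<^sup>2 * Im l"
    unfolding cmod_power2 by (simp add: power2_eq_square algebra_simps)
  then show ?thesis by (simp add: l_def)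
qed

lemma real_coframe_inj:
  assumes t: "t \<noteq> 0" "Im (w / t) \<noteq> 0" and v: "Re (t * v) = 0" "Re (w * v) = 0"
  shows "v = 0"
proof -
  define l x where "l = w / t" and "x = t * v"
  have "l * x = w * v" using t(1) by (simp add: l_def x_def)
  then have "Re (l * x) = 0" using v(2) by (simp only:)
  moreover have "Re x = 0" "Im l \<noteq> 0" using v(1) t(2) by (simp_all only: x_def l_def not_False_eq_True)
  ultimately have "Im x = 0" by simp
  then have "x = 0" using \<open>Re x = 0\<close> by (simp add: complex_eq_iff)
  then show ?thesis using t(1) by (simp add: x_def)
qed

lemma diag2_eq_0: "diag2 (2 * \<i> * of_real x) (2 * \<i> * of_real y) = 0 \<longleftrightarrow> x = 0 \<and> y = 0"
  by (simp add: mat2_eq_iff)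

lemma minkowski_diag2: "minkowski (diag2 (2 * \<i> * of_real x) (2 * \<i> * of_real y)) (diag2 (2 * \<i> * of_real x') (2 * \<i> * of_real y'))
   = - 2 * (x * y' + x' * y)"
  by (simp add: minkowski_eq)

locale holomorphic_frame = sl2_field +
  fixes \<theta> \<omega> :: "complex \<Rightarrow> complex"
  assumes mc_eq: "\<And>z v. z \<in> S \<Longrightarrow> mc B z v = vector [vector [0, \<theta> z * v], vector [\<omega> z * v, 0]]"
    and hol: "\<theta> holomorphic_on S" "\<omega> holomorphic_on S"
    and theta_nz: "\<And>z. z \<in> S \<Longrightarrow> \<theta> z \<noteq> 0"
    and Im_nz: "\<And>z. z \<in> S \<Longrightarrow> Im (\<omega> z / \<theta> z) \<noteq> 0"
begin

abbreviation F where "F \<equiv> \<lambda>z. conjg (B z) J_mat"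

abbreviation metric where "metric \<equiv> \<lambda>z u v. minkowski (dirD F u z) (dirD F v z)"

lemma dirD_F:
  assumes z: "z \<in> S"
  shows "dirD F v z = conjg (B z) (diag2 (2 * \<i> * of_real (Re (\<theta> z * v))) (2 * \<i> * of_real (Re (\<omega> z * v))))"
proof -
  have "mc B z v $ 1 $ 1 = 0" "mc B z v $ 1 $ 2 = \<theta> z * v" "mc B z v $ 2 $ 1 = \<omega> z * v"
    by (simp_all add: mc_eq[OF z])
  then show ?thesis
    unfolding dirD_conjg[OF z] structure_matrix[OF z] diag2_def by (simp only: zero_complex.sel of_real_0 mult_zero_right list.map)
qed

lemma smooth_F: "smooth_on S F"
  by (rule smooth_on_conjg[OF open_S smooth_B])

lemma metric_eq: "z \<in> S \<Longrightarrow> metric z u v = - 2 * (Re (\<theta> z * u) * Re (\<omega> z * v) + Re (\<theta> z * v) * Re (\<omega> z * u))"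
  by (simp only: dirD_F minkowski_conjg[OF det_B] minkowski_diag2)

lemma smooth_metric: "smooth_on S (\<lambda>z. metric z u v)"
  by (intro smooth_on_bilinear[OF bounded_bilinear_minkowski] smooth_on_dirD smooth_F open_S)

lemma signature_metric: "z \<in> S \<Longrightarrow> signature_1_1 (metric z)"
proof -
  assume z: "z \<in> S"
  have lin: "linear (\<lambda>v. dirD F v z)"
    using linear_frechet_derivative[OF smooth_on_differentiable[OF smooth_F z]] .
  have l: "linear (\<lambda>v. minkowski X (dirD F v z))" for X
    using linear_compose[OF lin bounded_linear.linear[OF minkowski_linear_right]] by (simp only: o_def)
  have "(\<lambda>u. metric z u v) = (\<lambda>u. minkowski (dirD F v z) (dirD F u z))" for v
    by (rule ext) (rule minkowski_commute)
  then have "bilinear (metric z)"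
    unfolding bilinear_def using l by simp
  then have sym: "symmetric_bilinear (metric z)"
    by (simp add: symmetric_bilinear_def minkowski_commute)
  \<comment> \<open>The square of v is - 4 Re (\<theta> v) Re (\<omega> v), so values 1/2 of
    opposite or of equal sign give squares 1 and -1.\<close>
  obtain u where u: "Re (\<theta> z * u) = 1 / 2" "Re (\<omega> z * u) = - 1 / 2"
    using real_coframe_surj[OF theta_nz[OF z] Im_nz[OF z]] by metis
  obtain v where v: "Re (\<theta> z * v) = 1 / 2" "Re (\<omega> z * v) = 1 / 2"
    using real_coframe_surj[OF theta_nz[OF z] Im_nz[OF z]] by metis
  have "metric z u u = 1" "metric z v v = - 1" "metric z u v = 0"
    unfolding metric_eq[OF z] u v by simp_all
  with sym show ?thesis unfolding signature_1_1_def by blast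
qed

lemma inj_dirD_F: "z \<in> S \<Longrightarrow> inj (frechet_derivative F (at z))"
proof -
  assume z: "z \<in> S"
  have lin: "linear (frechet_derivative F (at z))"
    by (rule linear_frechet_derivative[OF smooth_on_differentiable[OF smooth_F z]])
  have "v = 0" if "frechet_derivative F (at z) v = 0" for v
  proof -
    have "conjg (B z) (diag2 (2 * \<i> * of_real (Re (\<theta> z * v))) (2 * \<i> * of_real (Re (\<omega> z * v)))) = conjg (B z) 0"
      using that dirD_F[OF z] by (simp add: mat2_eq_iff conjg_nth)
    then have "diag2 (2 * \<i> * of_real (Re (\<theta> z * v))) (2 * \<i> * of_real (Re (\<omega> z * v))) = 0"
      by (simp only: conjg_inject[OF det_B[OF z]])
    then have "Re (\<theta> z * v) = 0" "Re (\<omega> z * v) = 0"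
      unfolding diag2_eq_0 by blast+
    then show "v = 0" by (rule real_coframe_inj[OF theta_nz[OF z] Im_nz[OF z]])
  qed
  then show ?thesis using linear_injective_0[OF lin] by blast
qed

text \<open>The null coframe - 2 Re \<theta>, Re \<omega> has connection form 0: the derivative of a
  holomorphic coefficient is multiplication by a complex number, so the derivative of either form is
  symmetric in its two arguments, and both forms are closed.\<close>

lemma flat: "z \<in> S \<Longrightarrow> gauss_curvature (gram metric) z = 0"
proof -
  assume z: "z \<in> S"
  define p where "p i z = - 2 * Re (\<theta> z * unit_dir i)" for i z
  define q where "q i z = Re (\<omega> z * unit_dir i)" for i z
  have d: "partial i (\<lambda>z. Re (f z * unit_dir j)) z = Re (deriv f z * unit_dir i * unit_dir j)"
    if "f holomorphic_on S" "z \<in> S" for f i j z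
  proof -
    have "(f has_derivative (*) (deriv f z)) (at z)"
      using holomorphic_derivI[OF that(1) open_S that(2)] has_field_derivative_imp_has_derivative by blast
    then have "((\<lambda>z. Re (f z * unit_dir j)) has_derivative (\<lambda>v. Re (deriv f z * v * unit_dir j))) (at z)"
      by (intro has_derivative_Re has_derivative_mult_left)
    from frechet_derivative_at[OF this, symmetric] show ?thesis by (simp add: partial_def)
  qed
  have dc: "partial i (\<lambda>z. - 2 * Re (f z * unit_dir j)) z = - 2 * Re (deriv f z * unit_dir i * unit_dir j)"
    if "f holomorphic_on S" "z \<in> S" for f i j z
  proof -
    have "(\<lambda>z. Re (f z * unit_dir j)) differentiable (at z)"
      using that open_S by (intro smooth_on_differentiable[of S] smooth_on_Re smooth_on_mult smooth_on_const smooth_on_holomorphic)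
    then have "partial i (\<lambda>z. - 2 * Re (f z * unit_dir j)) z = - 2 * partial i (\<lambda>z. Re (f z * unit_dir j)) z"
      unfolding partial_def by (rule dirD_bounded_linear[OF bounded_linear_mult_right])
    then show ?thesis by (simp only: d[OF that])
  qed
  interpret null_coframe S p q "\<lambda>_ _. 0" "gram metric"
  proof
    show "smooth_on S (p i)" "smooth_on S (q i)" for i
      unfolding p_def[abs_def] q_def[abs_def]
      by (intro smooth_on_mult smooth_on_const smooth_on_Re smooth_on_holomorphic hol open_S)+
    show "gram metric z $ i $ j = p i z * q j z + p j z * q i z" if "z \<in> S" for z i j
      by (simp add: gram_def metric_eq[OF that] p_def q_def algebra_simps)
    show "p 1 z * q 2 z - p 2 z * q 1 z \<noteq> 0" if "z \<in> S" for z
    proof -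
      have "p 1 z * q 2 z - p 2 z * q 1 z = 2 * (Re (\<theta> z) * Im (\<omega> z) - Im (\<theta> z) * Re (\<omega> z))"
        by (simp add: p_def q_def unit_dir_def algebra_simps)
      also have "\<dots> = 2 * ((cmod (\<theta> z))\<^sup>2 * Im (\<omega> z / \<theta> z))"
        by (simp only: Re_Im_quotient[OF theta_nz[OF that]])
      finally show ?thesis using theta_nz[OF that] Im_nz[OF that] by simp
    qed
    show "partial i (p j) z - partial j (p i) z = - (0 * p j z - 0 * p i z)" if "z \<in> S" for z i j
      unfolding p_def[abs_def] dc[OF hol(1) that] by (simp add: algebra_simps)
    show "partial i (q j) z - partial j (q i) z = 0 * q j z - 0 * q i z" if "z \<in> S" for z i j
      unfolding q_def[abs_def] d[OF hol(2) that] by (simp add: algebra_simps)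
  qed (simp_all add: open_S)
  show ?thesis unfolding gauss_curvature_eq[OF z] by (simp add: partial_def)
qed

end

lemma holomorphic_mc:
  assumes S: "open S" and hol: "\<And>i j. (\<lambda>z. B z $ i $ j) holomorphic_on S" and z: "z \<in> S"
  shows "dirD B v z = (\<chi> i j. deriv (\<lambda>w. B w $ i $ j) z * v)"
    "mc B z v = (\<chi> i j. (adj2 (B z) ** (\<chi> i j. deriv (\<lambda>w. B w $ i $ j) z)) $ i $ j * v)"
proof -
  have "smooth_on S B" using hol S by (intro smooth_on_matI smooth_on_holomorphic)
  then have dB: "B differentiable (at z)" using z by (rule smooth_on_differentiable)
  have "dirD (\<lambda>w. B w $ i $ j) v z = deriv (\<lambda>w. B w $ i $ j) z * v" for i j
    using holomorphic_derivI[OF hol S z] has_field_derivative_imp_has_derivative frechet_derivative_at by metis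
  then show 1: "dirD B v z = (\<chi> i j. deriv (\<lambda>w. B w $ i $ j) z * v)"
    by (simp add: vec_eq_iff dirD_nth[OF dB, symmetric])
  show "mc B z v = (\<chi> i j. (adj2 (B z) ** (\<chi> i j. deriv (\<lambda>w. B w $ i $ j) z)) $ i $ j * v)"
    unfolding mc_def 1 by (simp add: mat2_eq_iff mat2_mult_nth algebra_simps)
qed

text \<open>Apart from the position in De Sitter space and the transformation law of the metric,
  every claim concerns a single chart and is settled in \<open>holomorphic_frame\<close>.\<close>

theorem holomorphic_frame_imp_flat_immersion:
  assumes rs: "riemann_surface M A" and B: "holomorphic_to_SL2 M A B"
    and th: "holomorphic_1form A \<theta>" "nowhere_vanishing A \<theta>"
    and om: "holomorphic_1form A \<omega>" "nowhere_vanishing A \<omega>"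
    and mcf: "has_maurer_cartan_form A B \<theta> \<omega>" and Im: "Im_quotient_nonzero A \<omega> \<theta>"
  defines "F \<equiv> (\<lambda>p. conjg (B p) J_mat)"
  shows "flat_timelike_surface M A (induced_metric F)" "isometric_immersion_in_de_sitter M A (induced_metric F) F"
proof -
  have ch: "chart_on M c" if "c \<in> A" for c
    using rs that by (auto simp: riemann_surface_def topological_surface_def)
  have sm: "smooth_surface M A"
    unfolding smooth_surface_def
    using rs open_overlap[OF ch ch] by (auto simp: riemann_surface_def intro!: smooth_on_holomorphic)
  have fr: "holomorphic_frame (coords c) (B \<circ> param c) (\<theta> c) (\<omega> c)" if c: "c \<in> A" for c
  proof
    show o: "open (coords c)" using chart_onD(2)[OF ch[OF c]] .
    have hol: "(\<lambda>z. (B \<circ> param c) z $ i $ j) holomorphic_on coords c" for i j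
      using B c by (simp add: holomorphic_to_SL2_def)
    then show "smooth_on (coords c) (B \<circ> param c)" using o by (intro smooth_on_matI smooth_on_holomorphic)
    show det: "det ((B \<circ> param c) z) = 1" if "z \<in> coords c" for z
      using param_in[OF ch[OF c] that] fst_chart_subset[OF ch[OF c]] B by (auto simp: holomorphic_to_SL2_def)
    show "mc (B \<circ> param c) z v = vector [vector [0, \<theta> c z * v], vector [\<omega> c z * v, 0]]" if z: "z \<in> coords c" for z v
    proof -
      have "maurer_cartan B c z = adj2 ((B \<circ> param c) z) ** (\<chi> i j. deriv (\<lambda>w. (B \<circ> param c) w $ i $ j) z)"
        using det[OF z] by (simp add: maurer_cartan_def matrix_inv_eq_adj2)
      moreover have "maurer_cartan B c z = vector [vector [0, \<theta> c z], vector [\<omega> c z, 0]]"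
        using mcf c z by (simp add: has_maurer_cartan_form_def)
      ultimately show ?thesis
        unfolding holomorphic_mc(2)[OF o hol z] by (simp add: mat2_eq_iff)
    qed
    show "\<theta> c holomorphic_on coords c" "\<omega> c holomorphic_on coords c"
      using th om c by (auto simp: holomorphic_1form_def)
    show "\<theta> c z \<noteq> 0" "Im (\<omega> c z / \<theta> c z) \<noteq> 0" if "z \<in> coords c" for z
      using th Im c that by (auto simp: nowhere_vanishing_def Im_quotient_nonzero_def)
  qed
  have Fc: "F \<circ> param c = (\<lambda>z. conjg ((B \<circ> param c) z) J_mat)" for c by (simp add: F_def o_def)
  note smF = holomorphic_frame.smooth_F[OF fr, folded Fc]
  have met: "induced_metric F c = (\<lambda>z u v. minkowski (dirD (F \<circ> param c) u z) (dirD (F \<circ> param c) v z))" for c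
    by (simp add: induced_metric_def differential_def fun_eq_iff)
  show "flat_timelike_surface M A (induced_metric F)"
    unfolding flat_timelike_surface_def
  proof (intro conjI sm)
    show "timelike_metric A (induced_metric F)"
      unfolding timelike_metric_def
    proof (intro conjI ballI allI)
      fix c u v assume c: "c \<in> A"
      show "smooth_on (coords c) (\<lambda>z. induced_metric F c z u v)"
        unfolding met Fc by (rule holomorphic_frame.smooth_metric[OF fr[OF c]])
    next
      fix c z assume c: "c \<in> A" "z \<in> coords c"
      show "signature_1_1 (induced_metric F c z)"
        unfolding met Fc by (rule holomorphic_frame.signature_metric[OF fr[OF c(1)] c(2)])
    next
      fix c d z u v assume cd: "c \<in> A" "d \<in> A" and z: "z \<in> overlap c d"
      have T: "transition c d differentiable (at z)"
        using smooth_on_differentiable[OF smooth_surfaceD(2)[OF sm cd] z] .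
      have Fd: "(F \<circ> param d) differentiable (at (transition c d z))"
        using smooth_on_differentiable[OF smF[OF cd(2)] transition_overlap(4)[OF ch[OF cd(1)] ch[OF cd(2)] z]] .
      show "induced_metric F c z u v = induced_metric F d (transition c d z)
          (frechet_derivative (transition c d) (at z) u) (frechet_derivative (transition c d) (at z) v)"
        unfolding met dirD_change_chart[OF ch[OF cd(1)] ch[OF cd(2)] z T Fd] ..
    qed
    show "flat_metric A (induced_metric F)"
      unfolding flat_metric_def met Fc using holomorphic_frame.flat[OF fr] by blast
  qed
  show "isometric_immersion_in_de_sitter M A (induced_metric F) F"
    unfolding isometric_immersion_in_de_sitter_def immersion_in_de_sitter_def
  proof (intro conjI ballI allI)
    show "F ` M \<subseteq> de_sitter"
    proof
      fix X assume "X \<in> F ` M"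
      then obtain p where p: "p \<in> M" "X = conjg (B p) J_mat" by (auto simp: F_def)
      have "det (B p) = 1" using B p by (simp add: holomorphic_to_SL2_def)
      then have "minkowski X X = minkowski J_mat J_mat" unfolding p(2) by (rule minkowski_conjg)
      then have "minkowski X X = 1" by (simp add: minkowski_eq[of J_mat])
      moreover have "J_mat \<in> i_Herm2" by (simp add: i_Herm2_iff)
      ultimately show "X \<in> de_sitter" by (simp add: de_sitter_def p(2) conjg_i_Herm2)
    qed
    show "smooth_on (coords c) (F \<circ> param c)" if "c \<in> A" for c by (rule smF[OF that])
    show "inj (differential F c z)" if "c \<in> A" "z \<in> coords c" for c z
      unfolding differential_def Fc by (rule holomorphic_frame.inj_dirD_F[OF fr[OF that(1)] that(2)])
  qed simp
qed

section \<open>From flat surfaces to holomorphic frames\<close>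

text \<open>What is kept of an adapted frame makes no mention of \<alpha> and \<beta>: a vanishing
  diagonal and an immersed surface. These conditions survive changes of coordinates and constant
  monomial factors that fix \<open>J_mat\<close>, so frames found in different places can be
  compared.\<close>

locale flat_frame = sl2_field +
  assumes diag: "\<And>z v. z \<in> S \<Longrightarrow> mc B z v $ 1 $ 1 = 0"
    and inj_F: "\<And>z. z \<in> S \<Longrightarrow> inj (frechet_derivative (\<lambda>z. conjg (B z) J_mat) (at z))"
begin

lemma diag': "z \<in> S \<Longrightarrow> mc B z v $ 2 $ 2 = 0"
  using mc_trace diag by simp

lemma dirD_F: "z \<in> S \<Longrightarrow> dirD (\<lambda>z. conjg (B z) J_mat) v z =
    conjg (B z) (diag2 (2 * \<i> * of_real (Re (mc B z v $ 1 $ 2))) (2 * \<i> * of_real (Re (mc B z v $ 2 $ 1))))"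
  unfolding dirD_conjg diag2_def by (subst structure_matrix) (simp_all add: diag)

lemma mc_nth_expand: "z \<in> S \<Longrightarrow> mc B z v $ i $ j = of_real (Re v) * mc B z 1 $ i $ j + of_real (Im v) * mc B z \<i> $ i $ j"
  using arg_cong[OF mc_expand, of z "\<lambda>X. X $ i $ j" v] by (simp add: scaleR_conv_of_real[where 'a=complex])

text \<open>A zero determinant would give a nonzero tangent vector killed by both real forms, and by
  \<open>dirD_F\<close> it would be in the kernel of the differential.\<close>

lemma independent:
  assumes z: "z \<in> S"
  shows "Re (mc B z 1 $ 1 $ 2) * Re (mc B z \<i> $ 2 $ 1) - Re (mc B z \<i> $ 1 $ 2) * Re (mc B z 1 $ 2 $ 1) \<noteq> 0"
proof
  define x1 x2 y1 y2 where "x1 = Re (mc B z 1 $ 1 $ 2)" and "x2 = Re (mc B z \<i> $ 1 $ 2)"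
    and "y1 = Re (mc B z 1 $ 2 $ 1)" and "y2 = Re (mc B z \<i> $ 2 $ 1)"
  assume "Re (mc B z 1 $ 1 $ 2) * Re (mc B z \<i> $ 2 $ 1) - Re (mc B z \<i> $ 1 $ 2) * Re (mc B z 1 $ 2 $ 1) = 0"
  then have D: "x1 * y2 - x2 * y1 = 0" by (simp add: x1_def x2_def y1_def y2_def)
  have zero: "v = 0" if "Re v * x1 + Im v * x2 = 0" "Re v * y1 + Im v * y2 = 0" for v
  proof -
    have "Re (mc B z v $ 1 $ 2) = 0" "Re (mc B z v $ 2 $ 1) = 0"
      using that unfolding mc_nth_expand[OF z, of v] by (simp_all add: x1_def x2_def y1_def y2_def)
    then have "frechet_derivative (\<lambda>z. conjg (B z) J_mat) (at z) v = 0"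
      unfolding dirD_F[OF z] by (simp add: mat2_eq_iff conjg_nth)
    also have "\<dots> = frechet_derivative (\<lambda>z. conjg (B z) J_mat) (at z) 0"
      by (rule linear_0[OF linear_frechet_derivative[OF smooth_on_differentiable[OF smooth_on_conjg[OF open_S smooth_B] z]], symmetric])
    finally show ?thesis using inj_F[OF z] by (simp add: inj_eq)
  qed
  \<comment> \<open>The vector annihilated by a row lies in the kernel, which forces this row to be
    0; with both rows 0, every vector would lie in the kernel.\<close>
  have "Complex x2 (- x1) = 0" by (rule zero) (use D in \<open>simp_all add: algebra_simps\<close>)
  then have x: "x1 = 0" "x2 = 0" by (simp_all add: complex_eq_iff)
  have "Complex y2 (- y1) = 0" by (rule zero) (use D x in \<open>simp_all add: algebra_simps\<close>)
  then have y: "y1 = 0" "y2 = 0" by (simp_all add: complex_eq_iff)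
  have "(1::complex) = 0" by (rule zero) (use x y in simp_all)
  then show False by simp
qed

text \<open>The diagonal entry of the structure equation: as the diagonal of the form is 0, it reads
  \<theta> \<and> \<omega> = 0.\<close>

lemma wedge: "z \<in> S \<Longrightarrow> mc B z 1 $ 1 $ 2 * mc B z \<i> $ 2 $ 1 = mc B z \<i> $ 1 $ 2 * mc B z 1 $ 2 $ 1"
proof -
  assume z: "z \<in> S"
  have "dirD (\<lambda>w. mc B w v $ 1 $ 1) u z = 0" for u v
    using frechet_derivative_cong_open[OF open_S z, of "\<lambda>w. mc B w v $ 1 $ 1" "\<lambda>w. 0"] diag by simp
  then show ?thesis
    using structure_equation_nth[OF z, of \<i> 1 1 1] by (simp add: diag[OF z])
qed

lemma closed: "z \<in> S \<Longrightarrow> dirD (\<lambda>w. mc B w 1 $ 1 $ 2) \<i> z = dirD (\<lambda>w. mc B w \<i> $ 1 $ 2) 1 z"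
  using structure_equation_nth[of z 1 1 2 \<i>] by (simp add: diag diag')

text \<open>The vanishing wedge product makes \<omega> = l \<theta> with complex l. The determinant
  of the real parts is then - Im l times the Jacobian determinant of \<theta>, so neither factor
  vanishes: l is not real, and \<theta> maps the real tangent plane isomorphically to the complex
  plane.\<close>

lemma quotient:
  assumes z: "z \<in> S"
  obtains l where "Im l \<noteq> 0" "\<And>v. mc B z v $ 2 $ 1 = l * mc B z v $ 1 $ 2"
    "Im (cnj (mc B z 1 $ 1 $ 2) * mc B z \<i> $ 1 $ 2) \<noteq> 0"
proof -
  define t1 t2 w1 w2 where "t1 = mc B z 1 $ 1 $ 2" and "t2 = mc B z \<i> $ 1 $ 2"
    and "w1 = mc B z 1 $ 2 $ 1" and "w2 = mc B z \<i> $ 2 $ 1"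
  have D: "Re t1 * Re w2 - Re t2 * Re w1 \<noteq> 0" and W: "t1 * w2 = t2 * w1"
    using independent[OF z] wedge[OF z] by (simp_all add: t1_def t2_def w1_def w2_def)
  have "t1 \<noteq> 0 \<or> t2 \<noteq> 0" using D by auto
  then obtain l where l: "w1 = l * t1" "w2 = l * t2"
  proof
    assume t: "t1 \<noteq> 0"
    have "w2 = (w1 / t1) * t2" using W t by (simp add: field_simps)
    then show ?thesis using that[of "w1 / t1"] t by simp
  next
    assume t: "t2 \<noteq> 0"
    have "w1 = (w2 / t2) * t1" using W t by (simp add: field_simps)
    then show ?thesis using that[of "w2 / t2"] t by simp
  qed
  have "Re t1 * Re w2 - Re t2 * Re w1 = - Im l * Im (cnj t1 * t2)"
    unfolding l by (simp add: algebra_simps)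
  then have nz: "Im l \<noteq> 0" "Im (cnj t1 * t2) \<noteq> 0" using D by auto
  have "mc B z v $ 2 $ 1 = l * mc B z v $ 1 $ 2" for v
    unfolding mc_nth_expand[OF z, of v] t1_def[symmetric] t2_def[symmetric] w1_def[symmetric] w2_def[symmetric] l
    by (simp add: algebra_simps)
  with nz show ?thesis using that by (simp add: t1_def t2_def)
qed

lemma coframe_surj:
  assumes z: "z \<in> S"
  obtains v where "Re (mc B z v $ 1 $ 2) = x" "Re (mc B z v $ 2 $ 1) = y"
proof -
  define x1 x2 y1 y2 where "x1 = Re (mc B z 1 $ 1 $ 2)" and "x2 = Re (mc B z \<i> $ 1 $ 2)"
    and "y1 = Re (mc B z 1 $ 2 $ 1)" and "y2 = Re (mc B z \<i> $ 2 $ 1)"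
  define D where "D = x1 * y2 - x2 * y1"
  have D: "D \<noteq> 0" using independent[OF z] by (simp add: D_def x1_def x2_def y1_def y2_def)
  define v where "v = Complex ((x * y2 - x2 * y) / D) ((x1 * y - x * y1) / D)"
  have "(x * y2 - x2 * y) * x1 + (x1 * y - x * y1) * x2 = x * D" "(x * y2 - x2 * y) * y1 + (x1 * y - x * y1) * y2 = y * D"
    by (simp_all add: D_def algebra_simps)
  then have "Re v * x1 + Im v * x2 = x" "Re v * y1 + Im v * y2 = y"
    using D by (simp_all add: v_def add_divide_distrib[symmetric])
  then have "Re (mc B z v $ 1 $ 2) = x" "Re (mc B z v $ 2 $ 1) = y"
    unfolding mc_nth_expand[OF z, of v] by (simp_all add: x1_def x2_def y1_def y2_def)
  then show ?thesis by (rule that)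
qed

end

text \<open>Both frames diagonalize the differential of the same surface.\<close>

lemma frame_change_monomial:
  assumes "flat_frame S B1" "flat_frame S B2" and eq: "\<And>z. z \<in> S \<Longrightarrow> conjg (B1 z) J_mat = conjg (B2 z) J_mat"
    and z: "z \<in> S"
  defines "C \<equiv> adj2 (B1 z) ** B2 z"
  shows "det C = 1" "conjg C J_mat = J_mat" "(C $ 1 $ 2 = 0 \<and> C $ 2 $ 1 = 0) \<or> (C $ 1 $ 1 = 0 \<and> C $ 2 $ 2 = 0)"
proof -
  interpret b1: flat_frame S B1 by fact
  interpret b2: flat_frame S B2 by fact
  show det: "det C = 1" using b1.det_B[OF z] b2.det_B[OF z] by (simp add: C_def det_mul det_adj2)
  show "conjg C J_mat = J_mat"
    unfolding C_def conjg_conjg[symmetric] eq[OF z, symmetric] by (rule conjg_adj2(1)[OF b1.det_B[OF z]])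
  \<comment> \<open>Every real diagonal pair is attained by the differential at some tangent vector,
    and the other frame makes the same differential diagonal too; so \<open>conjg C\<close>
    preserves diagonal form.\<close>
  have off: "conjg C (diag2 (2 * \<i> * of_real x) (2 * \<i> * of_real y)) $ 1 $ 2 = 0" for x y
  proof -
    obtain v where v: "Re (mc B2 z v $ 1 $ 2) = x" "Re (mc B2 z v $ 2 $ 1) = y" using b2.coframe_surj[OF z] .
    have "dirD (\<lambda>z. conjg (B2 z) J_mat) v z = dirD (\<lambda>z. conjg (B1 z) J_mat) v z"
      using frechet_derivative_cong_open[OF b1.open_S z, of "\<lambda>z. conjg (B2 z) J_mat" "\<lambda>z. conjg (B1 z) J_mat"] eq by simp
    then have "conjg C (diag2 (2 * \<i> * of_real x) (2 * \<i> * of_real y)) = diag2 (2 * \<i> * of_real (Re (mc B1 z v $ 1 $ 2))) (2 * \<i> * of_real (Re (mc B1 z v $ 2 $ 1)))"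
      unfolding C_def conjg_conjg[symmetric] b1.dirD_F[OF z] b2.dirD_F[OF z] v
      by (simp only: conjg_adj2(1)[OF b1.det_B[OF z]])
    then show ?thesis by simp
  qed
  have "C $ 1 $ 1 * cnj (C $ 2 $ 1) = 0" "C $ 1 $ 2 * cnj (C $ 2 $ 2) = 0"
    using off[of 1 0] off[of 0 1] unfolding conjg_nth by simp_all
  then show "(C $ 1 $ 2 = 0 \<and> C $ 2 $ 1 = 0) \<or> (C $ 1 $ 1 = 0 \<and> C $ 2 $ 2 = 0)"
    using det by (auto simp: det_2)
qed

lemma adj2_matrix_mult: "adj2 (A ** B) = adj2 B ** adj2 A"
  by (simp add: mat2_eq_iff mat2_mult_nth algebra_simps)

text \<open>The quotient \<open>C\<close> of the frames satisfies dC = C \<Omega>2 - \<Omega>1 C.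
  Near \<open>z0\<close> the monomial matrix \<open>C z\<close> is diagonal, while both forms have
  zero diagonal; so the diagonal of dC vanishes and \<open>C\<close> stays equal to the
  identity.\<close>

lemma frames_agree_locally:
  assumes F1: "flat_frame S B1" and F2: "flat_frame S B2" and eq: "\<And>z. z \<in> S \<Longrightarrow> conjg (B1 z) J_mat = conjg (B2 z) J_mat"
    and z0: "z0 \<in> S" "B1 z0 = B2 z0"
  obtains r where "r > 0" "ball z0 r \<subseteq> S" "\<And>z. z \<in> ball z0 r \<Longrightarrow> B1 z = B2 z"
proof -
  interpret b1: flat_frame S B1 by fact
  interpret b2: flat_frame S B2 by fact
  define C where "C z = adj2 (B1 z) ** B2 z" for z
  have smC: "smooth_on S C"
    unfolding C_def[abs_def]
    by (intro smooth_on_mat_mult smooth_on_bounded_linear[OF bounded_linear_adj2] b1.smooth_B b2.smooth_B b1.open_S)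
  have C0: "C z0 = mat 1" using z0 b2.det_B by (simp add: C_def adj2_mult)
  obtain r where r: "r > 0" "ball z0 r \<subseteq> S" "\<And>z. z \<in> ball z0 r \<Longrightarrow> C z $ 1 $ 1 \<in> - {0}"
    by (rule smooth_on_nbhd[OF smooth_on_mat_nth[OF smC b1.open_S] b1.open_S z0(1), where T="- {0}"])
       (use C0 in \<open>auto simp: mat_def\<close>)
  let ?B = "ball z0 r"
  have zz: "z0 \<in> ?B" using r by simp
  have off: "C z $ 1 $ 2 = 0 \<and> C z $ 2 $ 1 = 0" if "z \<in> ?B" for z
  proof -
    have "z \<in> S" using that r by blast
    then show ?thesis using frame_change_monomial(3)[OF F1 F2 eq, of z] r(3)[OF that] by (auto simp: C_def)
  qed
  have dC: "dirD C v z = C z ** mc B2 z v - mc B1 z v ** C z" if z: "z \<in> S" for z v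
  proof -
    have tr: "adj2 (mc B1 z v) = - mc B1 z v" using b1.mc_trace[OF z, of v] by (simp add: mat2_eq_iff)
    have a: "(\<lambda>z. adj2 (B1 z)) differentiable (at z)"
      using smooth_on_differentiable[OF smooth_on_bounded_linear[OF bounded_linear_adj2 b1.smooth_B b1.open_S] z] .
    have "dirD C v z = adj2 (B1 z) ** dirD B2 v z + adj2 (dirD B1 v z) ** B2 z"
      unfolding C_def[abs_def] dirD_bounded_bilinear[OF bounded_bilinear_mat2 a b2.diff_B[OF z]]
        dirD_bounded_linear[OF bounded_linear_adj2 b1.diff_B[OF z]] ..
    also have "\<dots> = C z ** mc B2 z v + adj2 (mc B1 z v) ** C z"
      unfolding b1.dirD_B[OF z] b2.dirD_B[OF z] adj2_matrix_mult C_def by (simp add: matrix_mul_assoc)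
    finally show ?thesis unfolding tr by (simp add: mat2_eq_iff mat2_mult_nth)
  qed
  have const: "C z $ i $ i = 1" if z: "z \<in> ?B" for z i
  proof -
    have d: "((\<lambda>z. C z $ i $ i) has_derivative (\<lambda>v. 0)) (at z within ?B)" if z: "z \<in> ?B" for z
    proof -
      have zS: "z \<in> S" using z r by blast
      have Cd: "C differentiable (at z)" using smooth_on_differentiable[OF smC zS] .
      have "(\<lambda>z. C z $ i $ i) differentiable (at z)"
        using smooth_on_differentiable[OF smooth_on_mat_nth[OF smC b1.open_S] zS] .
      then have "((\<lambda>z. C z $ i $ i) has_derivative frechet_derivative (\<lambda>z. C z $ i $ i) (at z)) (at z)"
        using frechet_derivative_works by blast
      moreover have "frechet_derivative (\<lambda>z. C z $ i $ i) (at z) = (\<lambda>v. 0)"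
      proof
        fix v
        show "dirD (\<lambda>z. C z $ i $ i) v z = 0"
          unfolding dirD_nth[OF Cd] dC[OF zS]
          using exhaust_2[of i] off[OF z] b1.diag[OF zS] b2.diag[OF zS] b1.diag'[OF zS] b2.diag'[OF zS]
          by (auto simp: mat2_mult_nth)
      qed
      ultimately show ?thesis by (simp add: has_derivative_at_withinI)
    qed
    obtain k where k: "\<And>z. z \<in> ?B \<Longrightarrow> C z $ i $ i = k"
      using has_derivative_zero_constant[OF convex_ball d] by metis
    have "C z0 $ i $ i = 1" unfolding C0 by (simp add: mat_def)
    then show ?thesis using k[OF z] k[OF zz] by simp
  qed
  have "B1 z = B2 z" if z: "z \<in> ?B" for z
  proof -
    have "C z = mat 1" using const[OF z, of 1] const[OF z, of 2] off[OF z] by (simp add: mat2_eq_iff mat_def)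
    then have "(B1 z ** adj2 (B1 z)) ** B2 z = B1 z" by (simp add: C_def matrix_mul_assoc[symmetric])
    moreover have "det (B1 z) = 1" using b1.det_B z r(2) by blast
    ultimately show ?thesis by (simp add: adj2_mult)
  qed
  with r that show ?thesis by blast
qed

lemma mc_right_mult:
  assumes "B differentiable (at z)"
  shows "mc (\<lambda>z. B z ** C) z v = adj2 C ** mc B z v ** C"
proof -
  have "(\<lambda>z. C :: complex^2^2) differentiable (at z)" by simp
  from dirD_bounded_bilinear[OF bounded_bilinear_mat2 assms this]
  have "dirD (\<lambda>z. B z ** C) v z = dirD B v z ** C"
    by (simp add: mat2_eq_iff mat2_mult_nth)
  then show ?thesis by (simp add: mc_def adj2_matrix_mult matrix_mul_assoc)
qed

lemma smooth_on_cong_imp: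
  assumes "open S" "smooth_on S f" "\<And>x. x \<in> S \<Longrightarrow> f x = g x"
  shows "smooth_on S g"
  using smooth_on_cong[OF assms(1), of f g] assms(2,3) by simp

lemma flat_frame_subset:
  assumes "flat_frame S B" "open T" "T \<subseteq> S"
  shows "flat_frame T B"
proof -
  interpret flat_frame S B by fact
  show ?thesis
    by unfold_locales (use assms(2,3) smooth_on_subset[OF smooth_B] det_B diag inj_F in auto)
qed

lemma mc_cong_open:
  assumes "open S" "z \<in> S" "\<And>w. w \<in> S \<Longrightarrow> B w = B' w"
  shows "mc B z v = mc B' z v"
  unfolding mc_def using assms(3)[OF assms(2)] frechet_derivative_cong_open[OF assms] by simp

lemma flat_frame_cong:
  assumes "flat_frame S B" "\<And>w. w \<in> S \<Longrightarrow> B w = B' w"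
  shows "flat_frame S B'"
proof -
  interpret flat_frame S B by fact
  show ?thesis
  proof
    show "smooth_on S B'" by (rule smooth_on_cong_imp[OF open_S smooth_B assms(2)])
    show "det (B' z) = 1" if "z \<in> S" for z using det_B[OF that] assms(2)[OF that] by simp
    show "mc B' z v $ 1 $ 1 = 0" if "z \<in> S" for z v
    proof -
      have "mc B z v = mc B' z v" by (rule mc_cong_open[OF open_S that assms(2)])
      then show ?thesis using diag[OF that, of v] by simp
    qed
    show "inj (frechet_derivative (\<lambda>z. conjg (B' z) J_mat) (at z))" if "z \<in> S" for z
      using inj_F[OF that] frechet_derivative_cong_open[OF open_S that, of "\<lambda>z. conjg (B' z) J_mat" "\<lambda>z. conjg (B z) J_mat"] assms(2)
      by simp
  qed (rule open_S)
qed

lemma mc_change_chart: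
  assumes c: "chart_on M c" and d: "chart_on M d" and z: "z \<in> overlap c d"
    and T: "transition c d differentiable (at z)" and B: "(B \<circ> param d) differentiable (at (transition c d z))"
  shows "mc (B \<circ> param c) z v = mc (B \<circ> param d) (transition c d z) (dirD (transition c d) v z)"
  unfolding mc_def dirD_change_chart[OF assms] using transition_overlap(5)[OF c d z] by simp

lemma nbhd_in_chart:
  assumes c: "chart_on M c" and p: "p \<in> fst c" and r: "r > 0" "ball (snd c p) r \<subseteq> snd c ` (U \<inter> fst c)"
    and P: "\<And>z. z \<in> ball (snd c p) r \<Longrightarrow> P (param c z)"
  shows "\<exists>V. openin (top_of_set M) V \<and> p \<in> V \<and> V \<subseteq> {q \<in> U. P q}"
proof (intro exI conjI)
  have "ball (snd c p) r \<subseteq> coords c" using r(2) by (auto simp: coords_def)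
  then show "openin (top_of_set M) (param c ` ball (snd c p) r)" by (intro openin_param_image[OF c]) auto
  have "snd c p \<in> ball (snd c p) r" using r(1) by simp
  then show "p \<in> param c ` ball (snd c p) r" using param_snd[OF c p] by (metis imageI)
  show "param c ` ball (snd c p) r \<subseteq> {q \<in> U. P q}"
  proof
    fix q assume "q \<in> param c ` ball (snd c p) r"
    then obtain z where z: "z \<in> ball (snd c p) r" "q = param c z" by blast
    then obtain q' where "q' \<in> U \<inter> fst c" "z = snd c q'" using r(2) by blast
    then show "q \<in> {q \<in> U. P q}" using P[OF z(1)] z(2) param_snd[OF c] by auto
  qed
qed

lemma path_connected_nbhd:
  assumes surf: "smooth_surface M A" and U: "openin (top_of_set M) U" "q \<in> U"
  shows "\<exists>V. openin (top_of_set M) V \<and> q \<in> V \<and> V \<subseteq> U \<and> path_connected V"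
proof -
  have "q \<in> M" using U openin_imp_subset by blast
  then obtain c where cA: "c \<in> A" "q \<in> fst c" using smooth_surfaceD(3)[OF surf] by blast
  have c: "chart_on M c" using smooth_surfaceD(1)[OF surf cA(1)] .
  have "snd c q \<in> snd c ` (U \<inter> fst c)" using U cA by blast
  then obtain r where r: "r > 0" "ball (snd c q) r \<subseteq> snd c ` (U \<inter> fst c)"
    using open_chart_image[OF c U(1)] open_contains_ball by blast
  have sub: "ball (snd c q) r \<subseteq> coords c" using r(2) by (auto simp: coords_def)
  have "path_connected (param c ` ball (snd c q) r)"
  proof (rule path_connected_continuous_image)
    show "continuous_on (ball (snd c q) r) (param c)"
      using chart_onD(3)[OF c] sub by (meson continuous_on_subset homeomorphism_def)
  qed (simp add: convex_imp_path_connected)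
  moreover have "openin (top_of_set M) (param c ` ball (snd c q) r)" by (intro openin_param_image[OF c] sub) auto
  moreover have "q \<in> param c ` ball (snd c q) r"
    using param_snd[OF c cA(2)] r(1) by (metis centre_in_ball imageI)
  moreover have "param c ` ball (snd c q) r \<subseteq> U"
  proof
    fix x assume "x \<in> param c ` ball (snd c q) r"
    then obtain y where "y \<in> U \<inter> fst c" "x = param c (snd c y)" using r(2) by blast
    then show "x \<in> U" using param_snd[OF c] by auto
  qed
  ultimately show ?thesis by blast
qed

section \<open>The local system of adapted frames of a flat immersion\<close>

locale flat_immersion =
  fixes M :: "'a::topological_space set" and A :: "'a chart set" and g :: "'a metric_field" and F :: "'a \<Rightarrow> complex^2^2"
  assumes surf: "smooth_surface M A" and metric: "timelike_metric A g" "flat_metric A g"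
    and iso: "isometric_immersion_in_de_sitter M A g F"
begin

lemmas chart = smooth_surfaceD(1)[OF surf] and smooth_transition = smooth_surfaceD(2)[OF surf] and cover = smooth_surfaceD(3)[OF surf]

lemma transition_differentiable: "c \<in> A \<Longrightarrow> d \<in> A \<Longrightarrow> z \<in> overlap c d \<Longrightarrow> transition c d differentiable (at z)"
  using smooth_on_differentiable[OF smooth_transition] by blast

definition good :: "'a chart \<Rightarrow> 'a set \<Rightarrow> ('a \<Rightarrow> complex^2^2) \<Rightarrow> bool" where
  "good c U B \<longleftrightarrow> flat_frame (snd c ` (U \<inter> fst c)) (B \<circ> param c) \<and> (\<forall>p\<in>U \<inter> fst c. F p = conjg (B p) J_mat)"

text \<open>Sections live on open sets that need not lie in one chart; demanding \<open>good\<close>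
  in every chart of \<open>A\<close> frees the notion from the choice of a chart.\<close>

definition L :: "('a set \<times> ('a \<Rightarrow> complex^2^2)) set" where
  "L = {(U, B). openin (top_of_set M) U \<and> (\<forall>c\<in>A. good c U B)}"

lemma goodI:
  assumes c: "c \<in> A" and U: "openin (top_of_set M) U" and B: "sl2_field (snd c ` (U \<inter> fst c)) (B \<circ> param c)"
    and F: "\<And>p. p \<in> U \<inter> fst c \<Longrightarrow> F p = conjg (B p) J_mat"
    and diag: "\<And>z v. z \<in> snd c ` (U \<inter> fst c) \<Longrightarrow> mc (B \<circ> param c) z v $ 1 $ 1 = 0"
  shows "good c U B"
  unfolding good_def
proof (intro conjI ballI F)
  interpret sl2_field "snd c ` (U \<inter> fst c)" "B \<circ> param c" by fact
  show "flat_frame (snd c ` (U \<inter> fst c)) (B \<circ> param c)"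
  proof
    fix z assume z: "z \<in> snd c ` (U \<inter> fst c)"
    have "conjg ((B \<circ> param c) w) J_mat = (F \<circ> param c) w" if "w \<in> snd c ` (U \<inter> fst c)" for w
      using that F param_snd[OF chart[OF c]] by auto
    then have "frechet_derivative (\<lambda>z. conjg ((B \<circ> param c) z) J_mat) (at z) = frechet_derivative (F \<circ> param c) (at z)"
      by (rule frechet_derivative_cong_open[OF open_S z])
    moreover have "z \<in> coords c" using z by (auto simp: coords_def)
    ultimately show "inj (frechet_derivative (\<lambda>z. conjg ((B \<circ> param c) z) J_mat) (at z))"
      using iso c by (auto simp: isometric_immersion_in_de_sitter_def immersion_in_de_sitter_def differential_def)
  qed (rule diag)
qed

lemma good_subset:
  assumes c: "c \<in> A" and g: "good c U B" and V: "openin (top_of_set M) V" "V \<subseteq> U"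
  shows "good c V B"
  using g flat_frame_subset[OF _ open_chart_image[OF chart[OF c] V(1)]] V(2) unfolding good_def
  by (metis (no_types, lifting) Int_iff Int_mono image_mono order_refl subsetD)

text \<open>In another chart the Maurer-Cartan form is the same form applied to the transformed
  vector, so a zero diagonal persists.\<close>

lemma good_change:
  assumes c: "c \<in> A" and d: "d \<in> A" and U: "openin (top_of_set M) U" "U \<subseteq> fst c" and g: "good c U B"
  shows "good d U B"
proof (rule goodI[OF d U(1)])
  let ?W = "snd c ` (U \<inter> fst c)" and ?W' = "snd d ` (U \<inter> fst d)" and ?T = "transition d c"
  interpret flat_frame ?W "B \<circ> param c" using g by (simp add: good_def)
  show FB: "F p = conjg (B p) J_mat" if "p \<in> U \<inter> fst d" for p
    using g that U(2) by (auto simp: good_def)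
  have ov: "?W' \<subseteq> overlap d c" using U(2) by (auto simp: overlap_def)
  have TW: "?T z \<in> ?W" if "z \<in> ?W'" for z
    using that U(2) param_snd[OF chart[OF d]] by (auto simp: transition_def)
  have oW': "open ?W'" by (rule open_chart_image[OF chart[OF d] U(1)])
  have par: "param c (?T z) = param d z" if "z \<in> ?W'" for z
    using transition_overlap(5)[OF chart[OF d] chart[OF c]] ov that by blast
  have BT: "(B \<circ> param d) z = (B \<circ> param c) (?T z)" if "z \<in> ?W'" for z
    using par[OF that] by simp
  show "sl2_field ?W' (B \<circ> param d)"
  proof
    have "smooth_on ?W' (\<lambda>z. (B \<circ> param c) (?T z))"
      by (rule smooth_on_compose[OF oW' smooth_on_subset[OF smooth_transition[OF d c] ov] smooth_B]) (use TW in blast)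
    then show "smooth_on ?W' (B \<circ> param d)" by (rule smooth_on_cong_imp[OF oW']) (simp only: BT)
    show "det ((B \<circ> param d) z) = 1" if "z \<in> ?W'" for z using det_B[OF TW[OF that]] BT[OF that] by simp
  qed (rule oW')
  show "mc (B \<circ> param d) z v $ 1 $ 1 = 0" if z: "z \<in> ?W'" for z v
  proof -
    have zo: "z \<in> overlap d c" using ov z by blast
    show ?thesis
      unfolding mc_change_chart[OF chart[OF d] chart[OF c] zo transition_differentiable[OF d c zo] diff_B[OF TW[OF z]]]
      by (rule diag[OF TW[OF z]])
  qed
qed

lemma local_solution:
  assumes p: "p \<in> M"
  obtains U B where "(U, B) \<in> L" "p \<in> U"
proof -
  obtain c where c: "c \<in> A" "p \<in> fst c" using cover[OF p] by blast
  note ch = chart[OF c(1)]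
  let ?f = "F \<circ> param c"
  have z0: "snd c p \<in> coords c" by (rule snd_in_coords[OF c(2)])
  have imm: "smooth_on (coords c) ?f" "F ` M \<subseteq> de_sitter"
    using iso c by (auto simp: isometric_immersion_in_de_sitter_def immersion_in_de_sitter_def)
  have fS: "?f z \<in> de_sitter" if "z \<in> coords c" for z
    using imm(2) param_in[OF ch that] fst_chart_subset[OF ch] by auto
  show thesis
  proof (rule local_frame[OF chart_onD(2)[OF ch] z0 imm(1) fS, of "g c"])
    show "smooth_on (coords c) (\<lambda>z. g c z u v)" for u v using metric(1) c(1) by (auto simp: timelike_metric_def)
    show "signature_1_1 (g c z)" if "z \<in> coords c" for z using metric(1) c(1) that by (auto simp: timelike_metric_def)
    show "gauss_curvature (gram (g c)) z = 0" if "z \<in> coords c" for z using metric(2) c(1) that by (auto simp: flat_metric_def)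
    show "g c z u v = minkowski (dirD ?f u z) (dirD ?f v z)" if "z \<in> coords c" for z u v
      using iso c(1) that by (simp add: isometric_immersion_in_de_sitter_def induced_metric_def differential_def)
  next
    fix r B assume r: "r > 0" "ball (snd c p) r \<subseteq> coords c" and sl: "sl2_field (ball (snd c p) r) B"
      and FB: "\<And>z. z \<in> ball (snd c p) r \<Longrightarrow> ?f z = conjg (B z) J_mat"
      and dg: "\<And>z v. z \<in> ball (snd c p) r \<Longrightarrow> mc B z v $ 1 $ 1 = 0"
    let ?B = "ball (snd c p) r"
    define U where "U = param c ` ?B"
    have U: "openin (top_of_set M) U" unfolding U_def by (rule openin_param_image[OF ch open_ball r(2)])
    have Uc: "U \<subseteq> fst c" unfolding U_def using param_in[OF ch] r(2) by blast
    have sU: "snd c ` (U \<inter> fst c) = ?B"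
    proof -
      have "snd c ` U = (\<lambda>z. snd c (param c z)) ` ?B" by (simp add: U_def image_image)
      also have "\<dots> = ?B" using snd_param[OF ch] r(2) by force
      finally show ?thesis using Uc by (simp add: Int_absorb2)
    qed
    have eq: "B w = ((B \<circ> snd c) \<circ> param c) w" if "w \<in> ?B" for w
      using snd_param[OF ch] r(2) that by auto
    interpret sl2_field ?B B by (rule sl)
    have "good c U (B \<circ> snd c)"
    proof (rule goodI[OF c(1) U])
      show "sl2_field (snd c ` (U \<inter> fst c)) ((B \<circ> snd c) \<circ> param c)"
        unfolding sU
      proof
        show "smooth_on ?B ((B \<circ> snd c) \<circ> param c)" by (rule smooth_on_cong_imp[OF open_ball smooth_B eq])
        show "det (((B \<circ> snd c) \<circ> param c) z) = 1" if "z \<in> ?B" for z using det_B[OF that] eq[OF that] by simp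
      qed simp
      show "F q = conjg ((B \<circ> snd c) q) J_mat" if q: "q \<in> U \<inter> fst c" for q
      proof -
        obtain z where z: "z \<in> ?B" "q = param c z" using q unfolding U_def by blast
        then show ?thesis using FB[OF z(1)] eq[OF z(1)] by simp
      qed
      show "mc ((B \<circ> snd c) \<circ> param c) z v $ 1 $ 1 = 0" if "z \<in> snd c ` (U \<inter> fst c)" for z v
      proof -
        have z: "z \<in> ?B" using that unfolding sU .
        have "mc B z v = mc ((B \<circ> snd c) \<circ> param c) z v" by (rule mc_cong_open[OF open_ball z eq])
        then show ?thesis using dg[OF z, of v] by simp
      qed
    qed
    then have "(U, B \<circ> snd c) \<in> L"
      unfolding L_def using U good_change[OF c(1) _ U Uc] by blast
    moreover have "p \<in> U" unfolding U_def using r(1) param_snd[OF ch c(2)] by (metis centre_in_ball imageI)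
    ultimately show thesis by (rule that)
  qed
qed

lemma L_good: "(U, s) \<in> L \<Longrightarrow> c \<in> A \<Longrightarrow> good c U s" "(U, s) \<in> L \<Longrightarrow> openin (top_of_set M) U"
  by (auto simp: L_def)

lemma L_pair:
  assumes L: "(U, s) \<in> L" "(V, t) \<in> L" and p: "p \<in> U \<inter> V"
  obtains c where "c \<in> A" "p \<in> fst c" "chart_on M c" "snd c p \<in> snd c ` ((U \<inter> V) \<inter> fst c)"
    "flat_frame (snd c ` ((U \<inter> V) \<inter> fst c)) (s \<circ> param c)" "flat_frame (snd c ` ((U \<inter> V) \<inter> fst c)) (t \<circ> param c)"
    "\<And>z. z \<in> snd c ` ((U \<inter> V) \<inter> fst c) \<Longrightarrow> conjg ((s \<circ> param c) z) J_mat = conjg ((t \<circ> param c) z) J_mat"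
proof -
  have o: "openin (top_of_set M) U" "openin (top_of_set M) V" using L L_good(2) by auto
  then have UV: "openin (top_of_set M) (U \<inter> V)" by blast
  have "p \<in> M" using p o(1) openin_imp_subset by blast
  then obtain c where c: "c \<in> A" "p \<in> fst c" using cover by blast
  have g: "good c (U \<inter> V) s" "good c (U \<inter> V) t"
    using good_subset[OF c(1) L_good(1)[OF L(1) c(1)] UV] good_subset[OF c(1) L_good(1)[OF L(2) c(1)] UV] by auto
  show ?thesis
  proof (rule that[OF c chart[OF c(1)]])
    show "conjg ((s \<circ> param c) z) J_mat = conjg ((t \<circ> param c) z) J_mat" if "z \<in> snd c ` ((U \<inter> V) \<inter> fst c)" for z
      using that g param_snd[OF chart[OF c(1)]] by (auto simp: good_def)
  qed (use g p c in \<open>auto simp: good_def\<close>)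
qed

text \<open>Agreement spreads by \<open>frames_agree_locally\<close>, disagreement by continuity.
  For \<open>transitive\<close>, any other frame at \<open>q\<close> differs from a fixed local
  frame \<open>s0\<close> by a monomial matrix that fixes \<open>J_mat\<close>, and
  \<open>s0\<close> times this constant is a section over all of \<open>U\<close>.\<close>

sublocale local_system M L
proof
  show "openin (top_of_set M) U" if "(U, s) \<in> L" for U s using L_good(2)[OF that] .
next
  fix U s V t assume L: "(U, s) \<in> L" "(V, t) \<in> L"
  show "openin (top_of_set M) {p \<in> U \<inter> V. s p = t p}"
  proof (subst openin_subopen, intro ballI)
    fix p assume "p \<in> {p \<in> U \<inter> V. s p = t p}"
    then have p: "p \<in> U \<inter> V" "s p = t p" by auto
    obtain c where c: "c \<in> A" "p \<in> fst c" "chart_on M c" "snd c p \<in> snd c ` ((U \<inter> V) \<inter> fst c)"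
      "flat_frame (snd c ` ((U \<inter> V) \<inter> fst c)) (s \<circ> param c)" "flat_frame (snd c ` ((U \<inter> V) \<inter> fst c)) (t \<circ> param c)"
      "\<And>z. z \<in> snd c ` ((U \<inter> V) \<inter> fst c) \<Longrightarrow> conjg ((s \<circ> param c) z) J_mat = conjg ((t \<circ> param c) z) J_mat"
      using L_pair[OF L p(1)] by metis
    have "(s \<circ> param c) (snd c p) = (t \<circ> param c) (snd c p)" using p(2) param_snd[OF c(3,2)] by simp
    then obtain r where "r > 0" "ball (snd c p) r \<subseteq> snd c ` ((U \<inter> V) \<inter> fst c)"
      "\<And>z. z \<in> ball (snd c p) r \<Longrightarrow> (s \<circ> param c) z = (t \<circ> param c) z"
      using frames_agree_locally[OF c(5,6,7,4)] by metis
    then show "\<exists>T. openin (top_of_set M) T \<and> p \<in> T \<and> T \<subseteq> {p \<in> U \<inter> V. s p = t p}"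
      using nbhd_in_chart[OF c(3,2), of r "U \<inter> V" "\<lambda>q. s q = t q"] by auto
  qed
  show "openin (top_of_set M) {p \<in> U \<inter> V. s p \<noteq> t p}"
  proof (subst openin_subopen, intro ballI)
    fix p assume "p \<in> {p \<in> U \<inter> V. s p \<noteq> t p}"
    then have p: "p \<in> U \<inter> V" "s p \<noteq> t p" by auto
    obtain c where c: "c \<in> A" "p \<in> fst c" "chart_on M c" "snd c p \<in> snd c ` ((U \<inter> V) \<inter> fst c)"
      "flat_frame (snd c ` ((U \<inter> V) \<inter> fst c)) (s \<circ> param c)" "flat_frame (snd c ` ((U \<inter> V) \<inter> fst c)) (t \<circ> param c)"
      "\<And>z. z \<in> snd c ` ((U \<inter> V) \<inter> fst c) \<Longrightarrow> conjg ((s \<circ> param c) z) J_mat = conjg ((t \<circ> param c) z) J_mat"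
      using L_pair[OF L p(1)] by metis
    interpret fs: flat_frame "snd c ` ((U \<inter> V) \<inter> fst c)" "s \<circ> param c" by (rule c(5))
    interpret ft: flat_frame "snd c ` ((U \<inter> V) \<inter> fst c)" "t \<circ> param c" by (rule c(6))
    have "smooth_on (snd c ` ((U \<inter> V) \<inter> fst c)) (\<lambda>z. (s \<circ> param c) z - (t \<circ> param c) z)"
      by (intro smooth_on_diff fs.smooth_B ft.smooth_B fs.open_S)
    moreover have "(s \<circ> param c) (snd c p) - (t \<circ> param c) (snd c p) \<in> - {0}" using p(2) param_snd[OF c(3,2)] by simp
    ultimately obtain r where "r > 0" "ball (snd c p) r \<subseteq> snd c ` ((U \<inter> V) \<inter> fst c)"
      "\<And>z. z \<in> ball (snd c p) r \<Longrightarrow> (s \<circ> param c) z - (t \<circ> param c) z \<in> - {0}"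
      by (rule smooth_on_nbhd[OF _ fs.open_S c(4) open_Compl[OF closed_singleton]]) blast
    then show "\<exists>T. openin (top_of_set M) T \<and> p \<in> T \<and> T \<subseteq> {p \<in> U \<inter> V. s p \<noteq> t p}"
      using nbhd_in_chart[OF c(3,2), of r "U \<inter> V" "\<lambda>q. s q \<noteq> t q"] by auto
  qed
next
  fix p assume "p \<in> M"
  then obtain U s0 where U: "(U, s0) \<in> L" "p \<in> U" using local_solution by blast
  have oU: "openin (top_of_set M) U" using L_good(2)[OF U(1)] .
  have "\<exists>s. (U, s) \<in> L \<and> s q = t q" if V: "(V, t) \<in> L" "q \<in> U \<inter> V" for V t q
  proof -
    obtain c where c: "c \<in> A" "q \<in> fst c" "chart_on M c" "snd c q \<in> snd c ` ((U \<inter> V) \<inter> fst c)"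
      "flat_frame (snd c ` ((U \<inter> V) \<inter> fst c)) (s0 \<circ> param c)" "flat_frame (snd c ` ((U \<inter> V) \<inter> fst c)) (t \<circ> param c)"
      "\<And>z. z \<in> snd c ` ((U \<inter> V) \<inter> fst c) \<Longrightarrow> conjg ((s0 \<circ> param c) z) J_mat = conjg ((t \<circ> param c) z) J_mat"
      using L_pair[OF U(1) V] by metis
    define C where "C = adj2 (s0 q) ** t q"
    have C: "det C = 1" "conjg C J_mat = J_mat" "(C $ 1 $ 2 = 0 \<and> C $ 2 $ 1 = 0) \<or> (C $ 1 $ 1 = 0 \<and> C $ 2 $ 2 = 0)"
      using frame_change_monomial[OF c(5,6,7,4)] param_snd[OF c(3,2)] by (simp_all add: C_def)
    interpret f0: flat_frame "snd c ` ((U \<inter> V) \<inter> fst c)" "s0 \<circ> param c" by (rule c(5))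
    have d0: "det (s0 q) = 1" using f0.det_B[OF c(4)] param_snd[OF c(3,2)] by simp
    let ?s = "\<lambda>p. s0 p ** C"
    have "good d U ?s" if d: "d \<in> A" for d
    proof -
      have g: "good d U s0" using L_good(1)[OF U(1) d] .
      interpret fd: flat_frame "snd d ` (U \<inter> fst d)" "s0 \<circ> param d" using g by (simp add: good_def)
      have comp: "?s \<circ> param d = (\<lambda>z. (s0 \<circ> param d) z ** C)" by (simp add: o_def)
      show ?thesis
      proof (rule goodI[OF d oU])
        show "sl2_field (snd d ` (U \<inter> fst d)) (?s \<circ> param d)"
          unfolding comp
        proof
          show "smooth_on (snd d ` (U \<inter> fst d)) (\<lambda>z. (s0 \<circ> param d) z ** C)"
            by (intro smooth_on_mat_mult fd.smooth_B fd.open_S smooth_on_const)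
          show "det ((s0 \<circ> param d) z ** C) = 1" if "z \<in> snd d ` (U \<inter> fst d)" for z
            using fd.det_B[OF that] C(1) by (simp add: det_mul)
        qed (rule fd.open_S)
        show "F p = conjg (?s p) J_mat" if "p \<in> U \<inter> fst d" for p
          using g that C(2) by (simp add: good_def conjg_conjg[symmetric])
        \<comment> \<open>Conjugation by a monomial matrix only scales or exchanges the off-diagonal
          entries.\<close>
        show "mc (?s \<circ> param d) z v $ 1 $ 1 = 0" if z: "z \<in> snd d ` (U \<inter> fst d)" for z v
          unfolding comp mc_right_mult[OF fd.diff_B[OF z]]
          using C(3) fd.diag[OF z] fd.diag'[OF z] by (auto simp: mat2_mult_nth)
      qed
    qed
    then have "(U, ?s) \<in> L" using oU by (simp add: L_def)
    moreover have "?s q = t q" using d0 by (simp add: C_def matrix_mul_assoc adj2_mult)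
    ultimately show ?thesis by blast
  qed
  then show "\<exists>U. openin (top_of_set M) U \<and> p \<in> U \<and> (\<forall>V t q. (V, t) \<in> L \<and> q \<in> U \<inter> V \<longrightarrow> (\<exists>s. (U, s) \<in> L \<and> s q = t q))"
    using oU U(2) by blast
qed

text \<open>Being a flat frame is a local condition, so the global section inherits it from the
  sections that it coincides with near each point.\<close>

lemma global_frame:
  assumes sc: "simply_connected M"
  obtains B where "\<And>c. c \<in> A \<Longrightarrow> flat_frame (coords c) (B \<circ> param c)" "\<And>p. p \<in> M \<Longrightarrow> F p = conjg (B p) J_mat"
proof -
  obtain B where B: "\<And>q. q \<in> M \<Longrightarrow> \<exists>U t V. (U, t) \<in> L \<and> openin (top_of_set M) V \<and> q \<in> V \<and> V \<subseteq> U \<and> (\<forall>r\<in>V. B r = t r)"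
  proof (rule global_section[OF sc])
    show "\<exists>V. openin (top_of_set M) V \<and> q \<in> V \<and> V \<subseteq> U \<and> path_connected V" if "openin (top_of_set M) U" "q \<in> U" for U q
      by (rule path_connected_nbhd[OF surf that])
    show "\<exists>U s. (U, s) \<in> L \<and> q \<in> U" if "q \<in> M" for q using local_solution[OF that] by metis
  qed metis
  have loc: "\<exists>V. openin (top_of_set M) V \<and> q \<in> V \<and> (\<forall>c\<in>A. flat_frame (snd c ` (V \<inter> fst c)) (B \<circ> param c)) \<and> F q = conjg (B q) J_mat"
    if q: "q \<in> M" for q
  proof -
    obtain U t V where U: "(U, t) \<in> L" "openin (top_of_set M) V" "q \<in> V" "V \<subseteq> U" "\<forall>r\<in>V. B r = t r"
      using B[OF q] by blast
    have g: "good c V t" if "c \<in> A" for c by (rule good_subset[OF that L_good(1)[OF U(1) that] U(2,4)])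
    have "flat_frame (snd c ` (V \<inter> fst c)) (B \<circ> param c)" if c: "c \<in> A" for c
    proof (rule flat_frame_cong)
      show "flat_frame (snd c ` (V \<inter> fst c)) (t \<circ> param c)" using g[OF c] by (simp add: good_def)
      show "(t \<circ> param c) w = (B \<circ> param c) w" if "w \<in> snd c ` (V \<inter> fst c)" for w
        using that U(5) param_snd[OF chart[OF c]] by auto
    qed
    moreover obtain c where "c \<in> A" "q \<in> fst c" using cover[OF q] by blast
    then have "F q = conjg (B q) J_mat" using g[of c] U(3,5) by (auto simp: good_def)
    ultimately show ?thesis using U by blast
  qed
  show ?thesis
  proof (rule that)
    show "F p = conjg (B p) J_mat" if "p \<in> M" for p using loc[OF that] by blast
    fix c assume c: "c \<in> A"
    have ex: "\<exists>W. open W \<and> z \<in> W \<and> flat_frame W (B \<circ> param c)" if z: "z \<in> coords c" for z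
    proof -
      have p: "param c z \<in> fst c" "param c z \<in> M"
        using param_in[OF chart[OF c] z] fst_chart_subset[OF chart[OF c]] by auto
      obtain V where V: "openin (top_of_set M) V" "param c z \<in> V" "flat_frame (snd c ` (V \<inter> fst c)) (B \<circ> param c)"
        using loc[OF p(2)] c by blast
      have "z \<in> snd c ` (V \<inter> fst c)" using snd_param[OF chart[OF c] z] V(2) p(1) by (metis IntI imageI)
      then show ?thesis using open_chart_image[OF chart[OF c] V(1)] V(3) by blast
    qed
    show "flat_frame (coords c) (B \<circ> param c)"
    proof
      show "open (coords c)" by (rule chart_onD(2)[OF chart[OF c]])
      show "smooth_on (coords c) (B \<circ> param c)"
        by (rule smooth_on_local) (use ex in \<open>metis flat_frame.axioms(1) sl2_field.smooth_B\<close>)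
      fix z assume "z \<in> coords c"
      then obtain W where W: "z \<in> W" "flat_frame W (B \<circ> param c)" using ex by blast
      then interpret flat_frame W "B \<circ> param c" by simp
      show "det ((B \<circ> param c) z) = 1" by (rule det_B[OF W(1)])
      show "mc (B \<circ> param c) z v $ 1 $ 1 = 0" for v by (rule diag[OF W(1)])
      show "inj (frechet_derivative (\<lambda>z. conjg ((B \<circ> param c) z) J_mat) (at z))" by (rule inj_F[OF W(1)])
    qed
  qed
qed

end

section \<open>The complex structure defined by \<theta>\<close>

lemma dirD_compose:
  fixes f :: "'b::real_normed_vector \<Rightarrow> 'c::real_normed_vector"
  assumes "h differentiable (at z)" "f differentiable (at (h z))"
  shows "dirD (\<lambda>w. f (h w)) v z = dirD f (dirD h v z) (h z)"
  using frechet_derivative_at[OF has_derivative_compose[OF assms[unfolded frechet_derivative_works]]] by metis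

lemma differentiable_compose_at:
  fixes f :: "'b::real_normed_vector \<Rightarrow> 'c::real_normed_vector"
  assumes "h differentiable (at z)" "f differentiable (at (h z))"
  shows "(\<lambda>w. f (h w)) differentiable (at z)"
  using has_derivative_compose[OF assms[unfolded frechet_derivative_works]] by (auto simp: differentiable_def)

locale framed_immersion = flat_immersion +
  fixes B :: "'a \<Rightarrow> complex^2^2"
  assumes frame: "\<And>c. c \<in> A \<Longrightarrow> flat_frame (coords c) (B \<circ> param c)"
    and F_eq: "\<And>p. p \<in> M \<Longrightarrow> F p = conjg (B p) J_mat"
begin

abbreviation \<theta> :: "'a chart \<Rightarrow> complex \<Rightarrow> complex \<Rightarrow> complex" where
  "\<theta> d z v \<equiv> mc (B \<circ> param d) z v $ 1 $ 2"

text \<open>The complex coordinates are the local primitives of the closed form \<open>\<theta>\<close>.\<close>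

definition atlas :: "'a chart set" where
  "atlas = {c. chart_on M c \<and> (\<forall>d\<in>A. smooth_on (overlap d c) (transition d c) \<and>
     smooth_on (overlap c d) (transition c d) \<and> (\<forall>z\<in>overlap d c. \<forall>v. dirD (transition d c) v z = \<theta> d z v))}"

lemma atlasD:
  assumes "c \<in> atlas"
  shows "chart_on M c" "d \<in> A \<Longrightarrow> smooth_on (overlap d c) (transition d c)" "d \<in> A \<Longrightarrow> smooth_on (overlap c d) (transition c d)"
    "d \<in> A \<Longrightarrow> z \<in> overlap d c \<Longrightarrow> dirD (transition d c) v z = \<theta> d z v"
  using assms by (auto simp: atlas_def)

lemma det_B: "p \<in> M \<Longrightarrow> det (B p) = 1"
proof -
  assume "p \<in> M"
  then obtain c where c: "c \<in> A" "p \<in> fst c" using cover by blast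
  interpret flat_frame "coords c" "B \<circ> param c" by (rule frame[OF c(1)])
  show ?thesis using det_B[OF snd_in_coords[OF c(2)]] param_snd[OF chart[OF c(1)] c(2)] by simp
qed

text \<open>On a disc the closed form \<theta> has a primitive \<open>w\<close>, and
  \<open>quotient\<close> makes its Jacobian determinant nonzero, so \<open>w\<close> restricts to a
  chart. It is smoothly related to all charts of \<open>A\<close>, and \<theta> is its differential
  in each of them.\<close>

lemma atlas_cover:
  assumes p: "p \<in> M"
  shows "\<exists>c\<in>atlas. p \<in> fst c"
proof -
  obtain d0 where d0: "d0 \<in> A" "p \<in> fst d0" using cover[OF p] by blast
  note ch0 = chart[OF d0(1)]
  interpret fr: flat_frame "coords d0" "B \<circ> param d0" by (rule frame[OF d0(1)])
  let ?z0 = "snd d0 p"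
  have z0: "?z0 \<in> coords d0" by (rule snd_in_coords[OF d0(2)])
  obtain r where r: "r > 0" "ball ?z0 r \<subseteq> coords d0" using fr.open_S z0 open_contains_ball by blast
  let ?B = "ball ?z0 r"
  have sm: "smooth_on ?B (\<lambda>z. \<theta> d0 z v)" for v
    by (rule smooth_on_subset[OF smooth_on_mat_nth[OF smooth_on_mc[OF fr.open_S fr.smooth_B] fr.open_S] r(2)])
  have cl: "dirD (\<lambda>z. \<theta> d0 z 1) \<i> z = dirD (\<lambda>z. \<theta> d0 z \<i>) 1 z" if "z \<in> ?B" for z
    using fr.closed r(2) that by blast
  obtain w where w: "\<And>z. z \<in> ?B \<Longrightarrow> (w has_derivative (\<lambda>v. Re v *\<^sub>R \<theta> d0 z 1 + Im v *\<^sub>R \<theta> d0 z \<i>)) (at z)"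
    using Poincare_ball[OF sm sm cl] by blast
  have dw: "dirD w v z = \<theta> d0 z v" if "z \<in> ?B" for z v
  proof -
    have "dirD w v z = Re v *\<^sub>R \<theta> d0 z 1 + Im v *\<^sub>R \<theta> d0 z \<i>"
      using fun_cong[OF frechet_derivative_at[OF w[OF that]], of v] by simp
    also have "\<dots> = \<theta> d0 z v"
      using fr.mc_nth_expand[of z v 1 2] that r(2) by (auto simp: scaleR_conv_of_real)
    finally show ?thesis .
  qed
  have smw: "smooth_on ?B w"
    by (rule smooth_onI[OF open_ball w], assumption)
       (intro smooth_on_add smooth_on_bilinear[OF bounded_bilinear_scaleR] smooth_on_const sm open_ball)
  have nz: "Im (cnj (dirD w 1 z) * dirD w \<i> z) \<noteq> 0" if "z \<in> ?B" for z
    unfolding dw[OF that] using fr.quotient[of z] that r(2) by blast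
  have z0B: "?z0 \<in> ?B" using r(1) by simp
  obtain U V h where h: "open U" "U \<subseteq> ?B" "?z0 \<in> U" "open V" "homeomorphism U V w h" "smooth_on V h"
    using local_diffeo[OF open_ball z0B smw nz] by metis
  have hw: "h (w z) = z" "w z \<in> V" if "z \<in> U" for z using h(5) that by (auto simp: homeomorphism_def)
  have wh: "w (h y) = y" "h y \<in> U" if "y \<in> V" for y using h(5) that by (auto simp: homeomorphism_def)
  have Uc: "U \<subseteq> coords d0" using h(2) r(2) by blast
  define c where "c = (param d0 ` U, w \<circ> snd d0)"
  have fc: "fst c = param d0 ` U" and sc: "snd c = w \<circ> snd d0" by (simp_all add: c_def)
  have sub: "fst c \<subseteq> fst d0" unfolding fc using param_in[OF ch0] Uc by blast
  have sU: "snd d0 q \<in> U" "param d0 (snd d0 q) = q" if "q \<in> fst c" for q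
    using that snd_param[OF ch0] Uc unfolding fc by auto
  have co: "coords c = V"
  proof -
    have "coords c = w ` ((\<lambda>z. snd d0 (param d0 z)) ` U)" by (simp add: coords_def fc sc image_comp o_def)
    also have "(\<lambda>z. snd d0 (param d0 z)) ` U = U" using snd_param[OF ch0] Uc by force
    also have "w ` U = V" using h(5) by (simp add: homeomorphism_def)
    finally show ?thesis .
  qed
  have inj: "inj_on (snd c) (fst c)"
  proof (rule inj_onI)
    fix x y assume xy: "x \<in> fst c" "y \<in> fst c" "snd c x = snd c y"
    then have "h (w (snd d0 x)) = h (w (snd d0 y))" by (simp add: sc)
    then show "x = y" using hw sU xy by metis
  qed
  have par: "param c y = param d0 (h y)" if "y \<in> V" for y
    unfolding param_def
  proof (rule inv_into_f_eq[OF inj])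
    show "inv_into (fst d0) (snd d0) (h y) \<in> fst c" unfolding fc param_def[symmetric] using wh(2)[OF that] by blast
    have "h y \<in> coords d0" using wh(2)[OF that] Uc by blast
    then show "snd c (inv_into (fst d0) (snd d0) (h y)) = y"
      unfolding param_def[symmetric] sc using wh(1)[OF that] snd_param[OF ch0] by simp
  qed
  have chc: "chart_on M c"
    unfolding chart_on_def
  proof (intro conjI)
    show "openin (top_of_set M) (fst c)" unfolding fc by (rule openin_param_image[OF ch0 h(1) Uc])
    show "open (coords c)" using co h(4) by simp
    show "homeomorphism (fst c) (coords c) (snd c) (param c)"
      unfolding homeomorphism_def
    proof (intro conjI ballI)
      show "continuous_on (fst c) (snd c)"
        unfolding sc
      proof (rule continuous_on_compose)
        show "continuous_on (fst c) (snd d0)"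
          using chart_onD(3)[OF ch0] sub by (meson continuous_on_subset homeomorphism_def)
        have "snd d0 ` fst c \<subseteq> U" using sU by blast
        then show "continuous_on (snd d0 ` fst c) w"
          using h(5) by (meson continuous_on_subset homeomorphism_def)
      qed
      have "continuous_on (coords d0) (param d0)" "continuous_on V h"
        using chart_onD(3)[OF ch0] h(5) by (simp_all add: homeomorphism_def)
      moreover have "h ` V \<subseteq> coords d0" using wh(2) Uc by blast
      ultimately have "continuous_on V (\<lambda>y. param d0 (h y))" by (rule continuous_on_compose2)
      then show "continuous_on (coords c) (param c)" unfolding co using par by (simp cong: continuous_on_cong)
      show "snd c ` fst c = coords c" by (simp add: coords_def)
      show "param c (snd c x) = x" if "x \<in> fst c" for x unfolding param_def by (rule inv_into_f_f[OF inj that])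
      show "snd c (param c y) = y" if "y \<in> coords c" for y
        unfolding param_def using that by (intro f_inv_into_f) (simp add: coords_def)
      have "param c ` V = param d0 ` (h ` V)" using par by (force simp: image_image)
      also have "h ` V = U" using h(5) by (simp add: homeomorphism_def)
      finally show "param c ` coords c = fst c" by (simp add: co fc)
    qed
  qed
  have "c \<in> atlas"
    unfolding atlas_def
  proof (intro CollectI conjI ballI allI chc)
    fix d assume d: "d \<in> A"
    note chd = chart[OF d]
    let ?T = "transition d d0"
    have ov: "overlap d c \<subseteq> overlap d d0" using sub by (auto simp: overlap_def)
    have TU: "?T z \<in> U" if "z \<in> overlap d c" for z
      using transition_overlap(2)[OF chd chc that] sU(1) by (simp add: transition_def)
    have tr: "w (?T z) = transition d c z" for z by (simp add: transition_def sc)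
    show "smooth_on (overlap d c) (transition d c)"
    proof (rule smooth_on_cong_imp[OF open_overlap[OF chd chc]])
      show "smooth_on (overlap d c) (\<lambda>z. w (?T z))"
        by (rule smooth_on_compose[OF open_overlap[OF chd chc] smooth_on_subset[OF smooth_transition[OF d d0(1)] ov] smw])
          (use TU h(2) in blast)
    qed (rule tr)
    show "smooth_on (overlap c d) (transition c d)"
    proof (rule smooth_on_cong_imp[OF open_overlap[OF chc chd]])
      have V: "overlap c d \<subseteq> V" using overlap_coords co by blast
      have ho: "h y \<in> overlap d0 d" if y: "y \<in> overlap c d" for y
      proof -
        have yV: "y \<in> V" using V y by blast
        have q: "param d0 (h y) \<in> fst d" "param d0 (h y) \<in> fst d0"
          using transition_overlap(1,2)[OF chc chd y] sub unfolding par[OF yV] by auto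
        have "snd d0 (param d0 (h y)) = h y" using snd_param[OF ch0] wh(2)[OF yV] Uc by blast
        then show ?thesis using q unfolding overlap_def by (metis IntI imageI)
      qed
      show "smooth_on (overlap c d) (\<lambda>y. transition d0 d (h y))"
        by (rule smooth_on_compose[OF open_overlap[OF chc chd] smooth_on_subset[OF h(6) V] smooth_transition[OF d0(1) d]])
          (use ho in blast)
      show "transition d0 d (h y) = transition c d y" if "y \<in> overlap c d" for y
        using par[of y] V that by (auto simp: transition_def)
    qed
    fix z v assume z: "z \<in> overlap d c"
    have zo: "z \<in> overlap d d0" using ov z by blast
    have TB: "?T z \<in> ?B" using TU[OF z] h(2) by blast
    have Td: "?T differentiable (at z)" by (rule transition_differentiable[OF d d0(1) zo])
    have "dirD (transition d c) v z = dirD (\<lambda>z. w (?T z)) v z" by (simp add: tr)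
    also have "\<dots> = dirD w (dirD ?T v z) (?T z)"
      by (rule dirD_compose[OF Td smooth_on_differentiable[OF smw TB]])
    also have "\<dots> = \<theta> d0 (?T z) (dirD ?T v z)" by (rule dw[OF TB])
    also have "\<dots> = \<theta> d z v"
      using mc_change_chart[OF chd ch0 zo Td fr.diff_B] TB r(2) by (metis subsetD)
    finally show "dirD (transition d c) v z = \<theta> d z v" .
  qed
  moreover have "p \<in> fst c" unfolding fc using param_snd[OF ch0 d0(2)] h(3) by (metis imageI)
  ultimately show ?thesis by blast
qed

text \<open>In a chart of the atlas \<theta> is dz: \<open>transition d c\<close> has derivative
  \<theta>, and composed with \<open>transition c d\<close> it is the identity.\<close>

lemma atlas_chart:
  assumes c: "c \<in> atlas" and z: "z \<in> coords c"
  obtains d where "d \<in> A" "chart_on M d" "z \<in> overlap c d" "transition c d z \<in> coords d" "transition c d z \<in> overlap d c"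
    "param d (transition c d z) = param c z" "transition c d differentiable (at z)"
    "\<And>v. \<theta> d (transition c d z) (dirD (transition c d) v z) = v"
proof -
  note ch = atlasD(1)[OF c]
  have p: "param c z \<in> fst c" using param_in[OF ch z] .
  then have "param c z \<in> M" using fst_chart_subset[OF ch] by blast
  then obtain d where d: "d \<in> A" "param c z \<in> fst d" using cover by blast
  note chd = chart[OF d(1)]
  have zo: "z \<in> overlap c d" using p d(2) snd_param[OF ch z] unfolding overlap_def by (metis IntI imageI)
  note t = transition_overlap[OF ch chd zo]
  have T: "transition c d differentiable (at z)" using smooth_on_differentiable[OF atlasD(3)[OF c d(1)] zo] .
  have T': "transition d c differentiable (at (transition c d z))"
    using smooth_on_differentiable[OF atlasD(2)[OF c d(1)] t(3)] .
  have "\<theta> d (transition c d z) (dirD (transition c d) v z) = v" for v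
  proof -
    have "\<theta> d (transition c d z) (dirD (transition c d) v z) = dirD (transition d c) (dirD (transition c d) v z) (transition c d z)"
      using atlasD(4)[OF c d(1) t(3)] by simp
    also have "\<dots> = dirD (\<lambda>w. transition d c (transition c d w)) v z"
      by (rule dirD_compose[OF T T', symmetric])
    also have "\<dots> = dirD (\<lambda>w. w) v z"
      using frechet_derivative_cong_open[OF open_overlap[OF ch chd] zo, of "\<lambda>w. transition d c (transition c d w)" "\<lambda>w. w"]
        transition_overlap(6)[OF ch chd] by simp
    finally show ?thesis by (simp add: frechet_derivative_ident)
  qed
  then show ?thesis using that d(1) chd zo t(3-5) T by blast
qed

text \<open>Both coordinates are primitives of \<theta>. Through a chart of \<open>A\<close>, the
  derivative of the second is \<theta>, which by \<open>atlas_chart\<close> is dz in the first; so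
  the real derivative is the identity, hence complex linear.\<close>

lemma atlas_transition:
  assumes c: "c \<in> atlas" and c': "c' \<in> atlas" and z: "z \<in> overlap c c'"
  shows "(transition c c' has_field_derivative 1) (at z)"
proof -
  note ch = atlasD(1)[OF c] and ch' = atlasD(1)[OF c']
  obtain d where d: "d \<in> A" "chart_on M d" "z \<in> overlap c d" "transition c d z \<in> overlap d c"
    "param d (transition c d z) = param c z" "transition c d differentiable (at z)"
    "\<And>v. \<theta> d (transition c d z) (dirD (transition c d) v z) = v"
    using atlas_chart[OF c overlap_coords[OF z]] by metis
  let ?T = "transition c d" and ?N = "overlap c c' \<inter> overlap c d"
  have N: "open ?N" "z \<in> ?N" using open_overlap[OF ch ch'] open_overlap[OF ch d(2)] z d(3) by auto
  have eq: "transition d c' (?T w) = transition c c' w" if "w \<in> ?N" for w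
    using transition_overlap(5)[OF ch d(2)] that by (auto simp: transition_def)
  have y: "?T z \<in> overlap d c'"
  proof -
    have "param c z \<in> fst c'" "param c z \<in> fst d"
      using transition_overlap(2)[OF ch ch' z] transition_overlap(2)[OF ch d(2,3)] by auto
    then show ?thesis unfolding overlap_def transition_def by auto
  qed
  have T': "transition d c' differentiable (at (?T z))"
    using smooth_on_differentiable[OF atlasD(2)[OF c' d(1)] y] .
  have "((\<lambda>w. transition d c' (?T w)) has_derivative (\<lambda>v. dirD (transition d c') (dirD ?T v z) (?T z))) (at z)"
    using has_derivative_compose[OF d(6)[unfolded frechet_derivative_works] T'[unfolded frechet_derivative_works]] .
  moreover have "(\<lambda>v. dirD (transition d c') (dirD ?T v z) (?T z)) = (*) 1"
    by (rule ext) (simp only: atlasD(4)[OF c' d(1) y] d(7) mult_1_left)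
  ultimately have "((\<lambda>w. transition d c' (?T w)) has_field_derivative 1) (at z)"
    by (simp only: has_field_derivative_def)
  then show ?thesis
    unfolding has_field_derivative_def
    by (rule has_derivative_transform_within_open[OF _ N eq])
qed

text \<open>In the coordinate of \<open>c\<close> the form \<open>mc\<close> on a vector v is v
  times a fixed matrix with entries 1 and \<open>l\<close> off the diagonal. The real derivative of
  \<open>B\<close> is therefore complex linear, which is how holomorphy arises.\<close>

lemma B_derivative:
  assumes c: "c \<in> atlas" and z: "z \<in> coords c" and d: "d \<in> A" "chart_on M d" "z \<in> overlap c d" "transition c d z \<in> coords d"
    "param d (transition c d z) = param c z" "transition c d differentiable (at z)"
    "\<And>v. \<theta> d (transition c d z) (dirD (transition c d) v z) = v"
    and l: "\<And>v. mc (B \<circ> param d) (transition c d z) v $ 2 $ 1 = l * \<theta> d (transition c d z) v"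
  shows "((\<lambda>z. B (param c z) $ i $ j) has_field_derivative (B (param c z) ** vector [vector [0, 1], vector [l, 0]]) $ i $ j) (at z)"
proof -
  note ch = atlasD(1)[OF c]
  interpret fr: flat_frame "coords d" "B \<circ> param d" by (rule frame[OF d(1)])
  let ?y = "transition c d z" and ?u = "\<lambda>v. dirD (transition c d) v z"
  have eq: "(B \<circ> param c) w = (B \<circ> param d) (transition c d w)" if "w \<in> overlap c d" for w
    using transition_overlap(5)[OF ch d(2) that] by simp
  have diff: "(B \<circ> param c) differentiable (at z)"
    using differentiable_cong_open[OF open_overlap[OF ch d(2)] d(3), of "B \<circ> param c" "\<lambda>w. (B \<circ> param d) (transition c d w)"]
      differentiable_compose_at[OF d(6) fr.diff_B[OF d(4)]] eq by blast
  have "mc (B \<circ> param d) ?y (?u v) = vector [vector [0, v], vector [l * v, 0]]" for v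
    using fr.diag[OF d(4)] fr.diag'[OF d(4)] d(7) l by (simp add: mat2_eq_iff)
  then have "dirD (B \<circ> param c) v z = B (param c z) ** vector [vector [0, v], vector [l * v, 0]]" for v
    using dirD_change_chart[OF ch d(2,3,6) fr.diff_B[OF d(4)]] fr.dirD_B[OF d(4)] d(5) by simp
  then have e: "dirD (\<lambda>z. (B \<circ> param c) z $ i $ j) v z = (B (param c z) ** vector [vector [0, 1], vector [l, 0]]) $ i $ j * v" for v
    unfolding dirD_nth[OF diff] using exhaust_2[of j] by (auto simp: mat2_mult_nth)
  have "bounded_linear (\<lambda>X :: complex^2^2. X $ i $ j)"
    unfolding linear_conv_bounded_linear[symmetric] by (rule linearI) simp_all
  from bounded_linear.has_derivative[OF this diff[unfolded frechet_derivative_works]]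
  have "((\<lambda>z. (B \<circ> param c) z $ i $ j) has_derivative (\<lambda>v. dirD (B \<circ> param c) v z $ i $ j)) (at z)" .
  then show ?thesis
    using e unfolding dirD_nth[OF diff] by (simp add: has_field_derivative_def)
qed

lemma maurer_cartan_atlas:
  assumes c: "c \<in> atlas" and z: "z \<in> coords c" and d: "d \<in> A" "chart_on M d" "z \<in> overlap c d" "transition c d z \<in> coords d"
    "param d (transition c d z) = param c z" "transition c d differentiable (at z)"
    "\<And>v. \<theta> d (transition c d z) (dirD (transition c d) v z) = v"
    and l: "\<And>v. mc (B \<circ> param d) (transition c d z) v $ 2 $ 1 = l * \<theta> d (transition c d z) v"
  shows "maurer_cartan B c z = vector [vector [0, 1], vector [l, 0]]"
proof -
  have "param c z \<in> M" using param_in[OF atlasD(1)[OF c] z] fst_chart_subset[OF atlasD(1)[OF c]] by blast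
  then have det: "det (B (param c z)) = 1" by (rule det_B)
  have "(\<chi> i j. deriv (\<lambda>w. B (param c w) $ i $ j) z) = B (param c z) ** vector [vector [0, 1], vector [l, 0]]"
    by (simp add: vec_eq_iff DERIV_imp_deriv[OF B_derivative[OF assms]])
  then show ?thesis
    using det by (simp add: maurer_cartan_def matrix_inv_eq_adj2 matrix_mul_assoc adj2_mult)
qed

lemma atlas_frame:
  assumes c: "c \<in> atlas" and z: "z \<in> coords c"
  obtains l where "Im l \<noteq> 0" "maurer_cartan B c z = vector [vector [0, 1], vector [l, 0]]"
    "\<And>i j. (\<lambda>z. B (param c z) $ i $ j) field_differentiable (at z)"
proof -
  obtain d where d: "d \<in> A" "chart_on M d" "z \<in> overlap c d" "transition c d z \<in> coords d"
    "param d (transition c d z) = param c z" "transition c d differentiable (at z)"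
    "\<And>v. \<theta> d (transition c d z) (dirD (transition c d) v z) = v"
    using atlas_chart[OF c z] by metis
  interpret fr: flat_frame "coords d" "B \<circ> param d" by (rule frame[OF d(1)])
  obtain l where l: "Im l \<noteq> 0" "\<And>v. mc (B \<circ> param d) (transition c d z) v $ 2 $ 1 = l * \<theta> d (transition c d z) v"
    using fr.quotient[OF d(4)] by metis
  show ?thesis
    using that[OF l(1) maurer_cartan_atlas[OF c z d l(2)]] B_derivative[OF c z d l(2)] field_differentiable_def by blast
qed

text \<open>The coordinate change has derivative 1, so coefficients of dz do not change.\<close>

lemma maurer_cartan_invariant:
  assumes c: "c \<in> atlas" and c': "c' \<in> atlas" and z: "z \<in> overlap c c'"
  shows "maurer_cartan B c z = maurer_cartan B c' (transition c c' z)"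
proof -
  note ch = atlasD(1)[OF c] and ch' = atlasD(1)[OF c']
  note t = transition_overlap[OF ch ch' z]
  have zc: "z \<in> coords c" by (rule overlap_coords[OF z])
  let ?z' = "transition c c' z"
  obtain l where l: "maurer_cartan B c z = vector [vector [0, 1], vector [l, 0]]" using atlas_frame[OF c zc] by metis
  obtain l' where l': "maurer_cartan B c' ?z' = vector [vector [0, 1], vector [l', 0]]" using atlas_frame[OF c' t(4)] by metis
  have der: "deriv (\<lambda>w. B (param c w) $ i $ j) z = deriv (\<lambda>w. B (param c' w) $ i $ j) ?z'" for i j
  proof -
    have "(\<lambda>w. B (param c' w) $ i $ j) field_differentiable (at ?z')" using atlas_frame[OF c' t(4)] by metis
    then have "((\<lambda>w. B (param c' w) $ i $ j) has_field_derivative deriv (\<lambda>w. B (param c' w) $ i $ j) ?z') (at ?z')"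
      by (simp add: field_differentiable_derivI)
    from DERIV_chain2[OF this atlas_transition[OF c c' z]]
    have "((\<lambda>w. B (param c' (transition c c' w)) $ i $ j) has_field_derivative deriv (\<lambda>w. B (param c' w) $ i $ j) ?z') (at z)"
      by simp
    then have "((\<lambda>w. B (param c w) $ i $ j) has_field_derivative deriv (\<lambda>w. B (param c' w) $ i $ j) ?z') (at z)"
      unfolding has_field_derivative_def
      by (rule has_derivative_transform_within_open[OF _ open_overlap[OF ch ch'] z])
         (simp add: transition_overlap(5)[OF ch ch'])
    then show ?thesis by (rule DERIV_imp_deriv)
  qed
  show ?thesis unfolding maurer_cartan_def der t(5) ..
qed

text \<open>As \<theta> is dz in every chart of the atlas, its coefficient is 1, and that of
  \<omega> is the remaining entry of \<open>maurer_cartan\<close>. Smoothness of the union of the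
  atlases says that the complex structure induces the given smooth one.\<close>

theorem complex_structure:
  "\<exists>A' \<theta> \<omega>. riemann_surface M A' \<and> smooth_surface M (A \<union> A') \<and>
     holomorphic_to_SL2 M A' B \<and> holomorphic_1form A' \<theta> \<and> nowhere_vanishing A' \<theta> \<and>
     holomorphic_1form A' \<omega> \<and> nowhere_vanishing A' \<omega> \<and> Im_quotient_nonzero A' \<omega> \<theta> \<and>
     has_maurer_cartan_form A' B \<theta> \<omega>"
proof (intro exI conjI)
  let ?t = "\<lambda>(c :: 'a chart) (z :: complex). 1 :: complex" and ?o = "\<lambda>c z. maurer_cartan B c z $ 2 $ 1"
  have top: "connected M" "Hausdorff_space (top_of_set M)" "second_countable_set M" "(\<Union>c\<in>A. fst c) = M"
    using surf by (auto simp: smooth_surface_def topological_surface_def)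
  have un: "(\<Union>c\<in>atlas. fst c) = M"
  proof
    show "(\<Union>c\<in>atlas. fst c) \<subseteq> M" using fst_chart_subset[OF atlasD(1)] by blast
    show "M \<subseteq> (\<Union>c\<in>atlas. fst c)" using atlas_cover by blast
  qed
  have hol: "transition c c' holomorphic_on overlap c c'" if "c \<in> atlas" "c' \<in> atlas" for c c'
    using atlas_transition[OF that] open_overlap[OF atlasD(1)[OF that(1)] atlasD(1)[OF that(2)]]
    by (auto simp: holomorphic_on_open)
  show "riemann_surface M atlas"
    unfolding riemann_surface_def topological_surface_def using top un atlasD(1) hol by blast
  show "smooth_surface M (A \<union> atlas)"
    unfolding smooth_surface_def topological_surface_def
  proof (intro conjI ballI top)
    show "chart_on M c" if "c \<in> A \<union> atlas" for c using that chart atlasD(1) by blast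
    show "(\<Union>c\<in>A \<union> atlas. fst c) = M" using top(4) un by blast
    show "smooth_on (overlap c d) (transition c d)" if cd: "c \<in> A \<union> atlas" "d \<in> A \<union> atlas" for c d
    proof -
      consider "c \<in> A" "d \<in> A" | "c \<in> A" "d \<in> atlas" | "c \<in> atlas" "d \<in> A" | "c \<in> atlas" "d \<in> atlas" using cd by blast
      then show ?thesis
      proof cases
        case 1 then show ?thesis by (rule smooth_transition)
      next
        case 2 then show ?thesis using atlasD(2) by blast
      next
        case 3 then show ?thesis using atlasD(3) by blast
      next
        case 4
        then show ?thesis
          using smooth_on_holomorphic[OF hol[OF 4] open_overlap[OF atlasD(1)[OF 4(1)] atlasD(1)[OF 4(2)]]] by blast
      qed
    qed
  qed
  have holB: "(\<lambda>z. B (param c z) $ i $ j) holomorphic_on coords c" if c: "c \<in> atlas" for c i j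
    unfolding holomorphic_on_def
  proof
    fix z assume "z \<in> coords c"
    then have "(\<lambda>z. B (param c z) $ i $ j) field_differentiable (at z)" using atlas_frame[OF c] by metis
    then show "(\<lambda>z. B (param c z) $ i $ j) field_differentiable (at z within coords c)"
      by (rule field_differentiable_at_within)
  qed
  show "holomorphic_to_SL2 M atlas B"
    unfolding holomorphic_to_SL2_def using det_B holB by blast
  show "has_maurer_cartan_form atlas B ?t ?o"
    unfolding has_maurer_cartan_form_def
  proof (intro ballI)
    fix c z assume "c \<in> atlas" "z \<in> coords c"
    then obtain l where "maurer_cartan B c z = vector [vector [0, 1], vector [l, 0]]" using atlas_frame by metis
    then show "maurer_cartan B c z = vector [vector [0, 1], vector [maurer_cartan B c z $ 2 $ 1, 0]]" by simp
  qed
  have Im: "Im (?o c z) \<noteq> 0" if cz: "c \<in> atlas" "z \<in> coords c" for c z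
  proof -
    obtain l where l: "Im l \<noteq> 0" "maurer_cartan B c z = vector [vector [0, 1], vector [l, 0]]" using atlas_frame[OF cz] by metis
    show ?thesis unfolding l(2) using l(1) by simp
  qed
  then show "Im_quotient_nonzero atlas ?o ?t" by (simp add: Im_quotient_nonzero_def)
  show "nowhere_vanishing atlas ?t" by (simp add: nowhere_vanishing_def)
  show "nowhere_vanishing atlas ?o"
    unfolding nowhere_vanishing_def using Im by (metis zero_complex.sel(2))
  have dtr: "deriv (transition c d) z = 1" if "c \<in> atlas" "d \<in> atlas" "z \<in> overlap c d" for c d z
    by (rule DERIV_imp_deriv[OF atlas_transition[OF that]])
  then show "holomorphic_1form atlas ?t" by (simp add: holomorphic_1form_def)
  show "holomorphic_1form atlas ?o"
    unfolding holomorphic_1form_def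
  proof (intro conjI ballI)
    fix c assume c: "c \<in> atlas"
    have o: "open (coords c)" by (rule chart_onD(2)[OF atlasD(1)[OF c]])
    \<comment> \<open>Holomorphy of \<omega> comes from that of \<open>B\<close>: the coefficient is
      a polynomial in entries of \<open>B\<close> and their derivatives.\<close>
    have eq: "maurer_cartan B c z $ 2 $ 1 = - (B (param c z) $ 2 $ 1) * deriv (\<lambda>w. B (param c w) $ 1 $ 1) z
       + B (param c z) $ 1 $ 1 * deriv (\<lambda>w. B (param c w) $ 2 $ 1) z" if z: "z \<in> coords c" for z
    proof -
      have "param c z \<in> M" using param_in[OF atlasD(1)[OF c] z] fst_chart_subset[OF atlasD(1)[OF c]] by blast
      then show ?thesis
        using det_B by (simp add: maurer_cartan_def matrix_inv_eq_adj2 mat2_mult_nth)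
    qed
    have "(\<lambda>z. - (B (param c z) $ 2 $ 1) * deriv (\<lambda>w. B (param c w) $ 1 $ 1) z
       + B (param c z) $ 1 $ 1 * deriv (\<lambda>w. B (param c w) $ 2 $ 1) z) holomorphic_on coords c"
      by (intro holomorphic_on_add holomorphic_on_mult holomorphic_on_minus holomorphic_deriv holB c o)
    then show "?o c holomorphic_on coords c" using eq by (simp cong: holomorphic_cong)
  next
    fix c d z assume "c \<in> atlas" "d \<in> atlas" "z \<in> overlap c d"
    then show "maurer_cartan B c z $ 2 $ 1 = maurer_cartan B d (transition c d z) $ 2 $ 1 * deriv (transition c d) z"
      using dtr maurer_cartan_invariant by simp
  qed
qed

end

theorem flat_immersion_imp_holomorphic_frame:
  assumes sc: "simply_connected M" and surf: "flat_timelike_surface M A g"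
    and iso: "isometric_immersion_in_de_sitter M A g F"
  shows "\<exists>A' B \<theta> \<omega>. riemann_surface M A' \<and> smooth_surface M (A \<union> A') \<and>
     holomorphic_to_SL2 M A' B \<and> holomorphic_1form A' \<theta> \<and> nowhere_vanishing A' \<theta> \<and>
     holomorphic_1form A' \<omega> \<and> nowhere_vanishing A' \<omega> \<and> Im_quotient_nonzero A' \<omega> \<theta> \<and>
     has_maurer_cartan_form A' B \<theta> \<omega> \<and> (\<forall>p\<in>M. F p = conjg (B p) J_mat)"
proof -
  interpret flat_immersion M A g F
    using surf iso by unfold_locales (auto simp: flat_timelike_surface_def)
  obtain B where B: "\<And>c. c \<in> A \<Longrightarrow> flat_frame (coords c) (B \<circ> param c)" "\<And>p. p \<in> M \<Longrightarrow> F p = conjg (B p) J_mat"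
    using global_frame[OF sc] by metis
  interpret framed_immersion M A g F B
    by (intro framed_immersion.intro framed_immersion_axioms.intro flat_immersion_axioms B)
  from complex_structure B(2) show ?thesis by blast
qed

theorem corollary7p1:
  fixes M :: "'a::topological_space set"
  shows
    "(\<forall>(A :: 'a chart set) B \<theta> \<omega>.
        riemann_surface M A \<and> holomorphic_to_SL2 M A B \<and>
        holomorphic_1form A \<theta> \<and> nowhere_vanishing A \<theta> \<and>
        holomorphic_1form A \<omega> \<and> nowhere_vanishing A \<omega> \<and>
        has_maurer_cartan_form A B \<theta> \<omega> \<and> Im_quotient_nonzero A \<omega> \<theta>
        \<longrightarrow> (let F = (\<lambda>p. B p ** J_mat ** conj_transpose (B p)) in
              flat_timelike_surface M A (induced_metric F) \<and>
              isometric_immersion_in_de_sitter M A (induced_metric F) F))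
     \<and>
     (\<forall>(A :: 'a chart set) g F.
        simply_connected M \<and> flat_timelike_surface M A g \<and>
        isometric_immersion_in_de_sitter M A g F
        \<longrightarrow> (\<exists>(A' :: 'a chart set) B \<theta> \<omega>.
              riemann_surface M A' \<and> smooth_surface M (A \<union> A') \<and>
              holomorphic_to_SL2 M A' B \<and>
              holomorphic_1form A' \<theta> \<and> nowhere_vanishing A' \<theta> \<and>
              holomorphic_1form A' \<omega> \<and> nowhere_vanishing A' \<omega> \<and>
              Im_quotient_nonzero A' \<omega> \<theta> \<and>
              has_maurer_cartan_form A' B \<theta> \<omega> \<and>
              (\<forall>p\<in>M. F p = B p ** J_mat ** conj_transpose (B p))))"
proof (intro conjI allI impI, goal_cases)
  case (1 A B \<theta> \<omega>)
  then show ?case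
    unfolding Let_def conjg_def[symmetric]
    by (intro conjI holomorphic_frame_imp_flat_immersion[of M A B \<theta> \<omega>]) simp_all
next
  case (2 A g F)
  then show ?case
    unfolding conjg_def[symmetric]
    using flat_immersion_imp_holomorphic_frame[of M A g F] by blast
qed

end
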